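(* Let $f\colon\mathbb{R}^n\to\mathbb{R}$ be a locally Lipschitz, Whitney $C^n$-stratifiable function, with a fixed Whitney $C^n$ stratification of its graph, and let $x$ be a point in the accumulation set of a bounded sequence $\{x_i\}_{i\in\mathbb{N}}$ generated by the subgradient method with step sizes $\{\varepsilon_i\}_{i\in\mathbb{N}}$ and subgradients $v_i\in\partial^cf(x_i)$, i.e. $x_{i+1}=x_i-\varepsilon_iv_i$. Assume that there is a subsequence $x_{i_j}\to x$ with $$\limsup_{j\to+\infty}\|v_{i_j}\|>0.$$ Then $x$ is contained in a stratum $S$ of dimension less than $n$, and if $w$ is tangent to $S$ at $x$, then $$\lim_{j\to+\infty}w\cdot v_{i_j}=0.$$
   Context: **Clarke subdifferential.** For a locally Lipschitz $f\colon\mathbb{R}^n\to\mathbb{R}$, $\partial^c f(x)$ is the closed convex hull of the set of $v\in\mathbb{R}^n$ for which there is a sequence $y_k\to x$ of differentiability points of $f$ with $\nabla f(y_k)\to v$. **Subgradient method.** $\{\varepsilon_i\}_{i\in\mathbb{N}}$ is a sequence of positive step sizes with $\sum_{i=0}^\infty\varepsilon_i=+\infty$ and $\varepsilon_i\searrow0$ (nonincreasing, converging to $0$). Given $x_0\in\mathbb{R}^n$, a subgradient sequence is any sequence with $x_{i+1}=x_i-\varepsilon_i v_i$, where $v_i$ is chosen freely in $\partial^c f(x_i)$, $i\geq0$. Its accumulation set is the set of its limit points. **Whitney stratification.** Let $X$ be a nonempty subset of $\mathbb{R}^m$ and $p>0$. A $C^p$ stratification $\{X_i\}_{i\in I}$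 of $X$ is a locally finite partition $X=\bigsqcup_i X_i$ into connected submanifolds $X_i$ of $\mathbb{R}^m$ of class $C^p$ (the strata) such that for each $i\neq j$, $\overline{X_i}\cap X_j\neq\emptyset$ implies $X_j\subset\overline{X_i}\setminus X_i$. It satisfies Whitney's condition (a) if, for each $x\in\overline{X_i}\cap X_j$, $i\neq j$, and each sequence $\{x_k\}_k\subset X_i$ with $x_k\to x$ such that the tangent spaces $T_{x_k}X_i$ converge (in the Grassmannian) to a subspace $V\subset T_x\mathbb{R}^m$, we have $T_xX_j\subset V$. A $C^p$ stratification is Whitney if it satisfies Whitney's condition (a). **Whitney stratifiable function.** $f\colon\mathbb{R}^n\to\mathbb{R}$ is Whitney $C^p$-stratifiable if there is a Whitney $C^p$ stratification of its graph as a subset of $\mathbb{R}^{n+1}$. The strata in $\mathbb{R}^n$ referred to in the claim are the images of the strata of the graph under the projection $(x,f(x))\mapsto x$; since $f$ is locally Lipschitz these are $C^p$ submanifolds of $\mathbb{R}^n$ of the same dimensions. *)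

theory Defs
  imports "HOL-Analysis.Analysis"
begin

definition locally_lipschitz :: "('a::metric_space \<Rightarrow> 'b::metric_space) \<Rightarrow> bool" where
  "locally_lipschitz f \<longleftrightarrow> (\<forall>x. \<exists>r>0. \<exists>L. L-lipschitz_on (ball x r) f)"

definition clarke_subdifferential :: "('a::euclidean_space \<Rightarrow> real) \<Rightarrow> 'a \<Rightarrow> 'a set" where
  "clarke_subdifferential f x =
     closure (convex hull {v. \<exists>y g. y \<longlonglongrightarrow> x \<and> (\<forall>k::nat. GDERIV f (y k) :> g k) \<and> g \<longlonglongrightarrow> v})"

definition step_sizes :: "(nat \<Rightarrow> real) \<Rightarrow> bool" where
  "step_sizes \<epsilon> \<longleftrightarrow> (\<forall>i. 0 < \<epsilon> i) \<and> filterlim (\<lambda>N. \<Sum>i<N. \<epsilon> i) at_top sequentially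
     \<and> decseq \<epsilon> \<and> \<epsilon> \<longlonglongrightarrow> 0"

definition subgradient_sequence ::
  "('a::euclidean_space \<Rightarrow> real) \<Rightarrow> (nat \<Rightarrow> real) \<Rightarrow> (nat \<Rightarrow> 'a) \<Rightarrow> (nat \<Rightarrow> 'a) \<Rightarrow> bool" where
  "subgradient_sequence f \<epsilon> x v \<longleftrightarrow>
     (\<forall>i. v i \<in> clarke_subdifferential f (x i) \<and> x (Suc i) = x i - \<epsilon> i *\<^sub>R v i)"

definition accumulation_set :: "(nat \<Rightarrow> 'a::topological_space) \<Rightarrow> 'a set" where
  "accumulation_set x = {l. \<exists>r::nat \<Rightarrow> nat. strict_mono r \<and> (x \<circ> r) \<longlonglongrightarrow> l}"

(* Only used for open U: all partial derivatives up to order p exist, are (Frechet)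
   differentiable below order p, and are continuous. *)
fun Ck_on :: "nat \<Rightarrow> ('a::euclidean_space \<Rightarrow> 'b::real_normed_vector) \<Rightarrow> 'a set \<Rightarrow> bool" where
  "Ck_on 0 f U \<longleftrightarrow> continuous_on U f"
| "Ck_on (Suc p) f U \<longleftrightarrow> f differentiable_on U
     \<and> (\<forall>b\<in>Basis. Ck_on p (\<lambda>x. frechet_derivative f (at x) b) U)"

(* Embedded submanifolds, via charts of the ambient space that straighten M to a
   d-dimensional linear subspace. *)
definition submanifold :: "nat \<Rightarrow> nat \<Rightarrow> 'a::euclidean_space set \<Rightarrow> bool" where
  "submanifold p d M \<longleftrightarrow>
     (\<forall>x\<in>M. \<exists>U V L \<phi> \<psi>. open U \<and> x \<in> U \<and> open (V::'a set) \<and> homeomorphism U V \<phi> \<psi>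
        \<and> Ck_on p \<phi> U \<and> Ck_on p \<psi> V
        \<and> subspace L \<and> dim L = d \<and> \<phi> ` (M \<inter> U) = V \<inter> L)"

definition tangent_space :: "'a::euclidean_space set \<Rightarrow> 'a \<Rightarrow> 'a set" where
  "tangent_space M x =
     {w. \<exists>\<gamma> e. 0 < e \<and> \<gamma> C1_differentiable_on {-e<..<e} \<and> \<gamma> ` {-e<..<e} \<subseteq> M \<and> \<gamma> 0 = x
        \<and> (\<gamma> has_vector_derivative w) (at 0)}"

(* Convergence in a Grassmannian for the metric given by the operator norm of the difference
   of the orthogonal projections; closest_point V is the orthogonal projection onto V. *)
definition grassmannian_tendsto :: "(nat \<Rightarrow> 'a::euclidean_space set) \<Rightarrow> 'a set \<Rightarrow> bool" where
  "grassmannian_tendsto T V \<longleftrightarrow>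
     subspace V \<and> (\<forall>k. subspace (T k) \<and> dim (T k) = dim V)
     \<and> (\<lambda>k. onorm (\<lambda>u. closest_point (T k) u - closest_point V u)) \<longlonglongrightarrow> 0"

definition stratification :: "nat \<Rightarrow> 'a::euclidean_space set \<Rightarrow> 'a set set \<Rightarrow> bool" where
  "stratification p X \<X> \<longleftrightarrow>
     0 < p \<and> X \<noteq> {} \<and> partition_on X \<X> \<and> locally_finite_in (top_of_set X) \<X>
     \<and> (\<forall>A\<in>\<X>. connected A \<and> (\<exists>d. submanifold p d A))
     \<and> (\<forall>A\<in>\<X>. \<forall>B\<in>\<X>. A \<noteq> B \<longrightarrow> closure A \<inter> B \<noteq> {} \<longrightarrow> B \<subseteq> closure A - A)"

definition whitney_condition_a :: "'a::euclidean_space set set \<Rightarrow> bool" where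
  "whitney_condition_a \<X> \<longleftrightarrow>
     (\<forall>A\<in>\<X>. \<forall>B\<in>\<X>. A \<noteq> B \<longrightarrow> (\<forall>x \<in> closure A \<inter> B. \<forall>y V.
        (\<forall>k. y k \<in> A) \<longrightarrow> y \<longlonglongrightarrow> x \<longrightarrow> grassmannian_tendsto (\<lambda>k. tangent_space A (y k)) V \<longrightarrow>
        tangent_space B x \<subseteq> V))"

definition whitney_stratification :: "nat \<Rightarrow> 'a::euclidean_space set \<Rightarrow> 'a set set \<Rightarrow> bool" where
  "whitney_stratification p X \<X> \<longleftrightarrow> stratification p X \<X> \<and> whitney_condition_a \<X>"

definition graph_of :: "('a \<Rightarrow> 'b) \<Rightarrow> ('a \<times> 'b) set" where
  "graph_of f = range (\<lambda>x. (x, f x))"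

definition whitney_stratifiable :: "nat \<Rightarrow> ('a::euclidean_space \<Rightarrow> real) \<Rightarrow> bool" where
  "whitney_stratifiable p f \<longleftrightarrow> (\<exists>\<X>. whitney_stratification p (graph_of f) \<X>)"

definition projected_strata :: "('a \<times> 'b) set set \<Rightarrow> 'a set set" where
  "projected_strata \<X> = (\<lambda>A. fst ` A) ` \<X>"

end

(*
  Along a stratum of the graph of f, Whitney's condition (a) makes w . v close to the slope w' for every
  tangent vector (w, w') at (x, f x) and every Clarke subgradient v at a point near x; the gradients at
  differentiability points of whatever strata accumulate at x suffice to see this. So it remains to
  prove that every limit point x of the sequence is critical for f on its stratum (all w' = 0).

  Interpolate the iterates linearly. A limit of time shifts of the interpolation is a Lipschitz curve g.
  At every time outside a countable set, g returns to one and the same stratum along a sequence of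
  times, and there the projection formula gives f o g a derived number -|p|^2, p being a limit of
  difference quotients of g. By Vitali's covering theorem f strictly decreases along g near a
  noncritical starting point. By the Morse-Sard theorem (which needs class C^n) there are noncritical
  levels in any interval, and at such a level the values of f along the sequence cannot cross
  upwards infinitely often; hence f converges along the sequence, which excludes noncritical limit points.

  The Morse-Sard theorem is proved by Morse's lemma: every set A is a countable union of pieces, each
  covered by a parametrised compact convex set of dimension at most n, such that all C^k functions
  vanishing on A are o(|x - y|^k) on the parametrisation near the piece.
*)
theory Submission
  imports Defs "HOL-Complex_Analysis.Great_Picard"
begin

section \<open>Functions of class $C^k$ and the inverse function theorem\<close>

text \<open>The obstacle is the chain rule: \<open>f\<close> and the limit curve are only Lipschitz.
  Limits of difference quotients along a single sequence of times are enough. If the points of the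
  graph over these times lie in one stratum, the limit (p, p') is tangent to it, so p . w is close
  to p' for all nearby subgradients w. The quotients of the curve are limits of averages of -v_i,
  whence p . p = -p'; this is the origin of -|p|^2. It stays away from 0 because a tangent vector
  (u, u') at the starting point with u' nonzero forces |u . q| to be at least |u'|/2 for every early
  quotient q. Descent holds only in the limit of late times, so \<open>f\<close> need not decrease
  along the iterates; hence the detour through a level that is regular on all strata. Class C^n
  suffices for Morse-Sard because tangent spaces of a Lipschitz graph contain no vertical vectors,
  so that strata have dimension at most n. At a limit point all slopes vanish, so w . v tends to 0
  for tangent w. On a stratum of dimension n every direction is tangent and v would tend to 0; the
  positive limsup forbids this.\<close>

lemma Ck_on_cong:
  assumes "open U" "\<And>x. x \<in> U \<Longrightarrow> f x = g x" "Ck_on p f U"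
  shows "Ck_on p g U"
  using assms
proof (induction p arbitrary: f g)
  case 0
  then show ?case by (simp cong: continuous_on_cong)
next
  case (Suc p)
  have der: "(g has_derivative frechet_derivative f (at x)) (at x)" if "x \<in> U" for x
  proof (rule has_derivative_transform_within_open[OF _ \<open>open U\<close> that Suc.prems(2)])
    show "(f has_derivative frechet_derivative f (at x)) (at x)"
      using Suc.prems that by (auto simp: differentiable_on_eq_differentiable_at frechet_derivative_works)
  qed auto
  then have eq: "frechet_derivative f (at x) = frechet_derivative g (at x)" if "x \<in> U" for x
    using frechet_derivative_at that by blast
  have "g differentiable_on U"
    using der by (meson Suc.prems(1) differentiable_def differentiable_on_def differentiable_at_withinI)
  moreover have "Ck_on p (\<lambda>x. frechet_derivative g (at x) b) U" if "b \<in> Basis" for b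
    using Suc.IH[OF \<open>open U\<close>, of "\<lambda>x. frechet_derivative f (at x) b"] eq Suc.prems(3) that by simp
  ultimately show ?case by simp
qed

lemma Ck_on_SucI:
  assumes "open U" "\<And>x. x \<in> U \<Longrightarrow> (f has_derivative f' x) (at x)"
    "\<And>b. b \<in> Basis \<Longrightarrow> Ck_on p (\<lambda>x. f' x b) U"
  shows "Ck_on (Suc p) f U"
proof -
  have "Ck_on p (\<lambda>x. frechet_derivative f (at x) b) U" if "b \<in> Basis" for b
  proof (rule Ck_on_cong[OF \<open>open U\<close> _ assms(3)[OF that]])
    show "f' x b = frechet_derivative f (at x) b" if "x \<in> U" for x
      using frechet_derivative_at[OF assms(2)[OF that]] by simp
  qed
  moreover have "f differentiable_on U"
    using assms(2) by (auto simp: differentiable_on_eq_differentiable_at[OF \<open>open U\<close>] differentiable_def)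
  ultimately show ?thesis by simp
qed

lemma Ck_on_has_derivative:
  assumes "open U" "Ck_on (Suc p) f U" "x \<in> U"
  shows "(f has_derivative frechet_derivative f (at x)) (at x)"
  using assms by (auto simp: differentiable_on_eq_differentiable_at frechet_derivative_works)

lemma Ck_on_partial:
  assumes "Ck_on (Suc p) f U" "b \<in> Basis"
  shows "Ck_on p (\<lambda>x. frechet_derivative f (at x) b) U"
  using assms by simp

lemma Ck_on_subset:
  assumes "Ck_on p f U" "open U" "open V" "V \<subseteq> U"
  shows "Ck_on p f V"
  using assms
proof (induction p arbitrary: f)
  case 0
  then show ?case by (auto intro: continuous_on_subset)
next
  case (Suc p)
  have "Ck_on p (\<lambda>x. frechet_derivative f (at x) b) V" if "b \<in> Basis" for b
    using Suc.IH[OF Ck_on_partial[OF Suc.prems(1) that]] Suc.prems by blast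
  moreover have "f differentiable_on V" using Suc.prems differentiable_on_subset by auto
  ultimately show ?case by simp
qed

lemma Ck_on_imp_continuous_on:
  assumes "Ck_on p f U"
  shows "continuous_on U f"
  using assms by (cases p) (auto dest: differentiable_imp_continuous_on simp del: Ck_on.simps(1), auto)

lemma Ck_on_Suc_imp:
  assumes "Ck_on (Suc p) f U"
  shows "Ck_on p f U"
  using assms
proof (induction p arbitrary: f)
  case 0
  then show ?case using differentiable_imp_continuous_on by auto
next
  case (Suc p)
  have "Ck_on p (\<lambda>x. frechet_derivative f (at x) b) U" if "b \<in> Basis" for b
    by (rule Suc.IH) (rule Ck_on_partial[OF Suc.prems that])
  moreover have "f differentiable_on U" using Suc.prems by simp
  ultimately show ?case by simp
qed

lemma Ck_on_mono:
  assumes "Ck_on p f U" "q \<le> p"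
  shows "Ck_on q f U"
  using assms(2,1)
proof (induction rule: dec_induct)
  case (step n)
  then show ?case using Ck_on_Suc_imp[OF step.prems] by simp
qed

lemma Ck_on_const:
  assumes "open U"
  shows "Ck_on p (\<lambda>x. c) U"
proof (induction p arbitrary: c)
  case (Suc p)
  show ?case
    by (rule Ck_on_SucI[where f' = "\<lambda>x h. 0", OF assms has_derivative_const Suc.IH])
qed auto

lemma Ck_on_bounded_linear: "open U \<Longrightarrow> bounded_linear T \<Longrightarrow> Ck_on p T U"
proof (cases p)
  case (Suc q)
  assume T: "open U" "bounded_linear T"
  show ?thesis unfolding Suc
    by (rule Ck_on_SucI[where f' = "\<lambda>x. T"]) (use T Ck_on_const in \<open>auto intro: bounded_linear_imp_has_derivative\<close>)
qed (auto intro: linear_continuous_on)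

lemma Ck_on_add:
  assumes "open U" "Ck_on p f U" "Ck_on p g U"
  shows "Ck_on p (\<lambda>x. f x + g x) U"
  using assms
proof (induction p arbitrary: f g)
  case 0 then show ?case by (simp add: continuous_on_add)
next
  case (Suc p)
  show ?case
  proof (rule Ck_on_SucI)
    fix x assume "x \<in> U"
    show "((\<lambda>x. f x + g x) has_derivative
       (\<lambda>h. frechet_derivative f (at x) h + frechet_derivative g (at x) h)) (at x)"
      by (intro has_derivative_add Ck_on_has_derivative[OF \<open>open U\<close>, of p] Suc.prems \<open>x \<in> U\<close>)
  qed (use Suc in auto)
qed

lemma Ck_on_sum:
  assumes "open U" "\<And>i. i \<in> I \<Longrightarrow> Ck_on p (f i) U"
  shows "Ck_on p (\<lambda>x. \<Sum>i\<in>I. f i x) U"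
  using assms(2)
proof (induction I rule: infinite_finite_induct)
  case (insert i I)
  then show ?case by (simp add: Ck_on_add[OF \<open>open U\<close>])
qed (auto simp: Ck_on_const[OF \<open>open U\<close>])

lemma Ck_on_bilinear:
  fixes f :: "'a::euclidean_space \<Rightarrow> 'b::real_normed_vector" and g :: "'a \<Rightarrow> 'c::real_normed_vector"
  assumes "bounded_bilinear pr" "open U" "Ck_on p f U" "Ck_on p g U"
  shows "Ck_on p (\<lambda>x. pr (f x) (g x)) U"
  using assms(3,4)
proof (induction p arbitrary: f g)
  case 0 then show ?case using assms by (simp add: bounded_bilinear.continuous_on)
next
  case (Suc p)
  show ?case
  proof (rule Ck_on_SucI)
    fix x assume "x \<in> U"
    show "((\<lambda>x. pr (f x) (g x)) has_derivative
       (\<lambda>h. pr (f x) (frechet_derivative g (at x) h) + pr (frechet_derivative f (at x) h) (g x))) (at x)"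
      by (intro bounded_bilinear.FDERIV[OF assms(1)] Ck_on_has_derivative[OF \<open>open U\<close>, of p] Suc.prems \<open>x \<in> U\<close>)
  next
    fix b :: 'a assume b: "b \<in> Basis"
    show "Ck_on p (\<lambda>x. pr (f x) (frechet_derivative g (at x) b) + pr (frechet_derivative f (at x) b) (g x)) U"
      by (rule Ck_on_add[OF \<open>open U\<close>]; rule Suc.IH)
        (use Suc.prems b Ck_on_partial Ck_on_Suc_imp in blast)+
  qed (rule assms)
qed

lemma Ck_on_linear_comp:
  assumes "bounded_linear T" "open U" "Ck_on p f U"
  shows "Ck_on p (\<lambda>x. T (f x)) U"
  using assms(3)
proof (induction p arbitrary: f)
  case 0 then show ?case using assms by (simp add: bounded_linear.continuous_on)
next
  case (Suc p)
  show ?case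
  proof (rule Ck_on_SucI)
    fix x assume "x \<in> U"
    show "((\<lambda>x. T (f x)) has_derivative (\<lambda>h. T (frechet_derivative f (at x) h))) (at x)"
      by (intro bounded_linear.has_derivative[OF assms(1)] Ck_on_has_derivative[OF \<open>open U\<close>, of p] Suc.prems \<open>x \<in> U\<close>)
  qed (use Suc assms in auto)
qed

lemma linear_euclidean_expansion:
  assumes "linear T"
  shows "T h = (\<Sum>i\<in>Basis. (h \<bullet> i) *\<^sub>R T i)"
proof -
  have "T h = T (\<Sum>i\<in>Basis. (h \<bullet> i) *\<^sub>R i)" by (simp add: euclidean_representation)
  also have "\<dots> = (\<Sum>i\<in>Basis. (h \<bullet> i) *\<^sub>R T i)"
    by (simp add: linear_sum[OF assms] linear_scale[OF assms])
  finally show ?thesis .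
qed

lemma Ck_on_directional:
  assumes "open U" "Ck_on (Suc p) f U"
  shows "Ck_on p (\<lambda>x. frechet_derivative f (at x) e) U"
proof (rule Ck_on_cong[OF \<open>open U\<close>])
  show "(\<Sum>i\<in>Basis. (e \<bullet> i) *\<^sub>R frechet_derivative f (at x) i) = frechet_derivative f (at x) e"
    if "x \<in> U" for x
    by (rule linear_euclidean_expansion[OF has_derivative_linear[OF Ck_on_has_derivative[OF assms that]], symmetric])
  show "Ck_on p (\<lambda>x. \<Sum>i\<in>Basis. (e \<bullet> i) *\<^sub>R frechet_derivative f (at x) i) U"
    by (rule Ck_on_sum[OF assms(1)], rule Ck_on_linear_comp[OF bounded_linear_scaleR_right assms(1)],
        rule Ck_on_partial[OF assms(2)])
qed

text \<open>Expanded in the basis, the chain rule becomes a sum of products of a coordinate of the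
  derivative of \<open>g\<close> with a partial derivative of \<open>f\<close> at
  \<open>g x\<close>, to which the bilinear rule and the induction hypothesis apply.\<close>

lemma Ck_on_compose:
  fixes f :: "'b::euclidean_space \<Rightarrow> 'c::real_normed_vector" and g :: "'a::euclidean_space \<Rightarrow> 'b"
  assumes "open U" "open V" "g ` U \<subseteq> V" "Ck_on p f V" "Ck_on p g U"
  shows "Ck_on p (\<lambda>x. f (g x)) U"
  using assms(4,5)
proof (induction p arbitrary: f)
  case 0 then show ?case using assms(3) by (auto intro: continuous_on_compose2)
next
  case (Suc p)
  have g: "Ck_on p g U" using Suc.prems Ck_on_Suc_imp by blast
  show ?case
  proof (rule Ck_on_SucI)
    fix x assume x: "x \<in> U"
    then have gx: "g x \<in> V" using assms by auto
    have lin: "linear (frechet_derivative f (at (g x)))"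
      using Ck_on_has_derivative[OF \<open>open V\<close> Suc.prems(1) gx] has_derivative_linear by blast
    have "((\<lambda>x. f (g x)) has_derivative (\<lambda>h. frechet_derivative f (at (g x)) (frechet_derivative g (at x) h))) (at x)"
      using has_derivative_compose[OF Ck_on_has_derivative[OF \<open>open U\<close> Suc.prems(2) x]
          Ck_on_has_derivative[OF \<open>open V\<close> Suc.prems(1) gx]] .
    then show "((\<lambda>x. f (g x)) has_derivative
       (\<lambda>h. \<Sum>i\<in>Basis. (frechet_derivative g (at x) h \<bullet> i) *\<^sub>R frechet_derivative f (at (g x)) i)) (at x)"
      by (subst (asm) linear_euclidean_expansion[OF lin])
  next
    fix b :: 'a assume b: "b \<in> Basis"
    show "Ck_on p (\<lambda>x. \<Sum>i\<in>Basis. (frechet_derivative g (at x) b \<bullet> i) *\<^sub>R frechet_derivative f (at (g x)) i) U"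
      by (rule Ck_on_sum[OF \<open>open U\<close>], rule Ck_on_bilinear[OF bounded_bilinear_scaleR \<open>open U\<close>],
          rule Ck_on_linear_comp[OF bounded_linear_inner_left \<open>open U\<close> Ck_on_partial[OF Suc.prems(2) b]])
        (rule Suc.IH[OF Ck_on_partial[OF Suc.prems(1)] g])
  qed (rule assms)
qed

lemma Ck_on_frechet_derivative_continuous:
  assumes "open U" "Ck_on (Suc p) f U"
  shows "continuous_on U (\<lambda>x. frechet_derivative f (at x) e)"
  using Ck_on_directional[OF assms] Ck_on_imp_continuous_on by blast

text \<open>A product rule for a factor \<open>g\<close> that is merely continuous: at a zero,
  \<open>u\<close> is O(|y - y0|), hence u (g - g y0) is o(|y - y0|). It differentiates inverses
  that are so far only known to be continuous.\<close>

lemma has_derivative_scaleR_vanishing: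
  fixes u :: "'a::real_normed_vector \<Rightarrow> real" and g :: "'a \<Rightarrow> 'b::real_normed_vector"
  assumes u: "(u has_derivative u') (at y0)" and "u y0 = 0" and g: "isCont g y0"
  shows "((\<lambda>y. u y *\<^sub>R g y) has_derivative (\<lambda>h. u' h *\<^sub>R g y0)) (at y0)"
proof -
  have bl: "bounded_linear u'" using u by (rule has_derivative_bounded_linear)
  obtain K where K: "0 < K" "\<And>h. norm (u' h) \<le> norm h * K"
    using bounded_linear.pos_bounded[OF bl] by blast
  have "\<exists>d>0. \<forall>y. norm (y - y0) < d \<longrightarrow> norm (u y *\<^sub>R (g y - g y0)) \<le> e * norm (y - y0)" if "e > 0" for e
  proof -
    obtain d1 where d1: "d1 > 0" "\<And>y. norm (y - y0) < d1 \<Longrightarrow> norm (u y - u y0 - u' (y - y0)) \<le> 1 * norm (y - y0)"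
      using u unfolding has_derivative_at_alt by (metis zero_less_one)
    have "e / (K + 1) > 0" using that K by simp
    then obtain d2 where d2: "d2 > 0" "\<And>y. dist y y0 < d2 \<Longrightarrow> dist (g y) (g y0) < e / (K + 1)"
      using g unfolding continuous_at_eps_delta by meson
    have "norm (u y *\<^sub>R (g y - g y0)) \<le> e * norm (y - y0)" if y: "norm (y - y0) < min d1 d2" for y
    proof -
      have "\<bar>u y\<bar> \<le> norm (u y - u y0 - u' (y - y0)) + norm (u' (y - y0))"
        using \<open>u y0 = 0\<close> by simp
      also have "\<dots> \<le> (K + 1) * norm (y - y0)"
        using d1(2)[of y] K(2)[of "y - y0"] y by (simp add: algebra_simps)
      finally have 1: "\<bar>u y\<bar> \<le> (K + 1) * norm (y - y0)" .
      have 2: "norm (g y - g y0) \<le> e / (K + 1)" using d2(2)[of y] y by (simp add: dist_norm)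
      have "norm (u y *\<^sub>R (g y - g y0)) \<le> ((K + 1) * norm (y - y0)) * (e / (K + 1))"
        unfolding norm_scaleR by (intro mult_mono 1 2) (use K in auto)
      also have "\<dots> = e * norm (y - y0)" using K(1) by (simp add: divide_simps)
      finally show ?thesis .
    qed
    then show ?thesis using d1(1) d2(1) by (intro exI[of _ "min d1 d2"]) auto
  qed
  then have "((\<lambda>y. u y *\<^sub>R (g y - g y0)) has_derivative (\<lambda>h. 0)) (at y0)"
    unfolding has_derivative_at_alt using \<open>u y0 = 0\<close> by simp
  from has_derivative_add[OF has_derivative_scaleR_left[OF u, of "g y0"] this]
  show ?thesis by (simp add: algebra_simps)
qed

text \<open>Inverses satisfy J y = J y0 - J y (M y - M y0) J y0, where the middle factor vanishes at
  y0. So continuity of \<open>J\<close> already gives the derivative -J (DM) J, and by induction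
  \<open>J\<close> reaches the class of \<open>M\<close>.\<close>

lemma Ck_on_inverse_family:
  fixes M J :: "'a::euclidean_space \<Rightarrow> 'b::euclidean_space \<Rightarrow> 'b"
  assumes V: "open V"
    and M: "\<And>y. y \<in> V \<Longrightarrow> linear (M y)" and J: "\<And>y. y \<in> V \<Longrightarrow> linear (J y)"
    and JM: "\<And>y h. y \<in> V \<Longrightarrow> J y (M y h) = h" and MJ: "\<And>y h. y \<in> V \<Longrightarrow> M y (J y h) = h"
    and CM: "\<And>b. Ck_on q (\<lambda>y. M y b) V"
    and CJ: "\<And>b. continuous_on V (\<lambda>y. J y b)"
  shows "Ck_on q (\<lambda>y. J y b) V"
  using CM
proof (induction q arbitrary: b)
  case 0
  then show ?case using CJ by simp
next
  case (Suc q)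
  have J': "Ck_on q (\<lambda>y. J y b) V" for b
    by (rule Suc.IH) (rule Ck_on_Suc_imp[OF Suc.prems])
  let ?D = "\<lambda>y h. - (\<Sum>i\<in>Basis. \<Sum>j\<in>Basis. ((J y b \<bullet> j) * (frechet_derivative (\<lambda>y. M y j) (at y) h \<bullet> i)) *\<^sub>R J y i)"
  show ?case
  proof (rule Ck_on_SucI[OF V, where f' = ?D])
    fix y0 assume y0: "y0 \<in> V"
    define c where "c = J y0 b"
    \<comment> \<open>Coordinates turn the composition into a finite sum of scalars vanishing at
      \<open>y0\<close> times the continuous \<open>J y i\<close>.\<close>
    have eq: "J y0 b - (\<Sum>i\<in>Basis. \<Sum>j\<in>Basis. ((c \<bullet> j) * ((M y j - M y0 j) \<bullet> i)) *\<^sub>R J y i) = J y b" if y: "y \<in> V" for y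
    proof -
      have "M y c - M y0 c = (\<Sum>j\<in>Basis. (c \<bullet> j) *\<^sub>R (M y j - M y0 j))"
        by (subst (1 2) linear_euclidean_expansion[OF M], (rule y y0)+)
          (simp add: sum_subtractf scaleR_diff_right)
      then have inner: "(M y c - M y0 c) \<bullet> i = (\<Sum>j\<in>Basis. (c \<bullet> j) * ((M y j - M y0 j) \<bullet> i))" for i
        by (simp add: inner_sum_left)
      have "J y0 b - J y b = J y (M y c - M y0 c)"
        by (simp add: linear_diff[OF J[OF y]] JM[OF y] c_def MJ[OF y0])
      also have "\<dots> = (\<Sum>i\<in>Basis. ((M y c - M y0 c) \<bullet> i) *\<^sub>R J y i)"
        by (rule linear_euclidean_expansion[OF J[OF y]])
      also have "\<dots> = (\<Sum>i\<in>Basis. \<Sum>j\<in>Basis. ((c \<bullet> j) * ((M y j - M y0 j) \<bullet> i)) *\<^sub>R J y i)"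
        unfolding inner by (simp add: scaleR_sum_left)
      finally show ?thesis by (simp add: algebra_simps)
    qed
    have dM: "((\<lambda>y. (c \<bullet> j) * ((M y j - M y0 j) \<bullet> i)) has_derivative
        (\<lambda>h. (c \<bullet> j) * ((frechet_derivative (\<lambda>y. M y j) (at y0) h - 0) \<bullet> i))) (at y0)" for i j
      by (intro has_derivative_mult_right has_derivative_inner_left has_derivative_diff has_derivative_const
          Ck_on_has_derivative[OF V Suc.prems y0])
    have JC: "isCont (\<lambda>y. J y i) y0" for i
      using CJ V y0 by (simp add: continuous_on_eq_continuous_at)
    have "((\<lambda>y. J y0 b - (\<Sum>i\<in>Basis. \<Sum>j\<in>Basis. ((c \<bullet> j) * ((M y j - M y0 j) \<bullet> i)) *\<^sub>R J y i)) has_derivative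
       (\<lambda>h. 0 - (\<Sum>i\<in>Basis. \<Sum>j\<in>Basis. ((c \<bullet> j) * ((frechet_derivative (\<lambda>y. M y j) (at y0) h - 0) \<bullet> i)) *\<^sub>R J y0 i))) (at y0)"
      by (intro has_derivative_diff has_derivative_const has_derivative_sum
          has_derivative_scaleR_vanishing dM JC) simp
    then have "((\<lambda>y. J y b) has_derivative
       (\<lambda>h. 0 - (\<Sum>i\<in>Basis. \<Sum>j\<in>Basis. ((c \<bullet> j) * ((frechet_derivative (\<lambda>y. M y j) (at y0) h - 0) \<bullet> i)) *\<^sub>R J y0 i))) (at y0)"
      by (rule has_derivative_transform_within_open[OF _ V y0 eq])
    then show "((\<lambda>y. J y b) has_derivative ?D y0) (at y0)" by (simp add: c_def)
  next
    fix k :: 'a assume k: "k \<in> Basis"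
    have "Ck_on q (\<lambda>y. \<Sum>i\<in>Basis. \<Sum>j\<in>Basis. ((J y b \<bullet> j) * (frechet_derivative (\<lambda>y. M y j) (at y) k \<bullet> i)) *\<^sub>R J y i) V"
      by (rule Ck_on_sum[OF V], rule Ck_on_sum[OF V], rule Ck_on_bilinear[OF bounded_bilinear_scaleR V],
          rule Ck_on_bilinear[OF bounded_bilinear_mult V])
        (rule Ck_on_linear_comp[OF bounded_linear_inner_left V] J' Ck_on_partial[OF Suc.prems k])+
    from Ck_on_linear_comp[OF bounded_linear_minus[OF bounded_linear_ident] V this]
    show "Ck_on q (\<lambda>y. ?D y k) V" .
  qed
qed

text \<open>The inverse function theorem gives a differentiable \<open>G\<close> whose derivative
  inverts F' at \<open>G y\<close>. If \<open>G\<close> is C^q, then so are y -> F' (G y) and its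
  inverse, and \<open>G\<close> is C^(q+1); the bootstrap ends at the class of \<open>F\<close>. The
  applications build \<open>F\<close> with derivative the identity at \<open>x0\<close>.\<close>

lemma Ck_local_inverse:
  fixes F :: "'a::euclidean_space \<Rightarrow> 'a"
  assumes U: "open U" and F: "Ck_on (Suc p) F U" and x0: "x0 \<in> U"
    and der: "(F has_derivative (\<lambda>h. h)) (at x0)"
  obtains U' V G where "open U'" "U' \<subseteq> U" "x0 \<in> U'" "open V" "F x0 \<in> V"
    "homeomorphism U' V F G" "Ck_on (Suc p) G V"
proof -
  define F' where "F' = (\<lambda>x. Blinfun (frechet_derivative F (at x)))"
  have F'app: "blinfun_apply (F' x) = frechet_derivative F (at x)" if "x \<in> U" for x
    unfolding F'_def
    by (rule bounded_linear_Blinfun_apply)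
      (rule has_derivative_bounded_linear[OF Ck_on_has_derivative[OF U F that]])
  have contF': "continuous_on U F'"
  proof (rule continuous_on_blinfun_componentwise)
    fix i :: 'a assume "i \<in> Basis"
    show "continuous_on U (\<lambda>x. blinfun_apply (F' x) i)"
      using Ck_on_frechet_derivative_continuous[OF U F, of i] F'app
      by (simp cong: continuous_on_cong)
  qed
  have F'x0: "F' x0 = id_blinfun"
    using F'app[OF x0] frechet_derivative_at[OF der] by (simp add: blinfun_eqI)
  have "isCont F' x0" using contF' U x0 by (simp add: continuous_on_eq_continuous_at)
  then obtain r where r: "r > 0" "\<And>x. dist x x0 < r \<Longrightarrow> dist (F' x) (F' x0) < 1/2"
    unfolding continuous_at_eps_delta by (metis half_gt_zero zero_less_one)
  define U0 where "U0 = U \<inter> ball x0 r"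
  have U0: "open U0" "U0 \<subseteq> U" "x0 \<in> U0" using U x0 r by (auto simp: U0_def)
  have derU0: "(F has_derivative blinfun_apply (F' x)) (at x)" if "x \<in> U0" for x
    using that U0 F'app Ck_on_has_derivative[OF U F] by auto
  \<comment> \<open>At distance at most 1/2 from the identity, a derivative shrinks no vector by
    more than a factor 2. This bounds the inverses uniformly, from which their continuity follows
    below.\<close>
  have lower: "norm h \<le> 2 * norm (blinfun_apply (F' x) h)" if "x \<in> U0" for x h
  proof -
    have "norm (blinfun_apply (F' x - id_blinfun) h) \<le> norm (F' x - id_blinfun) * norm h"
      by (rule norm_blinfun)
    also have "\<dots> \<le> 1/2 * norm h"
      using r(2)[of x] that by (intro mult_right_mono) (auto simp: U0_def F'x0 dist_norm norm_minus_commute)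
    finally have "norm (blinfun_apply (F' x) h - h) \<le> 1/2 * norm h" by (simp add: blinfun.diff_left)
    moreover have "norm h \<le> norm (blinfun_apply (F' x) h) + norm (blinfun_apply (F' x) h - h)"
      by (metis norm_triangle_sub norm_minus_commute)
    ultimately show ?thesis by simp
  qed
  have invF': "id_blinfun o\<^sub>L F' x0 = id_blinfun" by (simp add: F'x0 blinfun_eqI)
  have "\<exists>U' V G G'. open U' \<and> U' \<subseteq> U0 \<and> x0 \<in> U' \<and> open V \<and> F x0 \<in> V \<and> homeomorphism U' V F G \<and>
      (\<forall>y\<in>V. (G has_derivative (G' y)) (at y)) \<and>
      (\<forall>y\<in>V. G' y = inv (blinfun_apply (F' (G y)))) \<and> (\<forall>y\<in>V. bij (blinfun_apply (F' (G y))))"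
    by (rule inverse_function_theorem[OF U0(1) derU0 continuous_on_subset[OF contF' U0(2)] U0(3) invF'],
        assumption) blast
  then obtain U' V G G' where *: "open U'" "U' \<subseteq> U0" "x0 \<in> U'" "open V" "F x0 \<in> V" "homeomorphism U' V F G"
      "\<And>y. y \<in> V \<Longrightarrow> (G has_derivative (G' y)) (at y)"
      "\<And>y. y \<in> V \<Longrightarrow> G' y = inv (blinfun_apply (F' (G y)))"
      "\<And>y. y \<in> V \<Longrightarrow> bij (blinfun_apply (F' (G y)))"
    by blast
  have GV: "G y \<in> U'" if "y \<in> V" for y using *(6) that unfolding homeomorphism_def by auto
  let ?M = "\<lambda>y. blinfun_apply (F' (G y))"
  have J: "linear (G' y)" if "y \<in> V" for y using *(7)[OF that] has_derivative_linear by blast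
  have JM: "G' y (?M y h) = h" if "y \<in> V" for y h
    using *(8,9)[OF that] by (simp add: bij_is_inj)
  have MJ: "?M y (G' y h) = h" if "y \<in> V" for y h
    using *(8,9)[OF that] by (simp add: bij_is_surj surj_f_inv_f)
  have M: "linear (?M y)" for y by (simp add: blinfun.bounded_linear_right bounded_linear.linear)
  have contG: "continuous_on V G" using *(6) unfolding homeomorphism_def by auto
  have contM: "continuous_on V (\<lambda>y. F' (G y))"
    by (rule continuous_on_compose2[OF contF' contG]) (use GV *(2) U0(2) in auto)
  have contJ: "continuous_on V (\<lambda>y. G' y b)" for b
  proof (subst continuous_on_eq_continuous_at[OF \<open>open V\<close>], intro ballI)
    fix y0 assume y0: "y0 \<in> V"
    define c where "c = G' y0 b"
    have "isCont (\<lambda>y. ?M y c) y0"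
      using contM *(4) y0 by (auto simp: continuous_on_eq_continuous_at intro: continuous_intros)
    then have "((\<lambda>y. ?M y c) \<longlongrightarrow> b) (at y0)"
      using MJ[OF y0] by (simp add: isCont_def c_def)
    then have lim: "((\<lambda>y. 2 * norm (b - ?M y c)) \<longlongrightarrow> 0) (at y0)"
      by (intro tendsto_mult_right_zero tendsto_norm_zero) (auto intro: tendsto_eq_intros)
    have "\<forall>\<^sub>F y in at y0. norm (G' y b - c) \<le> 2 * norm (b - ?M y c)"
    proof (rule eventually_at_in_open'[OF \<open>open V\<close> y0, THEN eventually_mono])
      fix y assume y: "y \<in> V"
      have "G' y b - c = G' y (b - ?M y c)" by (simp add: linear_diff[OF J[OF y]] JM[OF y])
      moreover have "norm (G' y (b - ?M y c)) \<le> 2 * norm (?M y (G' y (b - ?M y c)))"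
        by (rule lower) (use GV[OF y] *(2) in auto)
      ultimately show "norm (G' y b - c) \<le> 2 * norm (b - ?M y c)" by (simp add: MJ[OF y])
    qed
    then have "((\<lambda>y. G' y b - c) \<longlongrightarrow> 0) (at y0)"
      by (rule Lim_null_comparison[OF _ lim])
    then show "isCont (\<lambda>y. G' y b) y0" by (simp add: isCont_def c_def LIM_zero_iff)
  qed
  have "q \<le> Suc p \<Longrightarrow> Ck_on q G V" for q
  proof (induction q)
    case 0 then show ?case using contG by simp
  next
    case (Suc q)
    have "Ck_on q (\<lambda>y. ?M y b) V" for b
    proof (rule Ck_on_cong[OF \<open>open V\<close>])
      show "frechet_derivative F (at (G y)) b = ?M y b" if "y \<in> V" for y
        using F'app GV[OF that] *(2) U0(2) by auto
      show "Ck_on q (\<lambda>y. frechet_derivative F (at (G y)) b) V"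
      proof (rule Ck_on_compose[where f = "\<lambda>x. frechet_derivative F (at x) b", OF \<open>open V\<close> U])
        show "G ` V \<subseteq> U" using GV *(2) U0(2) by auto
        show "Ck_on q (\<lambda>x. frechet_derivative F (at x) b) U"
          using Ck_on_mono[OF Ck_on_directional[OF U F]] Suc.prems by simp
        show "Ck_on q G V" using Suc by simp
      qed
    qed
    then have "Ck_on q (\<lambda>y. G' y b) V" for b
      using Ck_on_inverse_family[OF \<open>open V\<close> M J JM MJ _ contJ] by blast
    then show ?case by (intro Ck_on_SucI[OF \<open>open V\<close> *(7)])
  qed
  then have "Ck_on (Suc p) G V" by blast
  with that[OF *(1) _ *(3,4,5,6)] *(2) U0(2) show ?thesis by blast
qed

section \<open>The Morse--Sard theorem\<close>

lemma countable_open_cover: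
  fixes X :: "'a::second_countable_topology set"
  assumes "\<And>x. x \<in> X \<Longrightarrow> \<exists>N. open N \<and> x \<in> N \<and> Q N"
  obtains F where "countable F" "X \<subseteq> \<Union>F" "\<And>N. N \<in> F \<Longrightarrow> Q N"
proof -
  obtain F where F: "F \<subseteq> {N. open N \<and> Q N}" "countable F" "\<Union>F = \<Union>{N. open N \<and> Q N}"
    using Lindelof[of "{N. open N \<and> Q N}"] by (metis (no_types, lifting) mem_Collect_eq)
  have "X \<subseteq> \<Union>F" unfolding F(3) using assms by blast
  then show thesis by (rule that[OF F(2)]) (use F(1) in blast)
qed

text \<open>\<open>P\<close> is a piece of \<open>A\<close> parametrised by \<open>\<psi>\<close> on \<open>D\<close>; the last conjunct is the flatness of Morse's lemma, which
  also concerns the points of \<open>\<psi> ` D\<close> outside \<open>P\<close>.\<close>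
definition flat_chart :: "nat \<Rightarrow> 'a::euclidean_space set \<Rightarrow> 'a set \<Rightarrow> 'a set \<Rightarrow> 'a set \<Rightarrow> ('a \<Rightarrow> 'a) \<Rightarrow> 'a set \<Rightarrow> bool" where
  "flat_chart k U L A D \<psi> P \<longleftrightarrow>
     compact D \<and> convex D \<and> dim D \<le> dim L \<and> \<psi> ` D \<subseteq> U \<inter> L \<and> P \<subseteq> A \<inter> \<psi> ` D \<and>
     (\<exists>\<psi>' K. \<forall>x\<in>D. (\<psi> has_derivative \<psi>' x) (at x within D) \<and> (\<forall>h. norm (\<psi>' x h) \<le> K * norm h)) \<and>
     (\<forall>g::'a \<Rightarrow> real. Ck_on k g U \<longrightarrow> (\<forall>x\<in>A. g x = 0) \<longrightarrow>
        (\<forall>e>0. \<exists>\<delta>>0. \<forall>x\<in>D. \<forall>y\<in>D. \<psi> x \<in> P \<longrightarrow> dist x y < \<delta> \<longrightarrow> \<bar>g (\<psi> y)\<bar> \<le> e * dist x y ^ k))"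

text \<open>\<open>A\<close> is the set on which the test functions vanish, \<open>X\<close> the
  part of it to be covered. Keeping them apart allows \<open>X\<close> to be localised while
  flatness still concerns all functions that vanish on the whole of \<open>A\<close>.\<close>

definition flat_cover :: "nat \<Rightarrow> 'a::euclidean_space set \<Rightarrow> 'a set \<Rightarrow> 'a set \<Rightarrow> 'a set \<Rightarrow> bool" where
  "flat_cover k U L A X \<longleftrightarrow>
     (\<exists>\<P>. countable \<P> \<and> X \<subseteq> \<Union>\<P> \<and> (\<forall>P\<in>\<P>. \<exists>D \<psi>. flat_chart k U L A D \<psi> P))"

lemma flat_cover_local:
  assumes "\<And>x. x \<in> X \<Longrightarrow> \<exists>N. open N \<and> x \<in> N \<and> flat_cover k U L A (X \<inter> N)"
  shows "flat_cover k U L A X"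
proof -
  obtain F where F: "countable F" "X \<subseteq> \<Union>F" "\<And>N. N \<in> F \<Longrightarrow> flat_cover k U L A (X \<inter> N)"
    by (rule countable_open_cover[of X "\<lambda>N. flat_cover k U L A (X \<inter> N)", OF assms]) blast+
  have "\<forall>N\<in>F. \<exists>\<P>. countable \<P> \<and> X \<inter> N \<subseteq> \<Union>\<P> \<and> (\<forall>P\<in>\<P>. \<exists>D \<psi>. flat_chart k U L A D \<psi> P)"
    using F(3) unfolding flat_cover_def by blast
  then obtain Q where Q: "\<And>N. N \<in> F \<Longrightarrow> countable (Q N)" "\<And>N. N \<in> F \<Longrightarrow> X \<inter> N \<subseteq> \<Union>(Q N)"
    "\<And>N P. N \<in> F \<Longrightarrow> P \<in> Q N \<Longrightarrow> \<exists>D \<psi>. flat_chart k U L A D \<psi> P"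
    by metis
  have "X \<subseteq> \<Union>(\<Union>(Q ` F))" using F(2) Q(2) by blast
  moreover have "countable (\<Union>(Q ` F))" using F(1) Q(1) by blast
  ultimately show ?thesis unfolding flat_cover_def using Q(3) by (intro exI[of _ "\<Union>(Q ` F)"]) blast
qed

lemma flat_cover_Un:
  assumes "flat_cover k U L A X" "flat_cover k U L A Y"
  shows "flat_cover k U L A (X \<union> Y)"
proof -
  obtain P Q where "countable P" "X \<subseteq> \<Union>P" "\<forall>p\<in>P. \<exists>D \<psi>. flat_chart k U L A D \<psi> p"
    "countable Q" "Y \<subseteq> \<Union>Q" "\<forall>p\<in>Q. \<exists>D \<psi>. flat_chart k U L A D \<psi> p"
    using assms unfolding flat_cover_def by metis
  then show ?thesis unfolding flat_cover_def by (intro exI[of _ "P \<union> Q"]) auto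
qed

lemma flat_cover_subset: "flat_cover k U L A Y \<Longrightarrow> X \<subseteq> Y \<Longrightarrow> flat_cover k U L A X"
  unfolding flat_cover_def by (meson subset_trans)

text \<open>Flatness of order 0 is uniform continuity on a compact ball of \<open>L\<close>; the
  parametrisation is the identity.\<close>

lemma flat_cover_0:
  fixes A :: "'a::euclidean_space set"
  assumes U: "open U" and A: "A \<subseteq> U \<inter> L" and L: "subspace L"
  shows "flat_cover 0 U L A A"
proof (rule flat_cover_local)
  fix x assume x: "x \<in> A"
  then obtain r where r: "r > 0" "cball x r \<subseteq> U" using A U open_contains_cball by blast
  let ?D = "cball x r \<inter> L"
  have D: "compact ?D" using L by (intro compact_Int_closed) (auto intro: closed_subspace)
  have "flat_chart 0 U L A ?D (\<lambda>x. x) (A \<inter> ball x r)"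
    unfolding flat_chart_def
  proof (intro conjI allI impI)
    show "convex ?D" using L by (intro convex_Int) (auto intro: subspace_imp_convex)
    show "dim ?D \<le> dim L" by (intro dim_subset) auto
    show "\<exists>\<psi>' K. \<forall>x\<in>?D. ((\<lambda>x. x) has_derivative \<psi>' x) (at x within ?D) \<and> (\<forall>h. norm (\<psi>' x h) \<le> K * norm h)"
      by (rule exI[of _ "\<lambda>x h. h"], rule exI[of _ 1]) auto
    fix g :: "'a \<Rightarrow> real" and e :: real
    assume g: "Ck_on 0 g U" "\<forall>x\<in>A. g x = 0" and e: "e > 0"
    have "uniformly_continuous_on ?D g"
      by (rule compact_uniformly_continuous[OF _ D]) (use g r in \<open>auto intro: continuous_on_subset\<close>)
    then obtain d where d: "d > 0" "\<And>x y. x \<in> ?D \<Longrightarrow> y \<in> ?D \<Longrightarrow> dist y x < d \<Longrightarrow> dist (g y) (g x) < e"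
      unfolding uniformly_continuous_on_def using e by meson
    have "\<bar>g b\<bar> \<le> e * dist a b ^ 0" if "a \<in> ?D" "b \<in> ?D" "a \<in> A \<inter> ball x r" "dist a b < d" for a b
      using d(2)[of a b] that g(2) by (simp add: dist_commute dist_real_def)
    then show "\<exists>\<delta>>0. \<forall>xa\<in>?D. \<forall>y\<in>?D. xa \<in> A \<inter> ball x r \<longrightarrow> dist xa y < \<delta> \<longrightarrow> \<bar>g y\<bar> \<le> e * dist xa y ^ 0"
      using d(1) by blast
  qed (use D r A in auto)
  then have "flat_cover 0 U L A (A \<inter> ball x r)"
    unfolding flat_cover_def by (intro exI[of _ "{A \<inter> ball x r}"]) auto
  then show "\<exists>N. open N \<and> x \<in> N \<and> flat_cover 0 U L A (A \<inter> N)"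
    using r by (intro exI[of _ "ball x r"]) auto
qed

lemma has_vector_derivative_slope:
  assumes "(f has_vector_derivative w) (at t within S)"
  shows "((\<lambda>s. (f s - f t) /\<^sub>R (s - t)) \<longlongrightarrow> w) (at t within S)"
proof -
  have "((\<lambda>s. norm ((f s - f t) - (s - t) *\<^sub>R w) / norm (s - t)) \<longlongrightarrow> 0) (at t within S)"
    using assms unfolding has_vector_derivative_def has_derivative_iff_norm by blast
  moreover have "\<forall>\<^sub>F s in at t within S. norm ((f s - f t) - (s - t) *\<^sub>R w) / norm (s - t) = norm ((f s - f t) /\<^sub>R (s - t) - w)"
    unfolding eventually_at_filter
  proof (rule always_eventually, intro allI impI)
    fix s assume "s \<noteq> t"
    then have "(f s - f t) /\<^sub>R (s - t) - w = ((f s - f t) - (s - t) *\<^sub>R w) /\<^sub>R (s - t)"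
      by (simp add: scaleR_diff_right)
    then show "norm ((f s - f t) - (s - t) *\<^sub>R w) / norm (s - t) = norm ((f s - f t) /\<^sub>R (s - t) - w)"
      by (simp add: divide_inverse mult.commute)
  qed
  ultimately have "((\<lambda>s. norm ((f s - f t) /\<^sub>R (s - t) - w)) \<longlongrightarrow> 0) (at t within S)"
    by (rule Lim_transform_eventually)
  then show ?thesis by (rule LIM_zero_cancel[OF tendsto_norm_zero_cancel])
qed

lemma has_vector_derivative_in_closed_subspace:
  fixes c :: "real \<Rightarrow> 'a::euclidean_space"
  assumes L: "subspace L" and c: "\<And>s. s \<in> {0..1} \<Longrightarrow> c s \<in> L" and t: "t \<in> {0..1::real}"
    and der: "(c has_vector_derivative w) (at t within {0..1})"
  shows "w \<in> L"
proof -
  have lim: "((\<lambda>s. (c s - c t) /\<^sub>R (s - t)) \<longlongrightarrow> w) (at t within {0..1})"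
    by (rule has_vector_derivative_slope[OF der])
  have ev: "\<forall>\<^sub>F s in at t within {0..1}. (c s - c t) /\<^sub>R (s - t) \<in> L"
    using c t L by (auto simp: eventually_at_filter subspace_diff subspace_scale)
  have nb: "at t within {0..1} \<noteq> bot"
    using t by (simp add: trivial_limit_within)
  show ?thesis by (rule Lim_in_closed_set[OF closed_subspace[OF L] ev nb lim])
qed

text \<open>The derivatives of \<open>g\<close> along \<open>L\<close> are C^k and vanish on
  \<open>A\<close>, so they are o(|x - y|^k) near the piece. The segment from \<open>x\<close> to
  \<open>y\<close> stays in the convex \<open>D\<close>, and its image moves in directions of
  \<open>L\<close> at speed at most K |x - y|; the mean value inequality gains one order. This
  serves both to raise the order of a chart and to finish the Morse-Sard theorem.\<close>

lemma flat_chart_increment: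
  fixes g :: "'a::euclidean_space \<Rightarrow> real"
  assumes U: "open U" and L: "subspace L" and chart: "flat_chart k U L A D \<psi> P"
    and g: "Ck_on (Suc k) g U"
    and crit: "\<And>x e. x \<in> A \<Longrightarrow> e \<in> L \<Longrightarrow> frechet_derivative g (at x) e = 0"
    and e: "e > 0"
  shows "\<exists>\<delta>>0. \<forall>x\<in>D. \<forall>y\<in>D. \<psi> x \<in> P \<longrightarrow> dist x y < \<delta> \<longrightarrow> \<bar>g (\<psi> y) - g (\<psi> x)\<bar> \<le> e * dist x y ^ Suc k"
proof -
  obtain B where B: "B \<subseteq> L" "pairwise orthogonal B" "\<And>b. b \<in> B \<Longrightarrow> norm b = 1" "independent B" "span B = L"
    using orthonormal_basis_subspace[OF L] by metis
  then have finB: "finite B" using independent_imp_finite by blast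
  have D: "convex D" and img: "\<psi> ` D \<subseteq> U \<inter> L" using chart unfolding flat_chart_def by auto
  obtain \<psi>' K0 where K0: "\<And>x. x \<in> D \<Longrightarrow> (\<psi> has_derivative \<psi>' x) (at x within D)"
    "\<And>x h. x \<in> D \<Longrightarrow> norm (\<psi>' x h) \<le> K0 * norm h"
    using chart unfolding flat_chart_def by blast
  define K where "K = max K0 1"
  have K: "norm (\<psi>' x h) \<le> K * norm h" if "x \<in> D" for x h
  proof -
    have "K0 * norm h \<le> K * norm h" unfolding K_def by (intro mult_right_mono) auto
    then show ?thesis using K0(2)[OF that, of h] by simp
  qed
  have Kpos: "K > 0" by (simp add: K_def)
  \<comment> \<open>Each of the \<open>card B\<close> directions contributes K e1, in total at most
    \<open>e\<close>; the 1 keeps the denominator positive when \<open>L\<close> is trivial.\<close>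
  define e1 where "e1 = e / (K * (card B + 1))"
  have e1: "e1 > 0" unfolding e1_def using e Kpos by simp
  have flat: "\<exists>\<delta>>0. \<forall>x\<in>D. \<forall>y\<in>D. \<psi> x \<in> P \<longrightarrow> dist x y < \<delta> \<longrightarrow>
      \<bar>frechet_derivative g (at (\<psi> y)) b\<bar> \<le> e1 * dist x y ^ k" if "b \<in> B" for b
  proof -
    have "Ck_on k (\<lambda>x. frechet_derivative g (at x) b) U" by (rule Ck_on_directional[OF U g])
    moreover have "\<forall>x\<in>A. frechet_derivative g (at x) b = 0" using crit B(1) that by blast
    moreover have "\<forall>g. Ck_on k g U \<longrightarrow> (\<forall>x\<in>A. g x = 0) \<longrightarrow>
        (\<forall>e>0. \<exists>\<delta>>0. \<forall>x\<in>D. \<forall>y\<in>D. \<psi> x \<in> P \<longrightarrow> dist x y < \<delta> \<longrightarrow> \<bar>g (\<psi> y)\<bar> \<le> e * dist x y ^ k)"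
      using chart unfolding flat_chart_def by (elim conjE)
    ultimately show ?thesis using e1 by blast
  qed
  then obtain d where d: "\<And>b. b \<in> B \<Longrightarrow> d b > 0"
    "\<And>b x y. \<lbrakk>b \<in> B; x \<in> D; y \<in> D; \<psi> x \<in> P; dist x y < d b\<rbrakk> \<Longrightarrow>
      \<bar>frechet_derivative g (at (\<psi> y)) b\<bar> \<le> e1 * dist x y ^ k"
    by metis
  define \<delta> where "\<delta> = Min (insert 1 (d ` B))"
  have \<delta>: "\<delta> > 0" "\<And>b. b \<in> B \<Longrightarrow> \<delta> \<le> d b" unfolding \<delta>_def using d(1) finB by auto
  have "\<bar>g (\<psi> y) - g (\<psi> x)\<bar> \<le> e * dist x y ^ Suc k" if x: "x \<in> D" and y: "y \<in> D" and xP: "\<psi> x \<in> P" and xy: "dist x y < \<delta>" for x y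
  proof -
    define c where "c = (\<lambda>t::real. x + t *\<^sub>R (y - x))"
    have cD: "c t \<in> D" if "t \<in> {0..1}" for t
      using that convexD_alt[OF D x y, of t] by (simp add: c_def algebra_simps)
    have dist_c: "dist x (c t) \<le> dist x y" if "t \<in> {0..1}" for t
      using that by (simp add: c_def dist_norm norm_minus_commute mult_left_le_one_le)
    have der_c: "(c has_derivative (\<lambda>s. s *\<^sub>R (y - x))) (at t within {0..1})" for t
      unfolding c_def by (auto intro!: derivative_eq_intros)
    have der_psi: "((\<lambda>t. \<psi> (c t)) has_derivative (\<lambda>s. \<psi>' (c t) (s *\<^sub>R (y - x)))) (at t within {0..1})"
      if "t \<in> {0..1}" for t
      by (rule has_derivative_in_compose2[where t = D, OF K0(1) _ that der_c]) (use cD in auto)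
    define w where "w = (\<lambda>t. \<psi>' (c t) (y - x))"
    have lin: "linear (\<psi>' (c t))" if "t \<in> {0..1}" for t
      using K0(1)[OF cD[OF that]] has_derivative_linear by blast
    have w: "w t \<in> L" "norm (w t) \<le> K * dist x y" if "t \<in> {0..1}" for t
    proof -
      have "((\<lambda>t. \<psi> (c t)) has_vector_derivative w t) (at t within {0..1})"
        using der_psi[OF that] unfolding has_vector_derivative_def w_def
        by (simp add: linear_scale[OF lin[OF that]])
      then show "w t \<in> L"
        by (rule has_vector_derivative_in_closed_subspace[OF L _ that, rotated]) (use cD img in auto)
      show "norm (w t) \<le> K * dist x y"
        using K[OF cD[OF that], of "y - x"] by (simp add: w_def dist_norm norm_minus_commute)
    qed
    have der: "((\<lambda>t. g (\<psi> (c t))) has_derivative (\<lambda>s. frechet_derivative g (at (\<psi> (c t))) (\<psi>' (c t) (s *\<^sub>R (y - x))))) (at t within {0..1})"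
      if "t \<in> {0..1}" for t
      by (rule has_derivative_compose[OF der_psi[OF that] Ck_on_has_derivative[OF U g]]) (use cD[OF that] img in auto)
    have bound: "onorm (\<lambda>s::real. frechet_derivative g (at (\<psi> (c t))) (\<psi>' (c t) (s *\<^sub>R (y - x)))) \<le> e * dist x y ^ Suc k"
      if t: "t \<in> {0..1}" for t
    proof -
      let ?T = "frechet_derivative g (at (\<psi> (c t)))"
      have linT: "linear ?T"
        using Ck_on_has_derivative[OF U g, of "\<psi> (c t)"] cD[OF t] img has_derivative_linear by blast
      have "?T (w t) = ?T (\<Sum>b\<in>B. (w t \<bullet> b) *\<^sub>R b)"
        using orthonormal_basis_expand[OF B(2,3) _ finB, of "w t"] w(1)[OF t] B(5) by simp
      also have "\<dots> = (\<Sum>b\<in>B. (w t \<bullet> b) * ?T b)"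
        by (simp add: linear_sum[OF linT] linear_scale[OF linT])
      also have "\<bar>\<dots>\<bar> \<le> (\<Sum>b\<in>B. \<bar>(w t \<bullet> b) * ?T b\<bar>)" by (rule sum_abs)
      also have "\<dots> \<le> (\<Sum>b\<in>B. (K * dist x y) * (e1 * dist x y ^ k))"
      proof (rule sum_mono)
        fix b assume b: "b \<in> B"
        have "\<bar>w t \<bullet> b\<bar> \<le> norm (w t) * norm b" by (rule Cauchy_Schwarz_ineq2)
        then have 1: "\<bar>w t \<bullet> b\<bar> \<le> K * dist x y" using w(2)[OF t] B(3)[OF b] by simp
        have "\<bar>?T b\<bar> \<le> e1 * dist x (c t) ^ k"
          using dist_c[OF t] xy \<delta>(2)[OF b] by (intro d(2)[OF b x cD[OF t] xP]) simp
        also have "\<dots> \<le> e1 * dist x y ^ k"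
          using dist_c[OF t] e1 by (intro mult_left_mono power_mono) auto
        finally show "\<bar>(w t \<bullet> b) * ?T b\<bar> \<le> (K * dist x y) * (e1 * dist x y ^ k)"
          unfolding abs_mult using 1 Kpos by (intro mult_mono) auto
      qed
      also have "\<dots> = (card B / (card B + 1)) * (e * dist x y ^ Suc k)"
        unfolding e1_def using Kpos by (simp add: divide_simps)
      also have "\<dots> \<le> 1 * (e * dist x y ^ Suc k)"
        using e by (intro mult_right_mono) auto
      finally have Tw: "\<bar>?T (w t)\<bar> \<le> e * dist x y ^ Suc k" by simp
      show ?thesis
      proof (rule onorm_bound)
        show "norm (?T (\<psi>' (c t) (s *\<^sub>R (y - x)))) \<le> e * dist x y ^ Suc k * norm s" for s :: real
        proof -
          have "?T (\<psi>' (c t) (s *\<^sub>R (y - x))) = s * ?T (w t)"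
            by (simp add: linear_scale[OF lin[OF t]] linear_scale[OF linT] w_def)
          then show ?thesis using mult_left_mono[OF Tw, of "\<bar>s\<bar>"] by (simp add: abs_mult mult.commute)
        qed
      qed (use e in simp)
    qed
    have "norm (g (\<psi> (c 1)) - g (\<psi> (c 0))) \<le> e * dist x y ^ Suc k * norm (1 - 0::real)"
      by (rule differentiable_bound[where S = "{0..1}" and f = "\<lambda>t. g (\<psi> (c t))", OF _ der bound]) auto
    then show ?thesis by (simp add: c_def)
  qed
  then show ?thesis using \<delta>(1) by blast
qed

text \<open>A function vanishing on \<open>A\<close> is 0 at the point \<open>\<psi> x\<close> of
  the piece, so its increment is its value at \<open>\<psi> y\<close>. The given chart belongs to
  the smaller set \<open>A0\<close> because the derivatives along \<open>L\<close> are known to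
  vanish only there.\<close>

lemma flat_chart_Suc:
  assumes U: "open U" and L: "subspace L" and A: "A0 \<subseteq> A" and chart: "flat_chart k U L A0 D \<psi> P"
    and crit: "\<And>g x e. \<lbrakk>Ck_on (Suc k) g U; \<forall>x\<in>A. g x = (0::real); x \<in> A0; e \<in> L\<rbrakk> \<Longrightarrow> frechet_derivative g (at x) e = 0"
  shows "flat_chart (Suc k) U L A D \<psi> P"
proof -
  have PA: "P \<subseteq> A" using chart A unfolding flat_chart_def by blast
  have "\<exists>\<delta>>0. \<forall>x\<in>D. \<forall>y\<in>D. \<psi> x \<in> P \<longrightarrow> dist x y < \<delta> \<longrightarrow> \<bar>g (\<psi> y)\<bar> \<le> e * dist x y ^ Suc k"
    if g: "Ck_on (Suc k) g U" "\<forall>x\<in>A. g x = 0" "e > 0" for g :: "'a \<Rightarrow> real" and e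
  proof -
    obtain d where "d > 0" and d: "\<And>x y. \<lbrakk>x \<in> D; y \<in> D; \<psi> x \<in> P; dist x y < d\<rbrakk> \<Longrightarrow> \<bar>g (\<psi> y) - g (\<psi> x)\<bar> \<le> e * dist x y ^ Suc k"
      using flat_chart_increment[OF U L chart g(1) crit[OF g(1,2)] g(3)] by blast
    moreover have "g (\<psi> x) = 0" if "\<psi> x \<in> P" for x using g(2) PA that by blast
    ultimately show ?thesis by (intro exI[of _ d]) (metis diff_zero)
  qed
  moreover have "compact D" "convex D" "dim D \<le> dim L" "\<psi> ` D \<subseteq> U \<inter> L" "P \<subseteq> A \<inter> \<psi> ` D"
    "\<exists>\<psi>' K. \<forall>x\<in>D. (\<psi> has_derivative \<psi>' x) (at x within D) \<and> (\<forall>h. norm (\<psi>' x h) \<le> K * norm h)"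
    using chart A unfolding flat_chart_def by (elim conjE, blast)+
  ultimately show ?thesis unfolding flat_chart_def by blast
qed

lemma Ck_on_derivative_bounded:
  fixes G :: "'a::euclidean_space \<Rightarrow> 'b::real_normed_vector"
  assumes V: "open V" and G: "Ck_on (Suc k) G V" and C: "compact C" "C \<subseteq> V"
  obtains K where "K > 0" "\<And>w h. w \<in> C \<Longrightarrow> norm (frechet_derivative G (at w) h) \<le> K * norm h"
proof -
  have "\<exists>M. \<forall>w\<in>C. norm (frechet_derivative G (at w) i) \<le> M" for i
  proof -
    have "compact ((\<lambda>w. frechet_derivative G (at w) i) ` C)"
      by (rule compact_continuous_image[OF continuous_on_subset[OF Ck_on_frechet_derivative_continuous[OF V G] C(2)] C(1)])
    then have "bounded ((\<lambda>w. frechet_derivative G (at w) i) ` C)" by (rule compact_imp_bounded)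
    then show ?thesis by (auto simp: bounded_iff)
  qed
  then obtain M where M: "\<And>w i. w \<in> C \<Longrightarrow> norm (frechet_derivative G (at w) i) \<le> M i" by metis
  define K where "K = (\<Sum>i\<in>Basis. \<bar>M i\<bar>) + 1"
  have "norm (frechet_derivative G (at w) h) \<le> K * norm h" if w: "w \<in> C" for w h
  proof -
    have lin: "linear (frechet_derivative G (at w))"
      using Ck_on_has_derivative[OF V G] C w has_derivative_linear by blast
    have "norm (frechet_derivative G (at w) h) \<le> (\<Sum>i\<in>Basis. norm ((h \<bullet> i) *\<^sub>R frechet_derivative G (at w) i))"
      by (subst linear_euclidean_expansion[OF lin]) (rule norm_sum)
    also have "\<dots> \<le> (\<Sum>i\<in>Basis. norm h * \<bar>M i\<bar>)"
      using M[OF w] by (intro sum_mono) (auto intro!: mult_mono Basis_le_norm intro: order_trans[OF _ abs_ge_self])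
    also have "\<dots> \<le> K * norm h"
      unfolding K_def by (simp add: sum_distrib_left algebra_simps)
    finally show ?thesis .
  qed
  moreover have "K > 0" unfolding K_def by (smt (verit) sum_nonneg abs_ge_zero)
  ultimately show thesis using that by blast
qed

text \<open>Composition with \<open>G\<close> preserves the class of test functions. The parameter
  domain \<open>D\<close> is kept, so the distances in it, and with them the order of flatness, do
  not change.\<close>

lemma flat_chart_image:
  fixes G :: "'a::euclidean_space \<Rightarrow> 'a"
  assumes V: "open V" and U: "open U" and U': "U' \<subseteq> U"
    and hom: "homeomorphism U' V F G" and G: "Ck_on (Suc k) G V"
    and chart: "flat_chart (Suc k) V L1 (F ` (A \<inter> U')) D \<psi> P"
    and GL: "G ` (V \<inter> L1) \<subseteq> L" and dim: "dim L1 \<le> dim L"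
  shows "flat_chart (Suc k) U L A D (G \<circ> \<psi>) (G ` P)"
proof -
  have GF: "G (F x) = x" if "x \<in> U'" for x using hom that unfolding homeomorphism_def by auto
  have injG: "inj_on G V" using hom unfolding homeomorphism_def by (metis inj_on_def)
  have GV: "G ` V = U'" using hom unfolding homeomorphism_def by auto
  have c: "compact D" "convex D" "dim D \<le> dim L1" "\<psi> ` D \<subseteq> V \<inter> L1" "P \<subseteq> F ` (A \<inter> U') \<inter> \<psi> ` D"
    using chart unfolding flat_chart_def by auto
  obtain \<psi>' K0 where K0: "\<And>x. x \<in> D \<Longrightarrow> (\<psi> has_derivative \<psi>' x) (at x within D)"
    "\<And>x h. x \<in> D \<Longrightarrow> norm (\<psi>' x h) \<le> K0 * norm h"
    using chart unfolding flat_chart_def by blast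
  have "continuous_on D \<psi>" using K0(1) has_derivative_continuous_on by blast
  then have "compact (\<psi> ` D)" using c(1) compact_continuous_image by blast
  moreover have "\<psi> ` D \<subseteq> V" using c(4) by blast
  ultimately obtain K1 where K1: "K1 > 0" "\<And>w h. w \<in> \<psi> ` D \<Longrightarrow> norm (frechet_derivative G (at w) h) \<le> K1 * norm h"
    using Ck_on_derivative_bounded[OF V G] by metis
  have "((G \<circ> \<psi>) has_derivative (\<lambda>h. frechet_derivative G (at (\<psi> x)) (\<psi>' x h))) (at x within D) \<and>
     (\<forall>h. norm (frechet_derivative G (at (\<psi> x)) (\<psi>' x h)) \<le> (K1 * K0) * norm h)" if x: "x \<in> D" for x
  proof (intro conjI allI)
    show "((G \<circ> \<psi>) has_derivative (\<lambda>h. frechet_derivative G (at (\<psi> x)) (\<psi>' x h))) (at x within D)"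
      unfolding o_def
      by (rule has_derivative_compose[OF K0(1)[OF x] Ck_on_has_derivative[OF V G]]) (use c(4) x in auto)
    fix h
    have "norm (frechet_derivative G (at (\<psi> x)) (\<psi>' x h)) \<le> K1 * norm (\<psi>' x h)" using K1(2) x by blast
    also have "\<dots> \<le> K1 * (K0 * norm h)" using K0(2)[OF x] K1(1) by (intro mult_left_mono) auto
    finally show "norm (frechet_derivative G (at (\<psi> x)) (\<psi>' x h)) \<le> (K1 * K0) * norm h" by simp
  qed
  then have der: "\<exists>\<psi>' K. \<forall>x\<in>D. ((G \<circ> \<psi>) has_derivative \<psi>' x) (at x within D) \<and> (\<forall>h. norm (\<psi>' x h) \<le> K * norm h)"
    by (intro exI[of _ "\<lambda>x h. frechet_derivative G (at (\<psi> x)) (\<psi>' x h)"] exI[of _ "K1 * K0"]) blast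
  have flat: "\<exists>\<delta>>0. \<forall>x\<in>D. \<forall>y\<in>D. (G \<circ> \<psi>) x \<in> G ` P \<longrightarrow> dist x y < \<delta> \<longrightarrow> \<bar>g ((G \<circ> \<psi>) y)\<bar> \<le> e * dist x y ^ Suc k"
    if g: "Ck_on (Suc k) g U" "\<forall>x\<in>A. g x = 0" "e > 0" for g :: "'a \<Rightarrow> real" and e
  proof -
    have "Ck_on (Suc k) (\<lambda>x. g (G x)) V"
      by (rule Ck_on_compose[OF V U _ g(1) G]) (use GV U' in auto)
    moreover have "\<forall>x\<in>F ` (A \<inter> U'). g (G x) = 0" using GF g(2) by auto
    moreover have "\<forall>g. Ck_on (Suc k) g V \<longrightarrow> (\<forall>x\<in>F ` (A \<inter> U'). g x = 0) \<longrightarrow>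
        (\<forall>e>0. \<exists>\<delta>>0. \<forall>x\<in>D. \<forall>y\<in>D. \<psi> x \<in> P \<longrightarrow> dist x y < \<delta> \<longrightarrow> \<bar>g (\<psi> y)\<bar> \<le> e * dist x y ^ Suc k)"
      using chart unfolding flat_chart_def by (elim conjE)
    ultimately have "\<exists>\<delta>>0. \<forall>x\<in>D. \<forall>y\<in>D. \<psi> x \<in> P \<longrightarrow> dist x y < \<delta> \<longrightarrow> \<bar>g (G (\<psi> y))\<bar> \<le> e * dist x y ^ Suc k"
      using g(3) by blast
    moreover have "\<psi> x \<in> P" if x: "x \<in> D" "(G \<circ> \<psi>) x \<in> G ` P" for x
    proof -
      obtain p where p: "p \<in> P" "G (\<psi> x) = G p" using x(2) by auto
      moreover have "p \<in> V" "\<psi> x \<in> V" using p c(4,5) x by auto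
      ultimately show ?thesis using injG by (auto dest: inj_onD)
    qed
    ultimately show ?thesis unfolding comp_def by blast
  qed
  show ?thesis
    unfolding flat_chart_def
  proof (intro conjI allI impI)
    show "compact D" "convex D" by (rule c(1,2))+
    show "dim D \<le> dim L" using c(3) dim by simp
    show "(G \<circ> \<psi>) ` D \<subseteq> U \<inter> L"
    proof (rule image_subsetI)
      fix x assume "x \<in> D"
      then have "\<psi> x \<in> V \<inter> L1" using c(4) by blast
      then show "(G \<circ> \<psi>) x \<in> U \<inter> L" using GV U' GL by auto
    qed
    show "G ` P \<subseteq> A \<inter> (G \<circ> \<psi>) ` D"
    proof (rule image_subsetI)
      fix p assume "p \<in> P"
      then obtain a x where "a \<in> A \<inter> U'" "p = F a" "x \<in> D" "p = \<psi> x" using c(5) by blast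
      then have "G p \<in> A" "G p = (G \<circ> \<psi>) x" using GF by auto
      then show "G p \<in> A \<inter> (G \<circ> \<psi>) ` D" using \<open>x \<in> D\<close> by blast
    qed
  qed (rule der, rule flat)
qed

lemma flat_coverE:
  assumes "flat_cover k U L A X"
  obtains \<P> where "countable \<P>" "X \<subseteq> \<Union>\<P>" "\<forall>P\<in>\<P>. \<exists>D \<psi>. flat_chart k U L A D \<psi> P"
  using assms unfolding flat_cover_def by (elim exE conjE) (rule that)

text \<open>Near \<open>x\<close> the set \<open>A\<close> lies in a hypersurface of
  \<open>L\<close>, the zero set of \<open>g\<close>. Once straightened, it lies in a subspace of
  smaller dimension, where the induction hypothesis provides charts of the full order
  \<open>Suc k\<close>.\<close>

lemma flat_cover_near_regular_zero:
  fixes A :: "'a::euclidean_space set" and g :: "'a \<Rightarrow> real"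
  assumes IH: "\<And>U L1 (A :: 'a set). \<lbrakk>open U; subspace L1; dim L1 < dim L; A \<subseteq> U \<inter> L1\<rbrakk> \<Longrightarrow> flat_cover (Suc k) U L1 A A"
    and U: "open U" and L: "subspace L" and A: "A \<subseteq> U \<inter> L" and x: "x \<in> A"
    and g: "Ck_on (Suc k) g U" "\<forall>x\<in>A. g x = 0" and e0: "e0 \<in> L" "frechet_derivative g (at x) e0 \<noteq> 0"
  shows "\<exists>N. open N \<and> x \<in> N \<and> flat_cover (Suc k) U L A (A \<inter> N)"
proof -
  define l where "l = frechet_derivative g (at x)"
  have xU: "x \<in> U" and xL: "x \<in> L" using x A by auto
  have der_g: "(g has_derivative l) (at x)"
    unfolding l_def by (rule Ck_on_has_derivative[OF U g(1) xU])
  then have bl: "bounded_linear l" and lin: "linear l"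
    using has_derivative_bounded_linear has_derivative_linear by blast+
  \<comment> \<open>With l e = 1, the map z -> z - (l z) e is the projection onto the kernel of
    \<open>l\<close> along \<open>e\<close>; for z = y - x this is the value of \<open>F\<close> at
    a zero y of \<open>g\<close>.\<close>
  define e where "e = e0 /\<^sub>R l e0"
  have e: "e \<in> L" "l e = 1"
    using e0 L by (auto simp: e_def l_def[symmetric] subspace_scale linear_scale[OF lin])
  txt \<open>A diffeomorphism near \<open>x\<close> carrying the zeros of \<open>g\<close> in \<open>L\<close> into the smaller subspace \<open>L \<inter> ker l\<close>.\<close>
  define F where "F = (\<lambda>y. (y - x) + (g y - l (y - x)) *\<^sub>R e)"
  have Cdiff: "Ck_on (Suc k) (\<lambda>y. y - x) U"
    using Ck_on_add[OF U Ck_on_bounded_linear[OF U bounded_linear_ident] Ck_on_const[OF U, of _ "- x"]] by simp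
  have "Ck_on (Suc k) (\<lambda>y. g y + (- l (y - x))) U"
    by (rule Ck_on_add[OF U g(1) Ck_on_linear_comp[OF bounded_linear_minus[OF bl] U Cdiff]])
  then have CF: "Ck_on (Suc k) F U"
    unfolding F_def diff_conv_add_uminus[of "g _"]
    by (rule Ck_on_add[OF U Cdiff Ck_on_linear_comp[OF bounded_linear_scaleR_left U]])
  have dF: "(F has_derivative (\<lambda>h. h)) (at x)"
  proof -
    have "(F has_derivative (\<lambda>h. (h - 0) + (l h - l (h - 0)) *\<^sub>R e)) (at x)"
      unfolding F_def
      by (intro has_derivative_add has_derivative_diff has_derivative_scaleR_left has_derivative_ident
          has_derivative_const der_g bounded_linear.has_derivative[OF bl])
    then show ?thesis by simp
  qed
  obtain U' V G where inv: "open U'" "U' \<subseteq> U" "x \<in> U'" "open V" "F x \<in> V"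
    "homeomorphism U' V F G" "Ck_on (Suc k) G V"
    using Ck_local_inverse[OF U CF xU dF] by metis
  define L1 where "L1 = L \<inter> {z. l z = 0}"
  have L1: "subspace L1"
    unfolding L1_def by (intro subspace_inter L linear_subspace_kernel lin)
  have "e \<notin> L1" "L1 \<subseteq> L" using e by (simp_all add: L1_def)
  then have "L1 \<subset> L" using e(1) by blast
  then have dimL1: "dim L1 < dim L"
    using L L1 dim_psubset[of L1 L] by (simp add: span_eq_iff[THEN iffD2])
  have FA: "F ` (A \<inter> U') \<subseteq> V \<inter> L1"
  proof
    fix z assume "z \<in> F ` (A \<inter> U')"
    then obtain y where y: "y \<in> A" "y \<in> U'" "z = F y" by auto
    have "F y = (y - x) - l (y - x) *\<^sub>R e" using y(1) g(2) by (simp add: F_def)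
    moreover have "(y - x) - l (y - x) *\<^sub>R e \<in> L"
      using y(1) A xL e(1) L by (intro subspace_diff subspace_scale) auto
    moreover have "l ((y - x) - l (y - x) *\<^sub>R e) = 0"
      by (simp add: linear_diff[OF lin, of _ "_ *\<^sub>R _"] linear_scale[OF lin] e)
    moreover have "F y \<in> V" using inv(6) y(2) unfolding homeomorphism_def by auto
    ultimately show "z \<in> V \<inter> L1" using y by (simp add: L1_def)
  qed
  have GL: "G ` (V \<inter> L1) \<subseteq> L"
  proof
    fix y assume "y \<in> G ` (V \<inter> L1)"
    then obtain z where z: "z \<in> V" "z \<in> L" "y = G z" by (auto simp: L1_def)
    have "F y = z" using inv(6) z unfolding homeomorphism_def by auto
    then have "y = x + z - (g y - l (y - x)) *\<^sub>R e" by (simp add: F_def algebra_simps)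
    also have "\<dots> \<in> L" using xL z e(1) L by (intro subspace_diff subspace_add subspace_scale)
    finally show "y \<in> L" .
  qed
  obtain Q where Q: "countable Q" "F ` (A \<inter> U') \<subseteq> \<Union>Q"
    "\<forall>P\<in>Q. \<exists>D \<psi>. flat_chart (Suc k) V L1 (F ` (A \<inter> U')) D \<psi> P"
    by (rule flat_coverE[OF IH[OF inv(4) L1 dimL1 FA]])
  have "A \<inter> U' \<subseteq> \<Union>((`) G ` Q)"
  proof
    fix y assume y: "y \<in> A \<inter> U'"
    then obtain P where P: "P \<in> Q" "F y \<in> P" using Q(2) by blast
    have "y = G (F y)" using inv(6) y unfolding homeomorphism_def by auto
    then show "y \<in> \<Union>((`) G ` Q)" using P by blast
  qed
  moreover have "\<exists>D \<psi>. flat_chart (Suc k) U L A D \<psi> P'" if P': "P' \<in> (`) G ` Q" for P'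
  proof -
    obtain P where P: "P \<in> Q" "P' = G ` P" using P' by blast
    then obtain D \<psi> where "flat_chart (Suc k) V L1 (F ` (A \<inter> U')) D \<psi> P" using Q(3) by blast
    from flat_chart_image[OF inv(4) U inv(2,6,7) this GL] dimL1 P(2) show ?thesis by auto
  qed
  ultimately have "flat_cover (Suc k) U L A (A \<inter> U')"
    unfolding flat_cover_def using Q(1) by (intro exI[of _ "(`) G ` Q"]) auto
  then show ?thesis using inv by blast
qed

text \<open>Morse's lemma, by induction on the order and, for a fixed order, on the dimension of
  \<open>L\<close>. Where all C^(k+1) functions vanishing on \<open>A\<close> are critical along
  \<open>L\<close>, charts of order k improve by one order; where one of them is not, the dimension
  drops.\<close>

lemma flat_cover_exists:
  fixes A :: "'a::euclidean_space set"
  assumes "open U" "subspace L" "A \<subseteq> U \<inter> L"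
  shows "flat_cover k U L A A"
  using assms
proof (induction k arbitrary: U L A)
  case 0
  then show ?case by (intro flat_cover_0)
next
  case (Suc k)
  note IHk = Suc.IH
  show ?case using Suc.prems
  proof (induction "dim L" arbitrary: U L A rule: less_induct)
    case less
    define B where "B = {x\<in>A. \<exists>g e. Ck_on (Suc k) g U \<and> (\<forall>x\<in>A. g x = (0::real)) \<and> e \<in> L \<and> frechet_derivative g (at x) e \<noteq> 0}"
    have "flat_cover k U L (A - B) (A - B)" using less.prems by (intro IHk) auto
    then obtain Q where Q: "countable Q" "A - B \<subseteq> \<Union>Q" "\<forall>P\<in>Q. \<exists>D \<psi>. flat_chart k U L (A - B) D \<psi> P"
      by (rule flat_coverE)
    have "flat_chart (Suc k) U L A D \<psi> P" if "flat_chart k U L (A - B) D \<psi> P" for D \<psi> P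
      by (rule flat_chart_Suc[OF less.prems(1,2) _ that]) (auto simp: B_def)
    then have "\<exists>D \<psi>. flat_chart (Suc k) U L A D \<psi> P" if "P \<in> Q" for P using bspec[OF Q(3) that] by blast
    then have 1: "flat_cover (Suc k) U L A (A - B)"
      unfolding flat_cover_def using Q(1,2) by (intro exI[of _ Q]) blast
    have "flat_cover (Suc k) U L A B"
    proof (rule flat_cover_local)
      fix x assume x: "x \<in> B"
      then obtain g e where g: "x \<in> A" "Ck_on (Suc k) g U" "\<forall>x\<in>A. g x = (0::real)" "e \<in> L" "frechet_derivative g (at x) e \<noteq> 0"
        unfolding B_def by blast
      have "\<exists>N. open N \<and> x \<in> N \<and> flat_cover (Suc k) U L A (A \<inter> N)"
        by (rule flat_cover_near_regular_zero[OF _ less.prems(1,2,3) g]) (rule less.hyps)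
      then obtain N where "open N" "x \<in> N" "flat_cover (Suc k) U L A (A \<inter> N)" by blast
      then show "\<exists>N. open N \<and> x \<in> N \<and> flat_cover (Suc k) U L A (B \<inter> N)"
        using flat_cover_subset[of "Suc k" U L A "A \<inter> N" "B \<inter> N"] by (auto simp: B_def)
    qed
    from flat_cover_Un[OF 1 this] show ?case by (rule flat_cover_subset) auto
  qed
qed

section \<open>Grids, small oscillation and null images\<close>

lemma bounded_finite_grid:
  fixes S :: "'a::euclidean_space set"
  assumes S: "bounded S" and dim: "dim S \<le> n"
  obtains C :: real where "C > 0" "\<And>N::nat. N > 0 \<Longrightarrow>
    \<exists>\<T>. finite \<T> \<and> real (card \<T>) \<le> C * real N ^ n \<and> S \<subseteq> \<Union>\<T> \<and> (\<forall>T\<in>\<T>. \<forall>x\<in>T. \<forall>y\<in>T. dist x y \<le> C / N)"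
proof -
  obtain B where B: "B \<subseteq> span S" "pairwise orthogonal B" "\<And>b. b \<in> B \<Longrightarrow> norm b = 1" "independent B"
    "card B = dim (span S)" "span B = span S"
    using orthonormal_basis_subspace[OF subspace_span[of S]] by metis
  then have finB: "finite B" using independent_imp_finite by blast
  have cardB: "card B \<le> n" using B(5) dim by simp
  obtain R0 where R0: "\<And>x. x \<in> S \<Longrightarrow> norm x \<le> R0" using S unfolding bounded_iff by blast
  obtain R :: nat where R: "R0 \<le> R" using real_arch_simple by blast
  \<comment> \<open>One constant for two bounds: (2R + 1)^n for the number of cells of side 1/N, and
    n for the diameter, estimated by a sum over at most n coordinates.\<close>
  define C where "C = real ((2 * R + 1) ^ n + n + 1)"
  have "\<exists>\<T>. finite \<T> \<and> real (card \<T>) \<le> C * real N ^ n \<and> S \<subseteq> \<Union>\<T> \<and> (\<forall>T\<in>\<T>. \<forall>x\<in>T. \<forall>y\<in>T. dist x y \<le> C / N)"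
    if N: "N > 0" for N :: nat
  proof -
    let ?I = "{- int (N * R)..int (N * R)}"
    define cell where "cell = (\<lambda>\<phi>. {x\<in>S. \<forall>b\<in>B. \<lfloor>N * (x \<bullet> b)\<rfloor> = \<phi> b})"
    define \<T> where "\<T> = cell ` (PiE B (\<lambda>_. ?I))"
    have fin: "finite (PiE B (\<lambda>_. ?I))" using finB by (intro finite_PiE) auto
    have "card \<T> \<le> card (PiE B (\<lambda>_. ?I))" unfolding \<T>_def by (rule card_image_le[OF fin])
    also have "\<dots> = (2 * (N * R) + 1) ^ card B"
      by (simp add: card_PiE[OF finB] nat_add_distrib nat_mult_distrib)
    also have "\<dots> \<le> ((2 * R + 1) * N) ^ card B" using N by (intro power_mono) (auto simp: algebra_simps)
    also have "\<dots> \<le> ((2 * R + 1) * N) ^ n" using N cardB by (intro power_increasing) auto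
    finally have "real (card \<T>) \<le> real (((2 * R + 1) * N) ^ n)" by (rule of_nat_mono)
    also have "\<dots> = real ((2 * R + 1) ^ n) * real N ^ n" by (simp only: power_mult_distrib of_nat_mult of_nat_power)
    also have "\<dots> \<le> C * real N ^ n" unfolding C_def by (intro mult_right_mono) auto
    finally have c: "real (card \<T>) \<le> C * real N ^ n" .
    have cover: "S \<subseteq> \<Union>\<T>"
    proof
      fix x assume x: "x \<in> S"
      define \<phi> where "\<phi> = restrict (\<lambda>b. \<lfloor>N * (x \<bullet> b)\<rfloor>) B"
      have "\<phi> \<in> PiE B (\<lambda>_. ?I)"
      proof (rule PiE_I)
        fix b assume b: "b \<in> B"
        have "\<bar>x \<bullet> b\<bar> \<le> norm x * norm b" by (rule Cauchy_Schwarz_ineq2)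
        also have "\<dots> \<le> R" using B(3)[OF b] R0[OF x] R by simp
        finally have "N * \<bar>x \<bullet> b\<bar> \<le> N * real R" by (intro mult_left_mono) auto
        then have "\<bar>N * (x \<bullet> b)\<bar> \<le> real (N * R)" by (simp add: abs_mult)
        then have "- real (N * R) \<le> N * (x \<bullet> b)" "N * (x \<bullet> b) \<le> real (N * R)" by linarith+
        then have "- int (N * R) \<le> \<lfloor>N * (x \<bullet> b)\<rfloor>" "\<lfloor>N * (x \<bullet> b)\<rfloor> \<le> int (N * R)"
          by (simp_all add: le_floor_iff floor_le_iff)
        then show "\<phi> b \<in> ?I" using b by (simp add: \<phi>_def)
      qed (auto simp: \<phi>_def)
      moreover have "x \<in> cell \<phi>" using x by (auto simp: cell_def \<phi>_def)
      ultimately show "x \<in> \<Union>\<T>" unfolding \<T>_def by blast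
    qed
    have "dist x y \<le> C / N" if T: "T \<in> \<T>" "x \<in> T" "y \<in> T" for T x y
    proof -
      have xy: "x \<in> S" "y \<in> S" "\<And>b. b \<in> B \<Longrightarrow> \<lfloor>N * (x \<bullet> b)\<rfloor> = \<lfloor>N * (y \<bullet> b)\<rfloor>"
        using T unfolding \<T>_def cell_def by auto
      have "x - y \<in> span B" unfolding B(6) using xy by (intro span_diff span_base)
      then have "x - y = (\<Sum>b\<in>B. ((x - y) \<bullet> b) *\<^sub>R b)"
        using orthonormal_basis_expand[OF B(2,3) _ finB] by simp
      then have "norm (x - y) \<le> (\<Sum>b\<in>B. norm (((x - y) \<bullet> b) *\<^sub>R b))" by (metis norm_sum)
      also have "\<dots> \<le> (\<Sum>b\<in>B. 1 / N)"
      proof (rule sum_mono)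
        fix b assume b: "b \<in> B"
        have "\<bar>N * (x \<bullet> b) - N * (y \<bullet> b)\<bar> \<le> 1" using xy(3)[OF b] by linarith
        then have "N * \<bar>(x - y) \<bullet> b\<bar> \<le> 1"
          by (simp add: inner_diff_left right_diff_distrib[symmetric] abs_mult)
        then show "norm (((x - y) \<bullet> b) *\<^sub>R b) \<le> 1 / N" using N B(3)[OF b] by (simp add: field_simps)
      qed
      also have "\<dots> = real (card B) / N" by simp
      also have "\<dots> \<le> C / N"
      proof (rule divide_right_mono)
        show "real (card B) \<le> C" unfolding C_def of_nat_le_iff using cardB by simp
      qed simp
      finally show ?thesis by (simp add: dist_norm)
    qed
    then show ?thesis using c cover fin unfolding \<T>_def by blast
  qed
  moreover have "C > 0" unfolding C_def of_nat_0_less_iff by simp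
  ultimately show thesis using that by blast
qed

text \<open>Of the order of N^n cells, each with an image of length o(N^-n), have images of total
  length tending to 0.\<close>

lemma negligible_image_small_oscillation:
  fixes h :: "'a::euclidean_space \<Rightarrow> real"
  assumes S: "bounded S" "dim S \<le> n"
    and osc: "\<And>e. e > 0 \<Longrightarrow> \<exists>\<delta>>0. \<forall>x\<in>S. \<forall>y\<in>S. dist x y < \<delta> \<longrightarrow> \<bar>h y - h x\<bar> \<le> e * dist x y ^ n"
  shows "negligible (h ` S)"
  unfolding negligible_outer_le
proof (intro allI impI)
  fix e :: real assume e: "e > 0"
  obtain C where C: "C > 0" "\<And>N::nat. N > 0 \<Longrightarrow>
    \<exists>\<T>. finite \<T> \<and> real (card \<T>) \<le> C * real N ^ n \<and> S \<subseteq> \<Union>\<T> \<and> (\<forall>T\<in>\<T>. \<forall>x\<in>T. \<forall>y\<in>T. dist x y \<le> C / N)"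
    using bounded_finite_grid[OF S] by metis
  \<comment> \<open>Makes C N^n intervals of length 2 e1 (C/N)^n add up to exactly
    \<open>e\<close>.\<close>
  define e1 where "e1 = e / (2 * C ^ Suc n)"
  have e1: "e1 > 0" using e C by (simp add: e1_def)
  obtain \<delta> where \<delta>: "\<delta> > 0" "\<And>x y. x \<in> S \<Longrightarrow> y \<in> S \<Longrightarrow> dist x y < \<delta> \<Longrightarrow> \<bar>h y - h x\<bar> \<le> e1 * dist x y ^ n"
    using osc[OF e1] by blast
  obtain N0 :: nat where "C / \<delta> < N0" using reals_Archimedean2 by blast
  define N where "N = Suc N0"
  have N: "N > 0" "C / N < \<delta>"
  proof -
    have "C / \<delta> < N" using \<open>C / \<delta> < N0\<close> by (simp add: N_def)
    then show "C / N < \<delta>" using \<delta>(1) by (simp add: N_def field_simps)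
  qed (simp add: N_def)
  obtain \<T> where \<T>: "finite \<T>" "real (card \<T>) \<le> C * real N ^ n" "S \<subseteq> \<Union>\<T>"
    "\<And>T x y. T \<in> \<T> \<Longrightarrow> x \<in> T \<Longrightarrow> y \<in> T \<Longrightarrow> dist x y \<le> C / N"
    using C(2)[OF N(1)] by metis
  define r where "r = e1 * (C / N) ^ n"
  have r: "r \<ge> 0" using e1 C by (simp add: r_def)
  define J where "J = (\<lambda>T. cball (h (SOME x. x \<in> T \<inter> S)) r)"
  have hJ: "h x \<in> J T" if "T \<in> \<T>" "x \<in> T" "x \<in> S" for x T
  proof -
    define z where "z = (SOME x. x \<in> T \<inter> S)"
    have z: "z \<in> T \<inter> S" unfolding z_def by (rule someI[of _ x]) (use that in auto)
    have d: "dist z x \<le> C / N" using \<T>(4) that z by auto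
    then have "\<bar>h x - h z\<bar> \<le> e1 * dist z x ^ n" using \<delta>(2) z that N by auto
    also have "\<dots> \<le> r" unfolding r_def using e1 d by (intro mult_left_mono power_mono) auto
    finally show ?thesis by (simp add: J_def z_def dist_real_def)
  qed
  have meas: "measure lebesgue (J T) = 2 * r" for T
    using r by (simp add: J_def cball_eq_atLeastAtMost)
  show "\<exists>T. h ` S \<subseteq> T \<and> T \<in> lmeasurable \<and> measure lebesgue T \<le> e"
  proof (intro exI conjI)
    show "h ` S \<subseteq> (\<Union>T\<in>\<T>. J T)" using hJ \<T>(3) by blast
    show "(\<Union>T\<in>\<T>. J T) \<in> lmeasurable" using \<T>(1) by (intro fmeasurable.finite_UN) (auto simp: J_def)
    have "measure lebesgue (\<Union>T\<in>\<T>. J T) \<le> (\<Sum>T\<in>\<T>. measure lebesgue (J T))"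
      by (rule measure_UNION_le[OF \<T>(1)]) (auto simp: J_def)
    also have "\<dots> = card \<T> * (2 * r)" by (simp add: meas)
    also have "\<dots> \<le> (C * real N ^ n) * (2 * r)" using \<T>(2) r by (intro mult_right_mono) auto
    also have "\<dots> = e" using C(1) N(1) by (simp add: r_def e1_def field_simps)
    finally show "measure lebesgue (\<Union>T\<in>\<T>. J T) \<le> e" .
  qed
qed

text \<open>Charts of order n - 1 suffice: the derivatives of \<open>g\<close> along
  \<open>L\<close> vanish on the critical set, so one order is gained and \<open>g\<close> changes
  by o(|x - y|^n) over parameters of dimension at most \<open>n\<close>. Here class and dimension
  have to match.\<close>

theorem Morse_Sard_subspace:
  fixes g :: "'a::euclidean_space \<Rightarrow> real"
  assumes V: "open V" and g: "Ck_on n g V" and L: "subspace L" "dim L \<le> n"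
  shows "negligible (g ` {x\<in>V \<inter> L. \<forall>e\<in>L. frechet_derivative g (at x) e = 0})"
proof (cases n)
  \<comment> \<open>Without a derivative to spare no order can be gained, but then \<open>L\<close>
    is {0} and there is a single value.\<close>
  case 0
  then have "L \<subseteq> {0}" using L by (simp add: dim_eq_0)
  then have "g ` {x\<in>V \<inter> L. \<forall>e\<in>L. frechet_derivative g (at x) e = 0} \<subseteq> {g 0}" by blast
  then show ?thesis using negligible_subset negligible_sing by blast
next
  case (Suc k)
  define A where "A = {x\<in>V \<inter> L. \<forall>e\<in>L. frechet_derivative g (at x) e = 0}"
  have A: "A \<subseteq> V \<inter> L" by (auto simp: A_def)
  obtain Q where Q: "countable Q" "A \<subseteq> \<Union>Q" "\<forall>P\<in>Q. \<exists>D \<psi>. flat_chart k V L A D \<psi> P"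
    by (rule flat_coverE[OF flat_cover_exists[OF V L(1) A, of k]])
  have "negligible (g ` P)" if P: "P \<in> Q" for P
  proof -
    obtain D \<psi> where chart: "flat_chart k V L A D \<psi> P" using bspec[OF Q(3) P] by blast
    have c: "compact D" "dim D \<le> dim L" "P \<subseteq> \<psi> ` D" using chart unfolding flat_chart_def by auto
    let ?S = "{x\<in>D. \<psi> x \<in> P}"
    have "negligible ((\<lambda>x. g (\<psi> x)) ` ?S)"
    proof (rule negligible_image_small_oscillation)
      show "bounded ?S" using compact_imp_bounded[OF c(1)] by (rule bounded_subset) auto
      have "dim ?S \<le> dim D" by (intro dim_subset) auto
      then show "dim ?S \<le> n" using c(2) L(2) by simp
      fix e :: real assume e: "e > 0"
      have "frechet_derivative g (at x) h = 0" if "x \<in> A" "h \<in> L" for x h using that by (simp add: A_def)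
      from flat_chart_increment[OF V L(1) chart g[unfolded Suc] this e]
      obtain \<delta> where "\<delta> > 0" "\<forall>x\<in>D. \<forall>y\<in>D. \<psi> x \<in> P \<longrightarrow> dist x y < \<delta> \<longrightarrow> \<bar>g (\<psi> y) - g (\<psi> x)\<bar> \<le> e * dist x y ^ Suc k"
        by auto
      then show "\<exists>\<delta>>0. \<forall>x\<in>?S. \<forall>y\<in>?S. dist x y < \<delta> \<longrightarrow> \<bar>g (\<psi> y) - g (\<psi> x)\<bar> \<le> e * dist x y ^ n"
        unfolding Suc by (intro exI[of _ \<delta>]) simp
    qed
    moreover have "g ` P \<subseteq> (\<lambda>x. g (\<psi> x)) ` ?S" using c(3) by auto
    ultimately show ?thesis using negligible_subset by blast
  qed
  then have "negligible (\<Union>((`) g ` Q))" using Q(1) by blast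
  moreover have "g ` A \<subseteq> \<Union>((`) g ` Q)" using Q(2) by blast
  ultimately show ?thesis unfolding A_def using negligible_subset by blast
qed

section \<open>Tangent spaces of submanifolds\<close>

text \<open>The remainder is o(|y k - a|), and |y k - a| / |t k| is bounded since the scaled
  differences converge. The scales may have either sign: later they are differences between a time
  and times on both sides of it.\<close>

lemma secant_limit:
  fixes f :: "'a::real_normed_vector \<Rightarrow> 'b::real_normed_vector" and t :: "nat \<Rightarrow> real"
  assumes f: "(f has_derivative f') (at a)" and y: "y \<longlonglongrightarrow> a"
    and q: "(\<lambda>k. (y k - a) /\<^sub>R t k) \<longlonglongrightarrow> p"
  shows "(\<lambda>k. (f (y k) - f a) /\<^sub>R t k) \<longlonglongrightarrow> f' p"
proof -
  have bl: "bounded_linear f'" using f has_derivative_bounded_linear by blast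
  have lin: "linear f'" using bl by (rule bounded_linear.linear)
  define R where "R = (\<lambda>k. (f (y k) - f a - f' (y k - a)) /\<^sub>R t k)"
  obtain M where M: "M > 0" "\<And>k. norm ((y k - a) /\<^sub>R t k) \<le> M"
    using convergent_imp_Bseq[OF convergentI[OF q]] unfolding Bseq_def by auto
  have "R \<longlonglongrightarrow> 0"
  proof (rule LIMSEQ_I)
    fix e :: real assume e: "e > 0"
    then have "e / (2 * M) > 0" using M by simp
    then obtain d where d: "d > 0" "\<And>z. norm (z - a) < d \<Longrightarrow> norm (f z - f a - f' (z - a)) \<le> e / (2 * M) * norm (z - a)"
      using f unfolding has_derivative_at_alt by meson
    obtain N where N: "\<And>k. k \<ge> N \<Longrightarrow> norm (y k - a) < d" using LIMSEQ_D[OF y d(1)] by blast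
    have "norm (R k - 0) < e" if "k \<ge> N" for k
    proof -
      have eq: "norm (z /\<^sub>R t k) = norm z / \<bar>t k\<bar>" for z :: 'b
        by (simp add: divide_inverse_commute)
      have eqa: "norm (z /\<^sub>R t k) = norm z / \<bar>t k\<bar>" for z :: 'a
        by (simp add: divide_inverse_commute)
      have "norm (R k) = norm (f (y k) - f a - f' (y k - a)) / \<bar>t k\<bar>" unfolding R_def by (rule eq)
      also have "\<dots> \<le> (e / (2 * M) * norm (y k - a)) / \<bar>t k\<bar>" by (rule divide_right_mono[OF d(2)[OF N[OF that]] abs_ge_zero])
      also have "\<dots> = e / (2 * M) * norm ((y k - a) /\<^sub>R t k)"
        unfolding eqa by (rule times_divide_eq_right[symmetric])
      also have "\<dots> \<le> e / (2 * M) * M" by (rule mult_left_mono[OF M(2)]) (use M(1) e in simp)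
      also have "\<dots> < e" using M(1) e by simp
      finally show ?thesis by simp
    qed
    then show "\<exists>N. \<forall>k\<ge>N. norm (R k - 0) < e" by blast
  qed
  moreover have "(\<lambda>k. f' ((y k - a) /\<^sub>R t k)) \<longlonglongrightarrow> f' p" by (rule bounded_linear.tendsto[OF bl q])
  ultimately have "(\<lambda>k. R k + f' ((y k - a) /\<^sub>R t k)) \<longlonglongrightarrow> 0 + f' p" by (rule tendsto_add)
  moreover have "R k + f' ((y k - a) /\<^sub>R t k) = (f (y k) - f a) /\<^sub>R t k" for k
    unfolding linear_scale[OF lin] R_def by (simp add: scaleR_diff_right)
  ultimately show ?thesis by simp
qed

lemma has_vector_derivative_secants:
  fixes t :: "nat \<Rightarrow> real"
  assumes "(c has_vector_derivative w) (at a)" "t \<longlonglongrightarrow> 0" "\<And>k. t k \<noteq> 0"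
  shows "(\<lambda>k. (c (a + t k) - c a) /\<^sub>R t k) \<longlonglongrightarrow> w"
proof -
  have "filterlim (\<lambda>k. a + t k) (at a) sequentially"
    unfolding filterlim_at using assms(2,3) by (auto intro!: tendsto_eq_intros)
  from filterlim_compose[OF has_vector_derivative_slope[OF assms(1)] this] show ?thesis by simp
qed

lemma null_sequence_in_interval:
  assumes "(e::real) > 0"
  obtains t :: "nat \<Rightarrow> real" where "t \<longlonglongrightarrow> 0" "\<And>j. 0 < t j" "\<And>j. t j < e"
proof
  show "(\<lambda>j. e / 2 * inverse (real (Suc j))) \<longlonglongrightarrow> 0"
    by (rule tendsto_mult_right_zero[OF LIMSEQ_inverse_real_of_nat])
  fix j
  have "0 < inverse (real (Suc j))" "inverse (real (Suc j)) \<le> 1" by (simp_all add: inverse_le_1_iff)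
  then have "0 < e / 2 * inverse (real (Suc j))" "e / 2 * inverse (real (Suc j)) \<le> e / 2"
    using assms by (simp_all add: mult_left_le)
  then show "0 < e / 2 * inverse (real (Suc j))" "e / 2 * inverse (real (Suc j)) < e" using assms by auto
qed

lemma tangent_secants:
  fixes M :: "'a::euclidean_space set"
  assumes "w \<in> tangent_space M x"
  obtains y and t :: "nat \<Rightarrow> real" where "\<And>j. y j \<in> M" "y \<longlonglongrightarrow> x" "\<And>j. 0 < t j" "t \<longlonglongrightarrow> 0"
    "(\<lambda>j. (y j - x) /\<^sub>R t j) \<longlonglongrightarrow> w"
proof -
  obtain \<gamma> e where \<gamma>: "0 < e" "\<gamma> ` {-e<..<e} \<subseteq> M" "\<gamma> 0 = x" "(\<gamma> has_vector_derivative w) (at 0)"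
    using assms unfolding tangent_space_def by auto
  obtain t :: "nat \<Rightarrow> real" where t: "t \<longlonglongrightarrow> 0" "\<And>j. 0 < t j" "\<And>j. t j < e"
    using null_sequence_in_interval[OF \<gamma>(1)] by metis
  have t0: "t j \<noteq> 0" "t j \<in> {-e<..<e}" for j using t(2)[of j] t(3)[of j] \<gamma>(1) by auto
  have "isCont \<gamma> 0" using \<gamma>(4) by (rule has_vector_derivative_continuous)
  then have "(\<lambda>j. \<gamma> (t j)) \<longlonglongrightarrow> \<gamma> 0" using t(1) by (rule isCont_tendsto_compose)
  then have y: "(\<lambda>j. \<gamma> (t j)) \<longlonglongrightarrow> x" using \<gamma>(3) by simp
  have q: "(\<lambda>j. (\<gamma> (t j) - x) /\<^sub>R t j) \<longlonglongrightarrow> w"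
    using has_vector_derivative_secants[OF \<gamma>(4) t(1) t0(1)] \<gamma>(3) by simp
  show thesis by (rule that[of "\<lambda>j. \<gamma> (t j)" t]) (use y q t t0(2) \<gamma>(2) in auto)
qed

section \<open>A chart that straightens a submanifold\<close>

locale straightening =
  fixes k :: nat and M U V L :: "'a::euclidean_space set" and \<phi> \<psi> :: "'a \<Rightarrow> 'a"
  assumes open_U: "open U" and open_V: "open V" and hom: "homeomorphism U V \<phi> \<psi>"
    and Ck_\<phi>: "Ck_on (Suc k) \<phi> U" and Ck_\<psi>: "Ck_on (Suc k) \<psi> V"
    and subspace_L: "subspace L" and image: "\<phi> ` (M \<inter> U) = V \<inter> L"
begin

lemma \<psi>\<phi>: "x \<in> U \<Longrightarrow> \<psi> (\<phi> x) = x" and \<phi>\<psi>: "z \<in> V \<Longrightarrow> \<phi> (\<psi> z) = z"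
  and \<phi>_V: "x \<in> U \<Longrightarrow> \<phi> x \<in> V" and \<psi>_U: "z \<in> V \<Longrightarrow> \<psi> z \<in> U"
  using hom unfolding homeomorphism_def by auto

lemma \<psi>_M: "z \<in> V \<Longrightarrow> z \<in> L \<Longrightarrow> \<psi> z \<in> M"
  using image \<psi>\<phi> by (metis IntE IntI imageE)

lemma \<phi>_L: "x \<in> M \<Longrightarrow> x \<in> U \<Longrightarrow> \<phi> x \<in> L"
  using image by blast

abbreviation "D\<phi> x \<equiv> frechet_derivative \<phi> (at x)"
abbreviation "D\<psi> z \<equiv> frechet_derivative \<psi> (at z)"

lemma der_\<phi>: "x \<in> U \<Longrightarrow> (\<phi> has_derivative D\<phi> x) (at x)"
  by (rule Ck_on_has_derivative[OF open_U Ck_\<phi>])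

lemma der_\<psi>: "z \<in> V \<Longrightarrow> (\<psi> has_derivative D\<psi> z) (at z)"
  by (rule Ck_on_has_derivative[OF open_V Ck_\<psi>])

lemma linear_D\<psi>: "z \<in> V \<Longrightarrow> linear (D\<psi> z)"
  using der_\<psi> has_derivative_linear by blast

lemma D\<psi>_D\<phi>: 
  assumes x: "x \<in> U"
  shows "D\<psi> (\<phi> x) (D\<phi> x h) = h"
proof -
  have "((\<lambda>y. \<psi> (\<phi> y)) has_derivative (\<lambda>h. D\<psi> (\<phi> x) (D\<phi> x h))) (at x)"
    by (rule has_derivative_compose[OF der_\<phi>[OF x] der_\<psi>[OF \<phi>_V[OF x]]])
  then have "((\<lambda>y. y) has_derivative (\<lambda>h. D\<psi> (\<phi> x) (D\<phi> x h))) (at x)"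
    by (rule has_derivative_transform_within_open[OF _ open_U x]) (rule \<psi>\<phi>)
  from has_derivative_unique[OF this has_derivative_ident] show ?thesis by meson
qed

lemma D\<phi>_D\<psi>: 
  assumes z: "z \<in> V"
  shows "D\<phi> (\<psi> z) (D\<psi> z h) = h"
proof -
  have "((\<lambda>y. \<phi> (\<psi> y)) has_derivative (\<lambda>h. D\<phi> (\<psi> z) (D\<psi> z h))) (at z)"
    by (rule has_derivative_compose[OF der_\<psi>[OF z] der_\<phi>[OF \<psi>_U[OF z]]])
  then have "((\<lambda>y. y) has_derivative (\<lambda>h. D\<phi> (\<psi> z) (D\<psi> z h))) (at z)"
    by (rule has_derivative_transform_within_open[OF _ open_V z]) (rule \<phi>\<psi>)
  from has_derivative_unique[OF this has_derivative_ident] show ?thesis by meson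
qed

lemma inj_D\<psi>: "z \<in> V \<Longrightarrow> inj (D\<psi> z)"
  by (metis D\<phi>_D\<psi> injI)

text \<open>\<open>\<phi>\<close> maps secants of \<open>M\<close> to secants of \<open>L\<close>,
  which is closed. So limits of secants through arbitrary points of \<open>M\<close>, not only along
  C^1 curves, turn out to be tangent; the limit curves supply such secants.\<close>

lemma secant_in_image:
  fixes t :: "nat \<Rightarrow> real"
  assumes x: "x \<in> M" "x \<in> U" and y: "\<And>j. y j \<in> M" "y \<longlonglongrightarrow> x"
    and q: "(\<lambda>j. (y j - x) /\<^sub>R t j) \<longlonglongrightarrow> p"
  shows "p \<in> D\<psi> (\<phi> x) ` L"
proof -
  have lim: "(\<lambda>j. (\<phi> (y j) - \<phi> x) /\<^sub>R t j) \<longlonglongrightarrow> D\<phi> x p"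
    by (rule secant_limit[OF der_\<phi>[OF x(2)] y(2) q])
  have "\<forall>\<^sub>F j in sequentially. y j \<in> U"
    using y(2) open_U x(2) by (rule topological_tendstoD)
  then have "\<forall>\<^sub>F j in sequentially. (\<phi> (y j) - \<phi> x) /\<^sub>R t j \<in> L"
  proof (rule eventually_mono)
    fix j assume "y j \<in> U"
    then show "(\<phi> (y j) - \<phi> x) /\<^sub>R t j \<in> L"
      using \<phi>_L x y(1) subspace_L by (intro subspace_scale subspace_diff) auto
  qed
  from Lim_in_closed_set[OF closed_subspace[OF subspace_L] this trivial_limit_sequentially lim]
  have "D\<phi> x p \<in> L" .
  then show ?thesis using D\<psi>_D\<phi>[OF x(2), of p] by (metis imageI)
qed

lemma tangent_space_eq:
  assumes x: "x \<in> M" "x \<in> U"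
  shows "tangent_space M x = D\<psi> (\<phi> x) ` L"
proof
  show "tangent_space M x \<subseteq> D\<psi> (\<phi> x) ` L"
  proof
    fix w assume "w \<in> tangent_space M x"
    then obtain y and t :: "nat \<Rightarrow> real" where y: "\<And>j. y j \<in> M" "y \<longlonglongrightarrow> x"
      "(\<lambda>j. (y j - x) /\<^sub>R t j) \<longlonglongrightarrow> w"
      by (rule tangent_secants) blast
    then show "w \<in> D\<psi> (\<phi> x) ` L" by (rule secant_in_image[OF x])
  qed
  show "D\<psi> (\<phi> x) ` L \<subseteq> tangent_space M x"
  proof
    fix w assume "w \<in> D\<psi> (\<phi> x) ` L"
    then obtain l where l: "l \<in> L" "w = D\<psi> (\<phi> x) l" by blast
    define c where "c = (\<lambda>t::real. \<phi> x + t *\<^sub>R l)"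
    have contc: "continuous_on UNIV c" unfolding c_def by (intro continuous_intros)
    have "open (c -` V)" by (rule open_vimage[OF open_V contc])
    moreover have "0 \<in> c -` V" using \<phi>_V[OF x(2)] by (simp add: c_def)
    ultimately obtain e where e: "e > 0" "ball 0 e \<subseteq> c -` V" by (rule openE)
    then have cV: "c t \<in> V" if "t \<in> {-e<..<e}" for t
    proof -
      have "t \<in> ball 0 e" using that by (auto simp: dist_real_def)
      then show ?thesis using e(2) by blast
    qed
    have cL: "c t \<in> L" for t
      using \<phi>_L[OF x] l(1) subspace_L by (simp add: c_def subspace_add subspace_scale)
    have der: "((\<lambda>t. \<psi> (c t)) has_vector_derivative D\<psi> (c t) l) (at t)" if "t \<in> {-e<..<e}" for t
    proof -
      have "(c has_derivative (\<lambda>s. s *\<^sub>R l)) (at t)"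
        unfolding c_def by (auto intro!: derivative_eq_intros)
      from has_derivative_compose[OF this der_\<psi>[OF cV[OF that]]]
      show ?thesis unfolding has_vector_derivative_def by (simp add: linear_scale[OF linear_D\<psi>[OF cV[OF that]]])
    qed
    have "continuous_on {-e<..<e} (\<lambda>t. D\<psi> (c t) l)"
    proof (rule continuous_on_compose2[OF Ck_on_frechet_derivative_continuous[OF open_V Ck_\<psi>]])
      show "continuous_on {-e<..<e} c" by (rule continuous_on_subset[OF contc]) simp
      show "c ` {-e<..<e} \<subseteq> V" by (rule image_subsetI) (rule cV)
    qed
    then have "(\<lambda>t. \<psi> (c t)) C1_differentiable_on {-e<..<e}"
      unfolding C1_differentiable_on_def using der by (intro exI[of _ "\<lambda>t. D\<psi> (c t) l"]) simp
    moreover have "(\<lambda>t. \<psi> (c t)) ` {-e<..<e} \<subseteq> M"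
      by (rule image_subsetI) (rule \<psi>_M[OF cV cL])
    moreover have "\<psi> (c 0) = x" using \<psi>\<phi>[OF x(2)] by (simp add: c_def)
    moreover have "((\<lambda>t. \<psi> (c t)) has_vector_derivative w) (at 0)"
      using der[of 0] e(1) l(2) by (simp add: c_def)
    ultimately show "w \<in> tangent_space M x"
      unfolding tangent_space_def using e(1)
      by (intro CollectI exI[of _ "\<lambda>t. \<psi> (c t)"] exI[of _ e] conjI)
  qed
qed

lemma subspace_tangent_space:
  assumes x: "x \<in> M" "x \<in> U"
  shows "subspace (tangent_space M x)"
  unfolding tangent_space_eq[OF x] by (rule linear_subspace_image[OF linear_D\<psi>[OF \<phi>_V[OF x(2)]] subspace_L])

lemma dim_tangent_space:
  assumes x: "x \<in> M" "x \<in> U"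
  shows "dim (tangent_space M x) = dim L"
  unfolding tangent_space_eq[OF x]
  by (rule dim_image_eq[OF linear_D\<psi>[OF \<phi>_V[OF x(2)]]]) (use inj_D\<psi>[OF \<phi>_V[OF x(2)]] in \<open>auto intro: inj_on_subset\<close>)

text \<open>The counterpart of condition (a) within one submanifold: the same \<open>l\<close> is
  carried to nearby points by the continuous derivative of the chart.\<close>

lemma tangent_vectors_converge:
  assumes x: "x \<in> M" "x \<in> U" and y: "\<And>j. y j \<in> M" "\<And>j. y j \<in> U" "y \<longlonglongrightarrow> x"
    and w: "w \<in> tangent_space M x"
  shows "\<exists>u. (\<forall>j. u j \<in> tangent_space M (y j)) \<and> u \<longlonglongrightarrow> w"
proof -
  obtain l where l: "l \<in> L" "w = D\<psi> (\<phi> x) l" using w unfolding tangent_space_eq[OF x] by blast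
  have "isCont \<phi> x" using der_\<phi>[OF x(2)] has_derivative_continuous by blast
  then have "(\<lambda>j. \<phi> (y j)) \<longlonglongrightarrow> \<phi> x" using y(3) by (rule isCont_tendsto_compose)
  moreover have "isCont (\<lambda>z. D\<psi> z l) (\<phi> x)"
    using Ck_on_frechet_derivative_continuous[OF open_V Ck_\<psi>, of l] \<phi>_V[OF x(2)] open_V
    by (simp add: continuous_on_eq_continuous_at)
  ultimately have "(\<lambda>j. D\<psi> (\<phi> (y j)) l) \<longlonglongrightarrow> w" unfolding l(2) by (rule isCont_tendsto_compose[rotated])
  moreover have "D\<psi> (\<phi> (y j)) l \<in> tangent_space M (y j)" for j
    using tangent_space_eq[OF y(1,2)] l(1) by blast
  ultimately show ?thesis by (intro exI[of _ "\<lambda>j. D\<psi> (\<phi> (y j)) l"]) simp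
qed

end

section \<open>Tangent spaces without reference to a chart\<close>

lemma submanifold_straightening:
  fixes M :: "'a::euclidean_space set"
  assumes "submanifold (Suc k) d M" "x \<in> M"
  obtains U V L \<phi> \<psi> where "straightening k M U V L \<phi> \<psi>" "x \<in> U" "dim L = d"
proof -
  show thesis
    using bspec[OF assms(1)[unfolded submanifold_def] assms(2)]
  proof (elim exE)
    fix U V L :: "'a set" and \<phi> \<psi> :: "'a \<Rightarrow> 'a"
    assume "open U \<and> x \<in> U \<and> open V \<and> homeomorphism U V \<phi> \<psi>
        \<and> Ck_on (Suc k) \<phi> U \<and> Ck_on (Suc k) \<psi> V \<and> subspace L \<and> dim L = d \<and> \<phi> ` (M \<inter> U) = V \<inter> L"
    then show thesis
      by (intro that[of U V L \<phi> \<psi>]) (simp_all add: straightening_def del: Ck_on.simps)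
  qed
qed

lemma secant_limit_tangent:
  fixes t :: "nat \<Rightarrow> real"
  assumes M: "submanifold (Suc k) d M" "x \<in> M" and y: "\<And>j. y j \<in> M" "y \<longlonglongrightarrow> x"
    and q: "(\<lambda>j. (y j - x) /\<^sub>R t j) \<longlonglongrightarrow> p"
  shows "p \<in> tangent_space M x"
proof -
  obtain U V L \<phi> \<psi> where s: "straightening k M U V L \<phi> \<psi>" "x \<in> U" "dim L = d" by (rule submanifold_straightening[OF M])
  show ?thesis
    using straightening.secant_in_image[OF s(1) M(2) s(2) y q] straightening.tangent_space_eq[OF s(1) M(2) s(2)] by simp
qed

lemma submanifold_tangent_space:
  assumes M: "submanifold (Suc k) d M" "x \<in> M"
  shows "subspace (tangent_space M x)" "dim (tangent_space M x) = d"
proof -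
  obtain U V L \<phi> \<psi> where s: "straightening k M U V L \<phi> \<psi>" "x \<in> U" "dim L = d" by (rule submanifold_straightening[OF M])
  show "subspace (tangent_space M x)" "dim (tangent_space M x) = d"
    using straightening.subspace_tangent_space[OF s(1) M(2) s(2)] straightening.dim_tangent_space[OF s(1) M(2) s(2)] s(3) by auto
qed

section \<open>Grassmannian limits and condition (a)\<close>

lemma bounded_subsequence:
  fixes g :: "nat \<Rightarrow> 'a::euclidean_space"
  assumes "\<And>k. norm (g k) \<le> M"
  obtains l s where "strict_mono (s :: nat \<Rightarrow> nat)" "(\<lambda>k. g (s k)) \<longlonglongrightarrow> l"
proof -
  have "\<And>k. g k \<in> cball 0 M" using assms by simp
  then obtain l s where "strict_mono (s :: nat \<Rightarrow> nat)" "(g \<circ> s) \<longlonglongrightarrow> l"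
    using compact_cball[of "0::'a" M, unfolded compact_eq_seq_compact_metric seq_compact_def, rule_format, of g] by blast
  then show thesis by (intro that) (auto simp: o_def)
qed

lemma convergent_finite_family:
  fixes e :: "nat \<Rightarrow> nat \<Rightarrow> 'a::euclidean_space"
  assumes "\<And>k i. i < d \<Longrightarrow> norm (e k i) \<le> M"
  shows "\<exists>s l. strict_mono (s::nat \<Rightarrow> nat) \<and> (\<forall>i<d. (\<lambda>k. e (s k) i) \<longlonglongrightarrow> l i)"
  using assms
proof (induction d)
  case 0
  have "strict_mono (id :: nat \<Rightarrow> nat)" by (simp add: strict_mono_def)
  then show ?case by blast
next
  case (Suc d)
  then obtain s l where s: "strict_mono (s::nat \<Rightarrow> nat)" "\<forall>i<d. (\<lambda>k. e (s k) i) \<longlonglongrightarrow> l i"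
    using less_SucI by blast
  have "norm (e (s k) d) \<le> M" for k using Suc.prems by simp
  then obtain a s' where s': "strict_mono (s'::nat \<Rightarrow> nat)" "(\<lambda>k. e (s (s' k)) d) \<longlonglongrightarrow> a"
    by (rule bounded_subsequence)
  have "(\<lambda>k. e ((s \<circ> s') k) i) \<longlonglongrightarrow> (l(d := a)) i" if "i < Suc d" for i
  proof (cases "i = d")
    case False
    then have "(\<lambda>k. e (s k) i) \<longlonglongrightarrow> l i" using s(2) that by simp
    from LIMSEQ_subseq_LIMSEQ[OF this s'(1)] False show ?thesis by (simp add: o_def)
  qed (use s'(2) in \<open>simp add: o_def\<close>)
  moreover have "strict_mono (s \<circ> s')" using s(1) s'(1) by (rule strict_mono_o)
  ultimately show ?case by (intro exI[of _ "s \<circ> s'"] exI[of _ "l(d := a)"]) blast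
qed

text \<open>Indexed families, unlike sets, let bases of varying subspaces converge vector by
  vector.\<close>

definition orthonormal_family :: "nat \<Rightarrow> (nat \<Rightarrow> 'a::euclidean_space) \<Rightarrow> bool" where
  "orthonormal_family d e \<longleftrightarrow> (\<forall>i<d. \<forall>j<d. e i \<bullet> e j = (if i = j then 1 else 0))"

lemma orthonormal_familyD:
  assumes "orthonormal_family d e" "i < d"
  shows "e i \<bullet> e i = 1" "norm (e i) = 1" "j < d \<Longrightarrow> i \<noteq> j \<Longrightarrow> e i \<bullet> e j = 0"
  using assms unfolding orthonormal_family_def by (simp_all add: norm_eq_1)

lemma closest_point_span_orthonormal:
  assumes e: "orthonormal_family d e"
  shows "closest_point (span (e ` {..<d})) u = (\<Sum>i<d. (u \<bullet> e i) *\<^sub>R e i)"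
proof -
  let ?T = "span (e ` {..<d})" and ?p = "\<Sum>i<d. (u \<bullet> e i) *\<^sub>R e i"
  have p: "?p \<in> ?T" by (intro span_sum span_scale span_base) auto
  have "(u - ?p) \<bullet> e j = 0" if "j < d" for j
  proof -
    have "?p \<bullet> e j = (\<Sum>i<d. (u \<bullet> e i) * (if i = j then 1 else 0))"
      unfolding inner_sum_left using e that by (intro sum.cong) (auto simp: orthonormal_family_def)
    then show ?thesis using that by (simp add: inner_diff_left if_distrib cong: if_cong)
  qed
  then have orth: "orthogonal (u - ?p) z" if "z \<in> ?T" for z
    by (intro orthogonal_to_span[OF that]) (auto simp: orthogonal_def)
  have "dist u ?p \<le> dist u z" if z: "z \<in> ?T" for z
  proof -
    have "?p - z \<in> ?T" using p z by (rule span_diff)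
    then have "(norm ((u - ?p) + (?p - z)))\<^sup>2 = (norm (u - ?p))\<^sup>2 + (norm (?p - z))\<^sup>2"
      by (intro norm_add_Pythagorean orth)
    then have "(norm (u - ?p))\<^sup>2 \<le> (norm (u - z))\<^sup>2" by simp
    then have "norm (u - ?p) \<le> norm (u - z)" by (rule power2_le_imp_le) simp
    then show ?thesis by (simp add: dist_norm)
  qed
  then have "?p = closest_point ?T u"
    using p by (intro closest_point_unique) (auto intro: closed_subspace subspace_imp_convex)
  then show ?thesis by simp
qed

lemma orthonormal_family_exists:
  assumes T: "subspace (T :: 'a::euclidean_space set)" "dim T = d"
  obtains e where "orthonormal_family d e" "T = span (e ` {..<d})"
proof -
  obtain B where B: "B \<subseteq> T" "pairwise orthogonal B" "\<And>b. b \<in> B \<Longrightarrow> norm b = 1" "independent B" "card B = dim T" "span B = T"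
    using orthonormal_basis_subspace[OF T(1)] by metis
  have "finite B" using B(4) independent_imp_finite by blast
  then obtain e where e: "bij_betw e {0..<card B} B" using ex_bij_betw_nat_finite by blast
  have d: "{0..<card B} = {..<d}" using B(5) T(2) by auto
  have img: "e ` {..<d} = B" and inj: "inj_on e {..<d}" using e unfolding bij_betw_def d by auto
  have "orthonormal_family d e"
    unfolding orthonormal_family_def
  proof (intro allI impI)
    fix i j assume ij: "i < d" "j < d"
    then have eB: "e i \<in> B" "e j \<in> B" using img by auto
    show "e i \<bullet> e j = (if i = j then 1 else 0)"
    proof (cases "i = j")
      case True
      then show ?thesis using B(3)[OF eB(1)] by (simp add: norm_eq_1)
    next
      case False
      then have "e i \<noteq> e j" using inj ij by (auto dest: inj_onD)
      then show ?thesis using B(2) eB False by (auto simp: pairwise_def orthogonal_def)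
    qed
  qed
  then show thesis using that img B(6) by auto
qed

lemma orthonormal_family_dim:
  assumes e: "orthonormal_family d (e :: nat \<Rightarrow> 'a::euclidean_space)"
  shows "dim (span (e ` {..<d})) = d"
proof -
  have inj: "inj_on e {..<d}"
  proof (rule inj_onI)
    fix i j assume ij: "i \<in> {..<d}" "j \<in> {..<d}" "e i = e j"
    then have id: "i < d" "j < d" by auto
    then show "i = j"
      using orthonormal_familyD(1)[OF e id(1)] orthonormal_familyD(3)[OF e id] ij(3) by (cases "i = j") auto
  qed
  have "pairwise orthogonal (e ` {..<d})"
    using orthonormal_familyD(3)[OF e] by (fastforce simp: pairwise_def orthogonal_def)
  moreover have "0 \<notin> e ` {..<d}"
  proof
    assume "0 \<in> e ` {..<d}"
    then obtain i where "i < d" "e i = 0" by auto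
    with orthonormal_familyD(1)[OF e] show False by fastforce
  qed
  ultimately have "independent (e ` {..<d})" by (rule pairwise_orthogonal_independent)
  then have "dim (e ` {..<d}) = card (e ` {..<d})" by (rule dim_eq_card_independent)
  then show ?thesis using inj by (simp add: card_image)
qed

lemma bounded_linear_orthonormal_projection: "bounded_linear (\<lambda>u. \<Sum>i<d. (u \<bullet> e i) *\<^sub>R e i)"
  by (intro bounded_linear_sum bounded_linear_scaleR_const bounded_linear_inner_left)

text \<open>Orthonormal bases of the \<open>T k\<close> converge along a subsequence, and the limit
  is orthonormal. The projections u -> sum (u . e_i) e_i depend continuously on the basis: their
  distance in operator norm is at most 2 sum |e_i - l_i|.\<close>

lemma grassmannian_compact:
  fixes T :: "nat \<Rightarrow> 'a::euclidean_space set"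
  assumes T: "\<And>k. subspace (T k)" "\<And>k. dim (T k) = d"
  obtains s V where "strict_mono (s :: nat \<Rightarrow> nat)" "grassmannian_tendsto (\<lambda>k. T (s k)) V"
proof -
  have "\<exists>e. orthonormal_family d e \<and> T k = span (e ` {..<d})" for k
    using orthonormal_family_exists[OF T] by metis
  then obtain e where e: "\<And>k. orthonormal_family d (e k)" "\<And>k. T k = span (e k ` {..<d})" by metis
  have norm1: "norm (e k i) = 1" if "i < d" for k i
    using orthonormal_familyD(2)[OF e(1) that] .
  then obtain s l where s: "strict_mono (s::nat \<Rightarrow> nat)" "\<forall>i<d. (\<lambda>k. e (s k) i) \<longlonglongrightarrow> l i"
    using convergent_finite_family[of d e 1] by auto
  have lim: "(\<lambda>k. e (s k) i) \<longlonglongrightarrow> l i" if "i < d" for i using s(2) that by blast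
  have l: "orthonormal_family d l"
    unfolding orthonormal_family_def
  proof (intro allI impI)
    fix i j assume ij: "i < d" "j < d"
    have lim_ij: "(\<lambda>k. e (s k) i \<bullet> e (s k) j) \<longlonglongrightarrow> l i \<bullet> l j" by (intro tendsto_inner lim ij)
    have "(\<lambda>k. e (s k) i \<bullet> e (s k) j) = (\<lambda>k. if i = j then 1 else 0)"
    proof
      show "e (s k) i \<bullet> e (s k) j = (if i = j then 1 else 0)" for k
        using orthonormal_familyD(1)[OF e(1) ij(1), of "s k"] orthonormal_familyD(3)[OF e(1) ij, of "s k"]
        by (cases "i = j") auto
    qed
    from lim_ij[unfolded this] show "l i \<bullet> l j = (if i = j then 1 else 0)"
      unfolding LIMSEQ_const_iff by simp
  qed
  have norml: "norm (l i) = 1" if "i < d" for i using orthonormal_familyD(2)[OF l that] .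
  define V where "V = span (l ` {..<d})"
  let ?f = "\<lambda>k u. closest_point (T (s k)) u - closest_point V u"
  have f: "?f k = (\<lambda>u. (\<Sum>i<d. (u \<bullet> e (s k) i) *\<^sub>R e (s k) i) - (\<Sum>i<d. (u \<bullet> l i) *\<^sub>R l i))" for k
    unfolding e(2) V_def closest_point_span_orthonormal[OF e(1)] closest_point_span_orthonormal[OF l] ..
  have bl: "bounded_linear (?f k)" for k
    unfolding f by (intro bounded_linear_sub bounded_linear_orthonormal_projection)
  have upper: "onorm (?f k) \<le> (\<Sum>i<d. 2 * norm (e (s k) i - l i))" for k
  proof (rule onorm_bound)
    show "0 \<le> (\<Sum>i<d. 2 * norm (e (s k) i - l i))" by (intro sum_nonneg) simp
    fix u
    have "?f k u = (\<Sum>i<d. (u \<bullet> e (s k) i) *\<^sub>R e (s k) i - (u \<bullet> l i) *\<^sub>R l i)"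
      unfolding sum_subtractf by (rule fun_cong[OF f])
    also have "norm \<dots> \<le> (\<Sum>i<d. 2 * norm (e (s k) i - l i) * norm u)"
    proof (rule sum_norm_le)
      fix i assume "i \<in> {..<d}"
      then have i: "i < d" by simp
      have "(u \<bullet> e (s k) i) *\<^sub>R e (s k) i - (u \<bullet> l i) *\<^sub>R l i
          = (u \<bullet> (e (s k) i - l i)) *\<^sub>R e (s k) i + (u \<bullet> l i) *\<^sub>R (e (s k) i - l i)"
        by (simp add: inner_diff_right scaleR_diff_left scaleR_diff_right)
      also have "norm \<dots> \<le> \<bar>u \<bullet> (e (s k) i - l i)\<bar> * norm (e (s k) i) + \<bar>u \<bullet> l i\<bar> * norm (e (s k) i - l i)"
        by (rule norm_triangle_le) simp
      also have "\<dots> \<le> (norm u * norm (e (s k) i - l i)) * 1 + (norm u * 1) * norm (e (s k) i - l i)"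
        using norm1[OF i] norml[OF i] Cauchy_Schwarz_ineq2[of u "e (s k) i - l i"] Cauchy_Schwarz_ineq2[of u "l i"]
        by (intro add_mono mult_mono) auto
      finally show "norm ((u \<bullet> e (s k) i) *\<^sub>R e (s k) i - (u \<bullet> l i) *\<^sub>R l i) \<le> 2 * norm (e (s k) i - l i) * norm u"
        by (simp only: mult_1_right mult_2 distrib_right mult.commute[of "norm u"])
    qed
    finally show "norm (?f k u) \<le> (\<Sum>i<d. 2 * norm (e (s k) i - l i)) * norm u"
      by (simp add: sum_distrib_right)
  qed
  have "(\<lambda>k. \<Sum>i<d. 2 * norm (e (s k) i - l i)) \<longlonglongrightarrow> (\<Sum>i<d. 0)"
  proof (rule tendsto_sum)
    fix i assume "i \<in> {..<d}"
    then have "(\<lambda>k. e (s k) i - l i) \<longlonglongrightarrow> 0" using LIM_zero[OF lim] by simp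
    then show "(\<lambda>k. 2 * norm (e (s k) i - l i)) \<longlonglongrightarrow> 0" by (intro tendsto_mult_right_zero tendsto_norm_zero)
  qed
  then have lim0: "(\<lambda>k. \<Sum>i<d. 2 * norm (e (s k) i - l i)) \<longlonglongrightarrow> 0" by simp
  have "(\<lambda>k. onorm (?f k)) \<longlonglongrightarrow> 0"
    by (rule tendsto_sandwich[OF always_eventually always_eventually tendsto_const lim0])
      (use upper onorm_pos_le[OF bl] in auto)
  moreover have "dim V = d" unfolding V_def by (rule orthonormal_family_dim[OF l])
  ultimately have "grassmannian_tendsto (\<lambda>k. T (s k)) V"
    unfolding grassmannian_tendsto_def using T by (simp add: V_def)
  with s(1) show thesis by (rule that)
qed

lemma bounded_linear_closest_point:
  assumes "subspace (T :: 'a::euclidean_space set)"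
  shows "bounded_linear (closest_point T)"
proof -
  define d where "d = dim T"
  obtain e where e: "orthonormal_family d e" "T = span (e ` {..<d})"
    by (rule orthonormal_family_exists[OF assms d_def[symmetric]])
  have "closest_point T = (\<lambda>u. \<Sum>i<d. (u \<bullet> e i) *\<^sub>R e i)"
    unfolding e(2) by (rule ext) (rule closest_point_span_orthonormal[OF e(1)])
  with bounded_linear_orthonormal_projection[of e d] show ?thesis by simp
qed

text \<open>The form in which convergence in the Grassmannian is used: it produces vectors of the
  \<open>T k\<close>, the projections of \<open>w\<close>, that approximate a vector of the limit
  space.\<close>

lemma grassmannian_tendsto_closest_point:
  assumes T: "grassmannian_tendsto T V" and w: "w \<in> V"
  shows "(\<lambda>k. closest_point (T k) w) \<longlonglongrightarrow> w"
proof -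
  have V: "subspace V" and Tk: "\<And>k. subspace (T k)"
    and lim: "(\<lambda>k. onorm (\<lambda>u. closest_point (T k) u - closest_point V u)) \<longlonglongrightarrow> 0"
    using T unfolding grassmannian_tendsto_def by (elim conjE; simp)+
  have bl: "bounded_linear (\<lambda>u. closest_point (T k) u - closest_point V u)" for k
    by (rule bounded_linear_sub[OF bounded_linear_closest_point[OF Tk] bounded_linear_closest_point[OF V]])
  have lim_w: "(\<lambda>k. onorm (\<lambda>u. closest_point (T k) u - closest_point V u) * norm w) \<longlonglongrightarrow> 0"
    by (rule tendsto_mult_left_zero[OF lim])
  have "norm (closest_point (T k) w - w) \<le> onorm (\<lambda>u. closest_point (T k) u - closest_point V u) * norm w" for k
    using onorm[OF bl, of k w] unfolding closest_point_self[OF w] .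
  then have "(\<lambda>k. closest_point (T k) w - w) \<longlonglongrightarrow> 0"
    by (rule Lim_null_comparison[OF always_eventually[OF allI] lim_w])
  then show ?thesis by (rule LIM_zero_cancel)
qed

section \<open>Condition (a) in terms of tangent vectors\<close>

lemma whitney_stratificationD:
  assumes "whitney_stratification p X \<X>"
  shows "p > 0" "\<Union>\<X> = X" "disjoint \<X>" "locally_finite_in (top_of_set X) \<X>" "whitney_condition_a \<X>"
    "A \<in> \<X> \<Longrightarrow> \<exists>d. submanifold p d A"
  using assms unfolding whitney_stratification_def stratification_def partition_on_def by simp_all

text \<open>Condition (a) speaks of convergent tangent spaces; compactness of the Grassmannian
  supplies them along a subsequence. For A = B, where condition (a) is silent, continuity of the
  tangent spaces takes its place.\<close>

lemma whitney_tangent_limit: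
  fixes \<X> :: "'a::euclidean_space set set"
  assumes ws: "whitney_stratification (Suc k) X \<X>" and A: "A \<in> \<X>" and B: "B \<in> \<X>"
    and y: "\<And>j. y j \<in> A" "y \<longlonglongrightarrow> b" and b: "b \<in> B" and w: "w \<in> tangent_space B b"
  shows "\<exists>s u. strict_mono (s :: nat \<Rightarrow> nat) \<and> (\<forall>j. u j \<in> tangent_space A (y (s j))) \<and> u \<longlonglongrightarrow> w"
proof (cases "A = B")
  case True
  obtain d where "submanifold (Suc k) d B" using whitney_stratificationD(6)[OF ws B] ..
  then obtain U V L \<phi> \<psi> where s: "straightening k B U V L \<phi> \<psi>" "b \<in> U" "dim L = d"
    using b by (rule submanifold_straightening)
  have "open U" using s(1) by (rule straightening.open_U)
  then have "\<forall>\<^sub>F j in sequentially. y j \<in> U" using y(2) s(2) by (intro topological_tendstoD)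
  then obtain N where N: "\<And>j. j \<ge> N \<Longrightarrow> y j \<in> U" unfolding eventually_sequentially by blast
  define q where "q = (\<lambda>j::nat. j + N)"
  have q: "strict_mono q" by (simp add: q_def strict_mono_def)
  have "(\<lambda>j. y (q j)) \<longlonglongrightarrow> b" using y(2) unfolding q_def by (rule LIMSEQ_ignore_initial_segment)
  moreover have "y (q j) \<in> B" "y (q j) \<in> U" for j using y(1) True N by (auto simp: q_def)
  ultimately obtain u where "\<forall>j. u j \<in> tangent_space B (y (q j))" "u \<longlonglongrightarrow> w"
    using straightening.tangent_vectors_converge[OF s(1) b s(2) _ _ _ w, of "\<lambda>j. y (q j)"] by auto
  then show ?thesis using q True by auto
next
  case False
  obtain d where d: "submanifold (Suc k) d A" using whitney_stratificationD(6)[OF ws A] ..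
  have T: "subspace (tangent_space A (y j))" "dim (tangent_space A (y j)) = d" for j
    using submanifold_tangent_space[OF d y(1)] by auto
  obtain s V where s: "strict_mono (s :: nat \<Rightarrow> nat)" and V: "grassmannian_tendsto (\<lambda>j. tangent_space A (y (s j))) V"
    by (rule grassmannian_compact[of "\<lambda>j. tangent_space A (y j)", OF T])
  have ys: "(\<lambda>j. y (s j)) \<longlonglongrightarrow> b" using LIMSEQ_subseq_LIMSEQ[OF y(2) s] by (simp add: o_def)
  have "b \<in> closure A" unfolding closure_sequential using y by blast
  have wa: "whitney_condition_a \<X>" by (rule whitney_stratificationD(5)[OF ws])
  have "tangent_space B b \<subseteq> V"
    by (rule wa[unfolded whitney_condition_a_def, rule_format, OF A B False _ _ ys V])
      (use y(1) \<open>b \<in> closure A\<close> b in simp_all)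
  then have "w \<in> V" using w by blast
  from grassmannian_tendsto_closest_point[OF V this]
  have "(\<lambda>j. closest_point (tangent_space A (y (s j))) w) \<longlonglongrightarrow> w" .
  moreover have "closest_point (tangent_space A (y (s j))) w \<in> tangent_space A (y (s j))" for j
    using T by (intro closest_point_in_set closed_subspace) (auto dest: subspace_0)
  ultimately show ?thesis using s by (intro exI[of _ s] exI[of _ "\<lambda>j. closest_point (tangent_space A (y (s j))) w"]) simp
qed

section \<open>The projection formula\<close>

lemma graph_of_iff: "(z, c) \<in> graph_of f \<longleftrightarrow> c = f z"
  unfolding graph_of_def by auto

lemma tangent_secants_graph:
  fixes f :: "'a::euclidean_space \<Rightarrow> real"
  assumes A: "A \<subseteq> graph_of f" and u: "(u, u') \<in> tangent_space A (z, f z)"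
  obtains y and t :: "nat \<Rightarrow> real" where "y \<longlonglongrightarrow> z" "\<And>j. 0 < t j" "t \<longlonglongrightarrow> 0"
    "(\<lambda>j. (y j - z) /\<^sub>R t j) \<longlonglongrightarrow> u" "(\<lambda>j. (f (y j) - f z) /\<^sub>R t j) \<longlonglongrightarrow> u'"
proof -
  obtain p and t :: "nat \<Rightarrow> real" where p: "\<And>j. p j \<in> A" "p \<longlonglongrightarrow> (z, f z)" "\<And>j. 0 < t j" "t \<longlonglongrightarrow> 0"
    "(\<lambda>j. (p j - (z, f z)) /\<^sub>R t j) \<longlonglongrightarrow> (u, u')"
    by (rule tangent_secants[OF u]) blast
  have p_eq: "snd (p j) = f (fst (p j))" for j using p(1)[of j] A by (auto simp: graph_of_def)
  have 1: "(\<lambda>j. fst (p j)) \<longlonglongrightarrow> z" using tendsto_fst[OF p(2)] by simp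
  have 2: "(\<lambda>j. (fst (p j) - z) /\<^sub>R t j) \<longlonglongrightarrow> u" using tendsto_fst[OF p(5)] by simp
  have "(\<lambda>j. (snd (p j) - f z) /\<^sub>R t j) \<longlonglongrightarrow> u'" using tendsto_snd[OF p(5)] by simp
  then have 3: "(\<lambda>j. (f (fst (p j)) - f z) /\<^sub>R t j) \<longlonglongrightarrow> u'" unfolding p_eq .
  show thesis by (rule that[OF 1 p(3) p(4) 2 3])
qed

text \<open>Both sides are limits of the same secants. The stratum may have any dimension:
  differentiability of \<open>f\<close> at \<open>z\<close> alone fixes its slopes there, so strata
  of low dimension need no separate treatment.\<close>

lemma tangent_graph_gderiv:
  fixes f :: "'a::euclidean_space \<Rightarrow> real"
  assumes A: "A \<subseteq> graph_of f" and u: "(u, u') \<in> tangent_space A (z, f z)" and g: "GDERIV f z :> g"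
  shows "u' = u \<bullet> g"
proof -
  obtain y and t :: "nat \<Rightarrow> real" where y: "y \<longlonglongrightarrow> z" "(\<lambda>j. (y j - z) /\<^sub>R t j) \<longlonglongrightarrow> u" "(\<lambda>j. (f (y j) - f z) /\<^sub>R t j) \<longlonglongrightarrow> u'"
    by (rule tangent_secants_graph[OF A u]) blast
  have "(\<lambda>j. (f (y j) - f z) /\<^sub>R t j) \<longlonglongrightarrow> u \<bullet> g"
    by (rule secant_limit[OF g[unfolded gderiv_def] y(1,2)])
  with y(3) show ?thesis by (rule LIMSEQ_unique)
qed

text \<open>Applied to tangent vectors of the graph, which therefore cannot be vertical, and to a
  gradient in its own direction, which bounds its norm by \<open>L\<close>.\<close>

lemma lipschitz_secants_bound:
  fixes f :: "'a::euclidean_space \<Rightarrow> real"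
  assumes L: "L-lipschitz_on (ball z r) f" "r > 0" and y: "y \<longlonglongrightarrow> z" and t: "\<And>j. 0 < t j"
    and q: "(\<lambda>j. (y j - z) /\<^sub>R t j) \<longlonglongrightarrow> u" "(\<lambda>j. (f (y j) - f z) /\<^sub>R t j) \<longlonglongrightarrow> u'"
  shows "\<bar>u'\<bar> \<le> L * norm u"
proof -
  have "\<forall>\<^sub>F j in sequentially. y j \<in> ball z r" using y L(2) by (intro topological_tendstoD) auto
  then have "\<forall>\<^sub>F j in sequentially. \<bar>(f (y j) - f z) /\<^sub>R t j\<bar> \<le> L * norm ((y j - z) /\<^sub>R t j)"
  proof (rule eventually_mono)
    fix j assume "y j \<in> ball z r"
    then have "\<bar>f (y j) - f z\<bar> \<le> L * norm (y j - z)"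
      using lipschitz_onD[OF L(1), of "y j" z] L(2) by (simp add: dist_norm)
    then have "\<bar>f (y j) - f z\<bar> / t j \<le> (L * norm (y j - z)) / t j" using t[of j] by (intro divide_right_mono) auto
    moreover have "\<bar>(f (y j) - f z) /\<^sub>R t j\<bar> = \<bar>f (y j) - f z\<bar> / t j"
      using t[of j] by (simp add: abs_mult divide_inverse_commute)
    moreover have "L * norm ((y j - z) /\<^sub>R t j) = (L * norm (y j - z)) / t j"
      using t[of j] by (simp add: divide_inverse_commute)
    ultimately show "\<bar>(f (y j) - f z) /\<^sub>R t j\<bar> \<le> L * norm ((y j - z) /\<^sub>R t j)" by linarith
  qed
  moreover have "(\<lambda>j. L * norm ((y j - z) /\<^sub>R t j)) \<longlonglongrightarrow> L * norm u"
    by (rule tendsto_mult_left[OF tendsto_norm[OF q(1)]])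
  moreover have "(\<lambda>j. \<bar>(f (y j) - f z) /\<^sub>R t j\<bar>) \<longlonglongrightarrow> \<bar>u'\<bar>"
    by (rule tendsto_rabs[OF q(2)])
  ultimately show ?thesis by (intro tendsto_le[OF trivial_limit_sequentially])
qed

lemma tangent_graph_lipschitz:
  fixes f :: "'a::euclidean_space \<Rightarrow> real"
  assumes A: "A \<subseteq> graph_of f" and u: "(u, u') \<in> tangent_space A (z, f z)" and L: "L-lipschitz_on (ball z r) f" "r > 0"
  shows "\<bar>u'\<bar> \<le> L * norm u"
proof -
  obtain y and t :: "nat \<Rightarrow> real" where y: "y \<longlonglongrightarrow> z" "\<And>j. 0 < t j" "(\<lambda>j. (y j - z) /\<^sub>R t j) \<longlonglongrightarrow> u" "(\<lambda>j. (f (y j) - f z) /\<^sub>R t j) \<longlonglongrightarrow> u'"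
    by (rule tangent_secants_graph[OF A u]) blast
  show ?thesis by (rule lipschitz_secants_bound[OF L y])
qed

lemma gderiv_lipschitz:
  fixes f :: "'a::euclidean_space \<Rightarrow> real"
  assumes L: "L-lipschitz_on (ball z r) f" "r > 0" and g: "GDERIV f z :> g"
  shows "norm g \<le> L"
proof -
  obtain t :: "nat \<Rightarrow> real" where t: "t \<longlonglongrightarrow> 0" "\<And>j. 0 < t j"
    using null_sequence_in_interval[of 1] by (metis zero_less_one)
  have t0: "t j \<noteq> 0" for j using t(2)[of j] by simp
  define y where "y = (\<lambda>j. z + t j *\<^sub>R g)"
  have "(\<lambda>j. z + t j *\<^sub>R g) \<longlonglongrightarrow> z + 0 *\<^sub>R g" by (intro tendsto_intros t)
  then have y: "y \<longlonglongrightarrow> z" by (simp add: y_def)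
  have q: "(\<lambda>j. (y j - z) /\<^sub>R t j) \<longlonglongrightarrow> g" using t0 by (simp add: y_def)
  have "\<bar>g \<bullet> g\<bar> \<le> L * norm g"
    by (rule lipschitz_secants_bound[OF L y t(2) q secant_limit[OF g[unfolded gderiv_def] y q]])
  then have "norm g * norm g \<le> L * norm g" by (simp add: dot_square_norm power2_eq_square)
  then show ?thesis using lipschitz_on_nonneg[OF L(1)] by (cases "g = 0") auto
qed

text \<open>The reduction of Clarke subgradients to gradients: limits of gradients stay in the
  closed set \<open>K\<close>, and their closed convex hull stays in it by convexity.\<close>

lemma clarke_subdifferential_subset:
  fixes f :: "'a::euclidean_space \<Rightarrow> real"
  assumes K: "convex K" "closed K" and grad: "\<And>z g. z \<in> U \<Longrightarrow> GDERIV f z :> g \<Longrightarrow> g \<in> K"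
    and U: "open U" "x \<in> U"
  shows "clarke_subdifferential f x \<subseteq> K"
proof -
  have "v \<in> K" if y: "y \<longlonglongrightarrow> x" "\<forall>k::nat. GDERIV f (y k) :> g k" "g \<longlonglongrightarrow> v" for v y g
  proof -
    have "\<forall>\<^sub>F k in sequentially. y k \<in> U" using y(1) U by (intro topological_tendstoD)
    then have "\<forall>\<^sub>F k in sequentially. g k \<in> K" by (rule eventually_mono) (use grad y(2) in blast)
    then show ?thesis by (rule Lim_in_closed_set[OF K(2) _ trivial_limit_sequentially y(3)])
  qed
  then have "{v. \<exists>y g. y \<longlonglongrightarrow> x \<and> (\<forall>k::nat. GDERIV f (y k) :> g k) \<and> g \<longlonglongrightarrow> v} \<subseteq> K" by auto
  then show ?thesis unfolding clarke_subdifferential_def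
    by (intro closure_minimal hull_minimal K)
qed

lemma clarke_subdifferential_norm_le:
  fixes f :: "'a::euclidean_space \<Rightarrow> real"
  assumes L: "L-lipschitz_on (ball x r) f" "r > 0" and v: "v \<in> clarke_subdifferential f x"
  shows "norm v \<le> L"
proof -
  have "norm g \<le> L" if z: "z \<in> ball x r" and g: "GDERIV f z :> g" for z g
  proof -
    obtain s where s: "s > 0" "ball z s \<subseteq> ball x r" using openE[OF open_ball z] by blast
    show ?thesis by (rule gderiv_lipschitz[OF lipschitz_on_subset[OF L(1) s(2)] s(1) g])
  qed
  then have "clarke_subdifferential f x \<subseteq> cball 0 L"
    by (intro clarke_subdifferential_subset[of _ "ball x r"]) (use L(2) in auto)
  then show ?thesis using v by auto
qed

lemma locally_lipschitz_isCont:
  assumes "locally_lipschitz f"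
  shows "isCont f x"
proof -
  obtain r L where "r > 0" "L-lipschitz_on (ball x r) f" using assms unfolding locally_lipschitz_def by blast
  then have "continuous_on (ball x r) f" by (intro lipschitz_on_continuous_on)
  then show ?thesis using \<open>r > 0\<close> by (simp add: continuous_on_eq_continuous_at)
qed

section \<open>Subgradients near a point of a stratum\<close>

lemma locally_finite_neighbourhood:
  assumes "whitney_stratification p X \<X>" "a \<in> X"
  obtains N where "open N" "a \<in> N" "finite {A \<in> \<X>. A \<inter> N \<noteq> {}}"
proof -
  note ws = whitney_stratificationD[OF assms(1)]
  obtain V where V: "openin (top_of_set X) V" "a \<in> V" "finite {A \<in> \<X>. A \<inter> V \<noteq> {}}"
    using ws(4) assms(2) unfolding locally_finite_in_def by auto
  obtain N where N: "open N" "V = X \<inter> N" using V(1) unfolding openin_open by blast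
  have "{A \<in> \<X>. A \<inter> N \<noteq> {}} = {A \<in> \<X>. A \<inter> V \<noteq> {}}" using N(2) ws(2) by auto
  then show thesis using that[OF N(1)] V N by auto
qed

text \<open>Local finiteness leaves finitely many strata for infinitely many indices.\<close>

lemma subsequence_in_stratum:
  fixes p :: "nat \<Rightarrow> 'a::euclidean_space"
  assumes ws: "whitney_stratification k X \<X>" and p: "\<And>j. p j \<in> X" "p \<longlonglongrightarrow> a" and a: "a \<in> X"
  obtains A and s :: "nat \<Rightarrow> nat" where "A \<in> \<X>" "strict_mono s" "\<And>j. p (s j) \<in> A"
proof -
  obtain N where N: "open N" "a \<in> N" "finite {A \<in> \<X>. A \<inter> N \<noteq> {}}"
    by (rule locally_finite_neighbourhood[OF ws a]) blast
  obtain j0 where j0: "\<And>j. j \<ge> j0 \<Longrightarrow> p j \<in> N"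
    using topological_tendstoD[OF p(2) N(1,2)] unfolding eventually_sequentially by blast
  have "{j0..} \<subseteq> (\<Union>A\<in>{A \<in> \<X>. A \<inter> N \<noteq> {}}. {j. p j \<in> A})"
  proof
    fix j assume "j \<in> {j0..}"
    then have "p j \<in> N" using j0 by simp
    moreover obtain A where "A \<in> \<X>" "p j \<in> A" using p(1) whitney_stratificationD(2)[OF ws] by blast
    ultimately show "j \<in> (\<Union>A\<in>{A \<in> \<X>. A \<inter> N \<noteq> {}}. {j. p j \<in> A})" by blast
  qed
  then have "infinite (\<Union>A\<in>{A \<in> \<X>. A \<inter> N \<noteq> {}}. {j. p j \<in> A})"
    by (rule infinite_super[OF _ infinite_Ici])
  then obtain A where A: "A \<in> \<X>" "infinite {j. p j \<in> A}" using N(3) by auto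
  show thesis
    by (rule that[OF A(1) strict_mono_enumerate[OF A(2)]]) (use enumerate_in_set[OF A(2)] in auto)
qed

text \<open>Points violating the bound and converging to \<open>x\<close> may be taken in one
  stratum \<open>A\<close>. By condition (a), tangent vectors (u_j, u'_j) of \<open>A\<close> at
  these points converge to (u, u'). There u'_j = u_j . g_j, and as the gradients g_j are bounded, u
  . g_j - u' gets arbitrarily small.\<close>

lemma gradient_projection:
  fixes f :: "'a::euclidean_space \<Rightarrow> real"
  assumes lip: "locally_lipschitz f" and ws: "whitney_stratification (Suc k) (graph_of f) \<X>"
    and B: "B \<in> \<X>" "(x, f x) \<in> B" and u: "(u, u') \<in> tangent_space B (x, f x)" and e: "e > 0"
  shows "\<exists>\<delta>>0. \<forall>z\<in>ball x \<delta>. \<forall>g. GDERIV f z :> g \<longrightarrow> \<bar>u \<bullet> g - u'\<bar> \<le> e"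
proof (rule ccontr)
  assume contra: "\<not> ?thesis"
  obtain r L where r: "r > 0" "L-lipschitz_on (ball x r) f" using lip unfolding locally_lipschitz_def by blast
  have "\<exists>z g. z \<in> ball x (min r (inverse (real (Suc n)))) \<and> GDERIV f z :> g \<and> \<not> \<bar>u \<bullet> g - u'\<bar> \<le> e" for n
  proof -
    have "min r (inverse (real (Suc n))) > 0" using r(1) by simp
    then show ?thesis using contra by blast
  qed
  then obtain z g where zg: "\<And>n. z n \<in> ball x (min r (inverse (real (Suc n))))" "\<And>n. GDERIV f (z n) :> g n"
    "\<And>n. \<not> \<bar>u \<bullet> g n - u'\<bar> \<le> e"
    by metis
  have z: "z \<longlonglongrightarrow> x"
  proof (rule LIM_zero_cancel, rule Lim_null_comparison[OF always_eventually LIMSEQ_inverse_real_of_nat])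
    show "\<forall>n. norm (z n - x) \<le> inverse (real (Suc n))"
      using zg(1) by (auto simp: dist_norm norm_minus_commute less_imp_le)
  qed
  have g: "norm (g n) \<le> L" for n
  proof -
    have "z n \<in> ball x r" using zg(1)[of n] by simp
    then obtain s where s: "s > 0" "ball (z n) s \<subseteq> ball x r" using openE[OF open_ball] by blast
    show ?thesis by (rule gderiv_lipschitz[OF lipschitz_on_subset[OF r(2) s(2)] s(1) zg(2)])
  qed
  have fz: "(\<lambda>n. f (z n)) \<longlonglongrightarrow> f x" by (rule isCont_tendsto_compose[OF locally_lipschitz_isCont[OF lip] z])
  have p: "(\<lambda>n. (z n, f (z n))) \<longlonglongrightarrow> (x, f x)" by (rule tendsto_Pair[OF z fz])
  have pX: "(z n, f (z n)) \<in> graph_of f" "(x, f x) \<in> graph_of f" for n by (auto simp: graph_of_iff)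
  obtain A and s :: "nat \<Rightarrow> nat" where A: "A \<in> \<X>" "strict_mono s" "\<And>j. (z (s j), f (z (s j))) \<in> A"
    by (rule subsequence_in_stratum[OF ws pX(1) p pX(2)]) blast
  have ps: "(\<lambda>j. (z (s j), f (z (s j)))) \<longlonglongrightarrow> (x, f x)"
    using LIMSEQ_subseq_LIMSEQ[OF p A(2)] by (simp add: o_def)
  obtain q w where w: "strict_mono (q :: nat \<Rightarrow> nat)" "\<forall>j. w j \<in> tangent_space A (z (s (q j)), f (z (s (q j))))" "w \<longlonglongrightarrow> (u, u')"
    using whitney_tangent_limit[OF ws A(1) B(1) A(3) ps B(2) u] by blast
  have AX: "A \<subseteq> graph_of f" using A(1) whitney_stratificationD(2)[OF ws] by blast
  have w_eq: "snd (w j) = fst (w j) \<bullet> g (s (q j))" for j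
    by (rule tangent_graph_gderiv[OF AX _ zg(2)]) (use w(2) in simp)
  have wf: "(\<lambda>j. fst (w j)) \<longlonglongrightarrow> u" and wsn: "(\<lambda>j. snd (w j)) \<longlonglongrightarrow> u'"
    using tendsto_fst[OF w(3)] tendsto_snd[OF w(3)] by auto
  have "(\<lambda>j. norm (u - fst (w j)) * L + \<bar>snd (w j) - u'\<bar>) \<longlonglongrightarrow> norm (u - u) * L + \<bar>u' - u'\<bar>"
    by (intro tendsto_intros wf wsn)
  then have "(\<lambda>j. norm (u - fst (w j)) * L + \<bar>snd (w j) - u'\<bar>) \<longlonglongrightarrow> 0" by simp
  then have "\<forall>\<^sub>F j in sequentially. norm (u - fst (w j)) * L + \<bar>snd (w j) - u'\<bar> < e"
    using e by (rule order_tendstoD(2))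
  then obtain j where j: "norm (u - fst (w j)) * L + \<bar>snd (w j) - u'\<bar> < e"
    using eventually_happens trivial_limit_sequentially by blast
  have "u \<bullet> g (s (q j)) - u' = (u - fst (w j)) \<bullet> g (s (q j)) + (snd (w j) - u')"
    unfolding w_eq by (simp add: inner_diff_left)
  then have "\<bar>u \<bullet> g (s (q j)) - u'\<bar> \<le> \<bar>(u - fst (w j)) \<bullet> g (s (q j))\<bar> + \<bar>snd (w j) - u'\<bar>" by linarith
  also have "\<bar>(u - fst (w j)) \<bullet> g (s (q j))\<bar> \<le> norm (u - fst (w j)) * norm (g (s (q j)))"
    by (rule Cauchy_Schwarz_ineq2)
  also have "\<dots> \<le> norm (u - fst (w j)) * L" by (rule mult_left_mono[OF g]) simp
  finally show False using j zg(3)[of "s (q j)"] by linarith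
qed

text \<open>The bound on gradients describes a slab between two hyperplanes, which is closed and
  convex and so contains the Clarke subgradients too.\<close>

theorem clarke_projection:
  fixes f :: "'a::euclidean_space \<Rightarrow> real"
  assumes lip: "locally_lipschitz f" and ws: "whitney_stratification (Suc k) (graph_of f) \<X>"
    and B: "B \<in> \<X>" "(x, f x) \<in> B" and u: "(u, u') \<in> tangent_space B (x, f x)" and e: "e > 0"
  obtains \<delta> where "\<delta> > 0" "\<And>z v. z \<in> ball x \<delta> \<Longrightarrow> v \<in> clarke_subdifferential f z \<Longrightarrow> \<bar>u \<bullet> v - u'\<bar> \<le> e"
proof -
  obtain \<delta> where \<delta>: "\<delta> > 0" "\<And>z g. z \<in> ball x \<delta> \<Longrightarrow> GDERIV f z :> g \<Longrightarrow> \<bar>u \<bullet> g - u'\<bar> \<le> e"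
    using gradient_projection[OF assms] by blast
  let ?K = "{g. u \<bullet> g \<le> u' + e} \<inter> {g. u \<bullet> g \<ge> u' - e}"
  have "clarke_subdifferential f z \<subseteq> ?K" if z: "z \<in> ball x \<delta>" for z
  proof (rule clarke_subdifferential_subset[OF _ _ _ open_ball z])
    show "convex ?K" by (intro convex_Int convex_halfspace_le convex_halfspace_ge)
    show "closed ?K" by (intro closed_Int closed_halfspace_le closed_halfspace_ge)
    show "g \<in> ?K" if "y \<in> ball x \<delta>" "GDERIV f y :> g" for y g
      using \<delta>(2)[OF that] by (auto simp: abs_le_iff)
  qed
  then have "\<bar>u \<bullet> v - u'\<bar> \<le> e" if "z \<in> ball x \<delta>" "v \<in> clarke_subdifferential f z" for z v
    using that by (fastforce simp: abs_le_iff)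
  with \<delta>(1) show thesis by (rule that)
qed

text \<open>The Lipschitz bound on slopes excludes vertical tangent vectors; this makes the
  projection of tangent spaces to the domain injective.\<close>

lemma injective_fst_tangent_graph:
  fixes f :: "'a::euclidean_space \<Rightarrow> real"
  assumes lip: "locally_lipschitz f" and A: "A \<subseteq> graph_of f"
    and w: "w \<in> tangent_space A (x, f x)" and "fst w = 0"
  shows "w = 0"
proof -
  obtain r L where r: "r > 0" "L-lipschitz_on (ball x r) f" using lip unfolding locally_lipschitz_def by blast
  have "(fst w, snd w) \<in> tangent_space A (x, f x)" using w by simp
  from tangent_graph_lipschitz[OF A this r(2,1)] have "\<bar>snd w\<bar> \<le> L * norm (fst w)" .
  then have "snd w = 0" unfolding \<open>fst w = 0\<close> by simp
  then show ?thesis using \<open>fst w = 0\<close> by (simp add: prod_eq_iff)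
qed

lemma dim_fst_tangent_graph:
  fixes f :: "'a::euclidean_space \<Rightarrow> real"
  assumes lip: "locally_lipschitz f" and A: "A \<subseteq> graph_of f" "submanifold (Suc k) d A" "(x, f x) \<in> A"
  shows "dim (fst ` tangent_space A (x, f x)) = d" "subspace (fst ` tangent_space A (x, f x))"
proof -
  let ?T = "tangent_space A (x, f x)"
  have T: "subspace ?T" "dim ?T = d" using submanifold_tangent_space[OF A(2,3)] by auto
  have lin: "linear (fst :: 'a \<times> real \<Rightarrow> 'a)" by (rule linear_fst)
  have inj: "inj_on fst ?T"
  proof (rule inj_onI)
    fix a b assume ab: "a \<in> ?T" "b \<in> ?T" "fst a = fst b"
    have "a - b \<in> ?T" using ab T(1) by (intro subspace_diff)
    then have "a - b = 0" by (rule injective_fst_tangent_graph[OF lip A(1)]) (use ab in simp)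
    then show "a = b" by simp
  qed
  have sp: "span ?T = ?T" using T(1) by (simp only: span_eq_iff)
  have "dim (fst ` ?T) = dim ?T" by (rule dim_image_eq[OF lin]) (unfold sp, rule inj)
  then show "dim (fst ` ?T) = d" using T(2) by simp
  show "subspace (fst ` ?T)" by (rule linear_subspace_image[OF lin T(1)])
qed

text \<open>The graph lies in a space of dimension n + 1; that its strata obey the bound n is what
  lets class C^n suffice for the Morse-Sard theorem.\<close>

lemma graph_submanifold_dim_le:
  fixes f :: "'a::euclidean_space \<Rightarrow> real"
  assumes "locally_lipschitz f" "A \<subseteq> graph_of f" "submanifold (Suc k) d A" "A \<noteq> {}"
  shows "d \<le> DIM('a)"
proof -
  obtain x where "(x, f x) \<in> A" using assms(2,4) unfolding graph_of_def by blast
  from dim_fst_tangent_graph(1)[OF assms(1-3) this] show ?thesis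
    using dim_subset_UNIV[of "fst ` tangent_space A (x, f x)"] by simp
qed

text \<open>The parametrisation \<open>\<Psi> w = fst (\<psi> (\<phi> a + \<Lambda> w)) + (w - Q w)\<close>, where \<open>\<Lambda>\<close> inverts the projected tangent
  map and \<open>Q\<close> projects onto its range, has derivative the identity at \<open>0\<close>.\<close>
lemma projected_stratum_submanifold:
  fixes f :: "'a::euclidean_space \<Rightarrow> real"
  assumes lip: "locally_lipschitz f" and A: "A \<subseteq> graph_of f" "submanifold (Suc k) d A"
  shows "submanifold (Suc k) d (fst ` A)"
  unfolding submanifold_def
proof
  fix x assume "x \<in> fst ` A"
  then have xA: "(x, f x) \<in> A" using A(1) by (auto simp: graph_of_def)
  obtain U V L \<phi> \<psi> where s: "straightening k A U V L \<phi> \<psi>" "(x, f x) \<in> U" "dim L = d"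
    using A(2) xA by (rule submanifold_straightening)
  interpret straightening k A U V L \<phi> \<psi> by (rule s(1))
  define a where "a = (x, f x)"
  define z0 where "z0 = \<phi> a"
  define D where "D = D\<psi> z0"
  have a: "a \<in> A" "a \<in> U" using xA s(2) by (auto simp: a_def)
  have z0: "z0 \<in> V" "z0 \<in> L" "\<psi> z0 = a" using \<phi>_V[OF a(2)] \<phi>_L[OF a] \<psi>\<phi>[OF a(2)] by (auto simp: z0_def)
  have linD: "linear D" unfolding D_def by (rule linear_D\<psi>[OF z0(1)])
  define N where "N = (\<lambda>l. fst (D l))"
  have linN: "linear N" unfolding N_def using linear_compose[OF linD linear_fst] by (simp add: o_def)
  have TA: "tangent_space A a = D ` L" unfolding D_def z0_def by (rule tangent_space_eq[OF a])
  have N0: "l = 0" if "l \<in> L" "N l = 0" for l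
  proof -
    have "D l \<in> tangent_space A (x, f x)" using TA that(1) unfolding a_def by blast
    then have "D l = 0" using injective_fst_tangent_graph[OF lip A(1)] that(2) unfolding N_def by blast
    then have "D l = D 0" using linear_0[OF linD] by simp
    then show ?thesis using inj_D\<psi>[OF z0(1)] unfolding D_def by (simp add: inj_eq)
  qed
  have injN: "inj_on N L"
  proof (rule inj_onI)
    fix l m assume lm: "l \<in> L" "m \<in> L" "N l = N m"
    have "l - m = 0" using lm subspace_L by (intro N0) (auto simp: subspace_diff linear_diff[OF linN])
    then show "l = m" by simp
  qed
  \<comment> \<open>\<open>N\<close> is injective on \<open>L\<close>, so \<Lambda> can invert it:
    points z0 + \<Lambda> w with w in N L run through \<open>L\<close>, and w is the first-order
    position in the domain.\<close>
  obtain \<Lambda> where \<Lambda>: "range \<Lambda> \<subseteq> L" "linear \<Lambda>" "\<And>l. l \<in> L \<Longrightarrow> \<Lambda> (N l) = l"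
    using linear_exists_left_inverse_on[OF linN subspace_L injN] by blast
  have \<Lambda>L: "\<Lambda> w \<in> L" for w using \<Lambda>(1) by blast
  define L' where "L' = N ` L"
  have L': "subspace L'" unfolding L'_def by (rule linear_subspace_image[OF linN subspace_L])
  have sp: "span L = L" using subspace_L by (simp only: span_eq_iff)
  have "dim (N ` L) = dim L" by (rule dim_image_eq[OF linN]) (unfold sp, rule injN)
  then have dimL': "dim L' = d" using s(3) by (simp add: L'_def)
  have blN: "bounded_linear N" and bl\<Lambda>: "bounded_linear \<Lambda>"
    using linN \<Lambda>(2) by (simp_all add: linear_conv_bounded_linear)
  define Q where "Q = (\<lambda>w. N (\<Lambda> w))"
  have blQ: "bounded_linear Q" unfolding Q_def by (rule bounded_linear_compose[OF blN bl\<Lambda>])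
  have QL': "Q w = w" if "w \<in> L'" for w using that \<Lambda>(3) unfolding Q_def L'_def by auto
  define c where "c = (\<lambda>w. z0 + \<Lambda> w)"
  have cont_c: "continuous_on UNIV c"
    unfolding c_def by (intro continuous_intros linear_continuous_on bl\<Lambda>)
  define W where "W = c -` V"
  have W: "open W" unfolding W_def by (rule open_vimage[OF open_V cont_c])
  have "\<Lambda> 0 = 0" by (rule linear_0[OF \<Lambda>(2)])
  then have c0: "c 0 = z0" by (simp add: c_def)
  then have W0: "0 \<in> W" using z0(1) by (simp add: W_def)
  define \<Psi> where "\<Psi> = (\<lambda>w. fst (\<psi> (c w)) + (w + - Q w))"
  have Cc: "Ck_on (Suc k) c W"
    unfolding c_def by (rule Ck_on_add[OF W Ck_on_const[OF W] Ck_on_bounded_linear[OF W bl\<Lambda>]])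
  have "Ck_on (Suc k) (\<lambda>w. \<psi> (c w)) W"
    by (rule Ck_on_compose[OF W open_V _ Ck_\<psi> Cc]) (auto simp: W_def)
  then have C\<Psi>: "Ck_on (Suc k) \<Psi> W"
    unfolding \<Psi>_def
    by (rule Ck_on_add[OF W Ck_on_linear_comp[OF bounded_linear_fst W] Ck_on_add[OF W Ck_on_bounded_linear[OF W bounded_linear_ident]
          Ck_on_bounded_linear[OF W bounded_linear_minus[OF blQ]]]])
  have d\<Psi>: "(\<Psi> has_derivative (\<lambda>h. h)) (at 0)"
  proof -
    have "(c has_derivative (\<lambda>h. 0 + \<Lambda> h)) (at 0)"
      unfolding c_def by (intro has_derivative_add has_derivative_const bounded_linear_imp_has_derivative bl\<Lambda>)
    then have dc: "(c has_derivative \<Lambda>) (at 0)" by simp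
    have "(\<psi> has_derivative D) (at (c 0))" unfolding c0 D_def by (rule der_\<psi>[OF z0(1)])
    from has_derivative_compose[OF dc this]
    have "((\<lambda>w. \<psi> (c w)) has_derivative (\<lambda>h. D (\<Lambda> h))) (at 0)" .
    then have "(\<Psi> has_derivative (\<lambda>h. fst (D (\<Lambda> h)) + (h + - Q h))) (at 0)"
      unfolding \<Psi>_def
      by (intro has_derivative_add has_derivative_fst has_derivative_ident has_derivative_minus
          bounded_linear_imp_has_derivative blQ)
    then show ?thesis by (simp add: Q_def N_def)
  qed
  obtain U1 V1 G where inv: "open U1" "U1 \<subseteq> W" "0 \<in> U1" "open V1" "\<Psi> 0 \<in> V1"
    "homeomorphism U1 V1 \<Psi> G" "Ck_on (Suc k) G V1"
    using Ck_local_inverse[OF W C\<Psi> W0 d\<Psi>] by metis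
  have inv': "\<And>w. w \<in> U1 \<Longrightarrow> G (\<Psi> w) = w" "\<And>y. y \<in> V1 \<Longrightarrow> \<Psi> (G y) = y" "\<Psi> ` U1 = V1" "G ` V1 = U1"
    using inv(6) unfolding homeomorphism_def by auto
  have Q0: "Q 0 = 0" by (rule linear_0[OF bounded_linear.linear[OF blQ]])
  then have "\<Psi> 0 = x" by (simp add: \<Psi>_def c0 z0(3) a_def)
  then have xV1: "x \<in> V1" using inv(5) by simp
  have contf: "continuous_on UNIV f"
    using locally_lipschitz_isCont[OF lip] by (simp add: continuous_at_imp_continuous_on)
  have contgraph: "continuous_on UNIV (\<lambda>y. (y, f y))" by (intro continuous_on_Pair continuous_on_id contf)
  define O1 where "O1 = (\<lambda>y. (y, f y)) -` U"
  have O1: "open O1" unfolding O1_def by (rule open_vimage[OF open_U contgraph])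
  \<comment> \<open>For y in the projected stratum, \<theta> y is the parameter read off from the
    chart, the expected value of \<open>G y\<close>.\<close>
  define \<theta> where "\<theta> = (\<lambda>y. N (\<phi> (y, f y) - z0))"
  have "continuous_on O1 (\<lambda>y. \<phi> (y, f y))"
    by (rule continuous_on_compose2[OF Ck_on_imp_continuous_on[OF Ck_\<phi>] continuous_on_subset[OF contgraph]])
      (auto simp: O1_def)
  then have cont_\<theta>: "continuous_on O1 \<theta>"
    unfolding \<theta>_def by (intro bounded_linear.continuous_on[OF blN] continuous_on_diff continuous_on_const)
  \<comment> \<open>\<open>\<Psi>\<close> is known to be injective only on \<open>U1\<close>. Asking
    for \<theta> y in \<open>U1\<close> forces G y = \<theta> y on the projected stratum, and
    thereby G y in \<open>L'\<close>.\<close>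
  define Y where "Y = V1 \<inter> (O1 \<inter> \<theta> -` U1)"
  have Y: "open Y"
    unfolding Y_def by (rule open_Int[OF inv(4) continuous_open_preimage[OF cont_\<theta> O1 inv(1)]])
  have "\<theta> x = 0" unfolding \<theta>_def using linear_0[OF linN] by (simp add: z0_def a_def)
  then have xY: "x \<in> Y" using xV1 s(2) inv(3) by (simp add: Y_def O1_def)
  have YV1: "Y \<subseteq> V1" by (auto simp: Y_def)
  define Z where "Z = U1 \<inter> \<Psi> -` Y"
  have GY: "G ` Y = Z"
  proof
    show "G ` Y \<subseteq> Z" using YV1 inv' by (auto simp: Z_def)
    show "Z \<subseteq> G ` Y" using inv'(1) by (force simp: Z_def)
  qed
  have "\<Psi> ` Z = Y" unfolding GY[symmetric] using inv'(2) YV1 by force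
  have cont\<Psi>: "continuous_on U1 \<Psi>" and contG: "continuous_on V1 G" using inv(6) unfolding homeomorphism_def by auto
  have Z: "open Z" unfolding Z_def by (rule continuous_open_preimage[OF cont\<Psi> inv(1) Y])
  have ZU1: "Z \<subseteq> U1" by (auto simp: Z_def)
  have hom: "homeomorphism Y Z G \<Psi>"
    unfolding homeomorphism_def
    using GY \<open>\<Psi> ` Z = Y\<close> inv'(1,2) YV1 ZU1 continuous_on_subset[OF contG YV1] continuous_on_subset[OF cont\<Psi> ZU1]
    by auto
  have CG: "Ck_on (Suc k) G Y" by (rule Ck_on_subset[OF inv(7,4) Y YV1])
  have "Ck_on (Suc k) \<Psi> Z" by (rule Ck_on_subset[OF C\<Psi> W Z]) (use ZU1 inv(2) in auto)
  moreover have "G ` (fst ` A \<inter> Y) = Z \<inter> L'"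
  proof
    show "G ` (fst ` A \<inter> Y) \<subseteq> Z \<inter> L'"
    proof (rule image_subsetI)
      fix y assume y: "y \<in> fst ` A \<inter> Y"
      then have yA: "(y, f y) \<in> A" using A(1) by (auto simp: graph_of_def)
      have yU: "(y, f y) \<in> U" "\<theta> y \<in> U1" using y by (auto simp: Y_def O1_def)
      define l where "l = \<phi> (y, f y) - z0"
      have l: "l \<in> L" unfolding l_def using \<phi>_L[OF yA yU(1)] z0(2) subspace_L by (intro subspace_diff)
      have \<theta>y: "\<theta> y = N l" by (simp add: \<theta>_def l_def)
      then have \<theta>L': "\<theta> y \<in> L'" using l by (simp add: L'_def)
      have "c (\<theta> y) = \<phi> (y, f y)" unfolding c_def \<theta>y \<Lambda>(3)[OF l] by (simp add: l_def)
      then have "\<Psi> (\<theta> y) = y" using QL'[OF \<theta>L'] \<psi>\<phi>[OF yU(1)] by (simp add: \<Psi>_def)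
      then have "G y = \<theta> y" using inv'(1)[OF yU(2)] by simp
      moreover have "G y \<in> Z" using GY y by blast
      ultimately show "G y \<in> Z \<inter> L'" using \<theta>L' by simp
    qed
    show "Z \<inter> L' \<subseteq> G ` (fst ` A \<inter> Y)"
    proof
      fix w assume w: "w \<in> Z \<inter> L'"
      then obtain y where y: "y \<in> Y" "w = G y" using GY by blast
      have "c w \<in> V" using w ZU1 inv(2) by (auto simp: W_def)
      moreover have "c w \<in> L" unfolding c_def using z0(2) \<Lambda>L subspace_L by (intro subspace_add)
      ultimately have "\<psi> (c w) \<in> A" by (rule \<psi>_M)
      moreover have "y = fst (\<psi> (c w))"
        using inv'(2)[of y] y YV1 QL'[of w] w by (auto simp: \<Psi>_def)
      ultimately show "w \<in> G ` (fst ` A \<inter> Y)" using y by blast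
    qed
  qed
  ultimately show "\<exists>U V L \<phi> \<psi>. open U \<and> x \<in> U \<and> open (V::'a set) \<and> homeomorphism U V \<phi> \<psi>
        \<and> Ck_on (Suc k) \<phi> U \<and> Ck_on (Suc k) \<psi> V
        \<and> subspace L \<and> dim L = d \<and> \<phi> ` (fst ` A \<inter> U) = V \<inter> L"
    using Y xY Z hom CG L' dimL'
    by (intro exI[of _ Y] exI[of _ Z] exI[of _ L'] exI[of _ G] exI[of _ \<Psi>]) blast
qed

section \<open>Critical values\<close>

lemma negligible_local:
  fixes h :: "'a::euclidean_space \<Rightarrow> real"
  assumes "\<And>a. a \<in> C \<Longrightarrow> \<exists>N. open N \<and> a \<in> N \<and> negligible (h ` (C \<inter> N))"
  shows "negligible (h ` C)"
proof -
  obtain F where F: "countable F" "C \<subseteq> \<Union>F" "\<And>N. N \<in> F \<Longrightarrow> negligible (h ` (C \<inter> N))"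
    by (rule countable_open_cover[of C "\<lambda>N. negligible (h ` (C \<inter> N))", OF assms]) blast+
  have "h ` C \<subseteq> \<Union>((\<lambda>N. h ` (C \<inter> N)) ` F)" using F(2) by blast
  moreover have "negligible (\<Union>((\<lambda>N. h ` (C \<inter> N)) ` F))"
    by (rule negligible_countable_Union) (use F(1,3) in auto)
  ultimately show ?thesis by (rule negligible_subset[rotated])
qed

text \<open>In a chart the height \<open>snd\<close> becomes the last coordinate of
  \<open>\<psi>\<close>, and a horizontal tangent space says that it is critical along
  \<open>L\<close>. Countably many charts suffice.\<close>

lemma submanifold_critical_values_negligible:
  fixes A :: "('a::euclidean_space \<times> real) set"
  assumes A: "submanifold (Suc k) d A" "d \<le> Suc k"
  shows "negligible (snd ` {a\<in>A. \<forall>w\<in>tangent_space A a. snd w = 0})"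
proof (rule negligible_local)
  fix a assume "a \<in> {a\<in>A. \<forall>w\<in>tangent_space A a. snd w = 0}"
  then have aA: "a \<in> A" by simp
  obtain U V L \<phi> \<psi> where s: "straightening k A U V L \<phi> \<psi>" "a \<in> U" "dim L = d"
    using A(1) aA by (rule submanifold_straightening)
  interpret straightening k A U V L \<phi> \<psi> by (rule s(1))
  define g where "g = (\<lambda>z. snd (\<psi> z))"
  have g: "Ck_on (Suc k) g V"
    unfolding g_def by (rule Ck_on_linear_comp[OF bounded_linear_snd open_V Ck_\<psi>])
  have dg: "frechet_derivative g (at z) = (\<lambda>h. snd (D\<psi> z h))" if "z \<in> V" for z
    unfolding g_def by (rule frechet_derivative_at[symmetric, OF has_derivative_snd[OF der_\<psi>[OF that]]])
  have "snd ` ({a\<in>A. \<forall>w\<in>tangent_space A a. snd w = 0} \<inter> U) \<subseteq> g ` {z\<in>V \<inter> L. \<forall>e\<in>L. frechet_derivative g (at z) e = 0}"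
  proof (rule image_subsetI)
    fix b assume b: "b \<in> {a\<in>A. \<forall>w\<in>tangent_space A a. snd w = 0} \<inter> U"
    then have bA: "b \<in> A" "b \<in> U" by auto
    have "frechet_derivative g (at (\<phi> b)) e = 0" if "e \<in> L" for e
    proof -
      have "D\<psi> (\<phi> b) e \<in> tangent_space A b" unfolding tangent_space_eq[OF bA] using that by blast
      then show ?thesis using b unfolding dg[OF \<phi>_V[OF bA(2)]] by simp
    qed
    moreover have "snd b = g (\<phi> b)" by (simp add: g_def \<psi>\<phi>[OF bA(2)])
    ultimately show "snd b \<in> g ` {z\<in>V \<inter> L. \<forall>e\<in>L. frechet_derivative g (at z) e = 0}"
      using \<phi>_V[OF bA(2)] \<phi>_L[OF bA] by blast
  qed
  moreover have "negligible (g ` {z\<in>V \<inter> L. \<forall>e\<in>L. frechet_derivative g (at z) e = 0})"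
    by (rule Morse_Sard_subspace[OF open_V g subspace_L]) (use s(3) A(2) in simp)
  ultimately show "\<exists>N. open N \<and> a \<in> N \<and> negligible (snd ` ({a\<in>A. \<forall>w\<in>tangent_space A a. snd w = 0} \<inter> N))"
    using open_U s(2) negligible_subset by blast
qed

text \<open>Countably many open sets that meet finitely many strata each cover \<open>X\<close>, and
  every stratum, being nonempty, meets one of them.\<close>

lemma whitney_stratification_countable:
  assumes ws: "whitney_stratification p (X :: 'a::euclidean_space set) \<X>"
  shows "countable \<X>"
proof -
  obtain F where F: "countable F" "X \<subseteq> \<Union>F" "\<And>N. N \<in> F \<Longrightarrow> finite {A \<in> \<X>. A \<inter> N \<noteq> {}}"
  proof (rule countable_open_cover[of X "\<lambda>N. finite {A \<in> \<X>. A \<inter> N \<noteq> {}}"])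
    show "\<exists>N. open N \<and> a \<in> N \<and> finite {A \<in> \<X>. A \<inter> N \<noteq> {}}" if a: "a \<in> X" for a
      by (rule locally_finite_neighbourhood[OF ws a]) blast
  qed blast
  have "\<X> \<subseteq> (\<Union>N\<in>F. {A \<in> \<X>. A \<inter> N \<noteq> {}})"
  proof
    fix A assume A: "A \<in> \<X>"
    then have "A \<noteq> {}"
      using ws unfolding whitney_stratification_def stratification_def partition_on_def by blast
    then show "A \<in> (\<Union>N\<in>F. {A \<in> \<X>. A \<inter> N \<noteq> {}})"
      using A F(2) whitney_stratificationD(2)[OF ws] by blast
  qed
  moreover have "countable (\<Union>N\<in>F. {A \<in> \<X>. A \<inter> N \<noteq> {}})"
    using F(1,3) by (intro countable_UN) (auto intro: countable_finite)
  ultimately show ?thesis by (rule countable_subset)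
qed

text \<open>The critical values of countably many strata form a null set, which contains no
  interval. Regularity is asked on all strata at once because the stratum of a later limit point on
  level \<open>c\<close> is not known in advance.\<close>

lemma regular_value_exists:
  fixes f :: "'a::euclidean_space \<Rightarrow> real"
  assumes lip: "locally_lipschitz f" and ws: "whitney_stratification DIM('a) (graph_of f) \<X>"
    and ab: "a < b"
  obtains c where "a < c" "c < b"
    "\<And>A x. A \<in> \<X> \<Longrightarrow> (x, f x) \<in> A \<Longrightarrow> f x = c \<Longrightarrow> \<exists>u u'. (u, u') \<in> tangent_space A (x, f x) \<and> u' \<noteq> 0"
proof -
  obtain k where k: "DIM('a) = Suc k" using whitney_stratificationD(1)[OF ws] gr0_conv_Suc by blast
  define C where "C = (\<lambda>A. snd ` {a\<in>A. \<forall>w\<in>tangent_space A a. snd (w :: 'a \<times> real) = 0})"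
  have "negligible (C A)" if A: "A \<in> \<X>" for A
  proof (cases "A = {}")
    case False
    obtain d where d: "submanifold (Suc k) d A" using whitney_stratificationD(6)[OF ws A] k by auto
    have "A \<subseteq> graph_of f" using A whitney_stratificationD(2)[OF ws] by blast
    from graph_submanifold_dim_le[OF lip this d False] k
    show ?thesis unfolding C_def by (intro submanifold_critical_values_negligible[OF d]) simp
  qed (simp add: C_def)
  then have neg: "negligible (\<Union>(C ` \<X>))"
    using whitney_stratification_countable[OF ws] by (intro negligible_countable_Union) auto
  have "\<not> {a<..<b} \<subseteq> \<Union>(C ` \<X>)"
  proof
    assume "{a<..<b} \<subseteq> \<Union>(C ` \<X>)"
    then have "negligible {a<..<b}" by (rule negligible_subset[OF neg])
    then show False using open_not_negligible[of "{a<..<b}"] ab by auto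
  qed
  then obtain c where "c \<in> {a<..<b}" "c \<notin> \<Union>(C ` \<X>)" by blast
  then have c: "a < c" "c < b" "c \<notin> \<Union>(C ` \<X>)" by simp_all
  have "\<exists>u u'. (u, u') \<in> tangent_space A (x, f x) \<and> u' \<noteq> 0" if A: "A \<in> \<X>" "(x, f x) \<in> A" "f x = c" for A x
  proof (rule ccontr)
    assume "\<not> ?thesis"
    then have "snd w = 0" if "w \<in> tangent_space A (x, f x)" for w using that by (cases w) auto
    then have "snd (x, f x) \<in> C A" unfolding C_def using A(2) by blast
    then show False using c(3) A by auto
  qed
  with c(1,2) show thesis by (rule that)
qed
section \<open>A monotonicity criterion by derived numbers\<close>

text \<open>\<open>h\<close> does not rise over the intervals in \<open>C\<close> and rises at rate
  at most \<open>M\<close> over the rest. The induction removes the rightmost interval and continues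
  on what lies to its left.\<close>

lemma sum_intervals_le:
  fixes h :: "real \<Rightarrow> real"
  assumes lip: "\<And>x y. a \<le> x \<Longrightarrow> x \<le> y \<Longrightarrow> y \<le> b \<Longrightarrow> h y - h x \<le> M * (y - x)"
    and C: "finite C" "pairwise (\<lambda>i j. disjnt {fst i..snd i} {fst j..snd j}) C"
    and I: "\<And>i. i \<in> C \<Longrightarrow> a \<le> fst i \<and> fst i < snd i \<and> snd i \<le> b \<and> h (snd i) \<le> h (fst i)" and "a \<le> b"
  shows "h b - h a \<le> M * ((b - a) - (\<Sum>i\<in>C. snd i - fst i))"
  using assms
proof (induction "card C" arbitrary: C b)
  case 0
  then show ?case by simp
next
  case (Suc n)
  have "C \<noteq> {}" using Suc.hyps(2) by auto
  then have fin: "finite (snd ` C)" "snd ` C \<noteq> {}" using Suc.prems(2) by auto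
  obtain m where m: "m \<in> C" "snd m = Max (snd ` C)" using Max_in[OF fin] by (metis imageE)
  have max: "snd i \<le> snd m" if "i \<in> C" for i unfolding m(2) using that fin by (intro Max_ge) auto
  have im: "a \<le> fst m" "fst m < snd m" "snd m \<le> b" "h (snd m) \<le> h (fst m)" using Suc.prems(4)[OF m(1)] by auto
  have left: "snd i \<le> fst m" if i: "i \<in> C - {m}" for i
  proof (rule ccontr)
    assume "\<not> snd i \<le> fst m"
    then have "snd i \<in> {fst i..snd i} \<inter> {fst m..snd m}" using max[of i] i Suc.prems(4)[of i] by auto
    moreover have "disjnt {fst i..snd i} {fst m..snd m}" using Suc.prems(3) i m(1) by (auto simp: pairwise_def)
    ultimately show False by (auto simp: disjnt_def)
  qed
  have "h (fst m) - h a \<le> M * ((fst m - a) - (\<Sum>i\<in>C - {m}. snd i - fst i))"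
  proof (rule Suc.hyps(1))
    show "n = card (C - {m})" using Suc.hyps(2) m(1) Suc.prems(2) by simp
    show "h y - h x \<le> M * (y - x)" if "a \<le> x" "x \<le> y" "y \<le> fst m" for x y
      using Suc.prems(1) that im by simp
    show "pairwise (\<lambda>i j. disjnt {fst i..snd i} {fst j..snd j}) (C - {m})"
      using Suc.prems(3) by (rule pairwise_subset) auto
    show "a \<le> fst i \<and> fst i < snd i \<and> snd i \<le> fst m \<and> h (snd i) \<le> h (fst i)" if "i \<in> C - {m}" for i
      using Suc.prems(4)[of i] that left[OF that] by auto
  qed (use Suc.prems im in auto)
  moreover have "h b - h (snd m) \<le> M * (b - snd m)" using Suc.prems(1)[of "snd m" b] im by simp
  moreover have "M * ((b - a) - (\<Sum>i\<in>C. snd i - fst i))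
      = M * ((fst m - a) - (\<Sum>i\<in>C - {m}. snd i - fst i)) + M * (b - snd m)"
    unfolding sum.remove[OF Suc.prems(2) m(1)] by (simp add: algebra_simps)
  ultimately show ?case using im(4) by linarith
qed

text \<open>Vitali's covering theorem takes the place of differentiability almost everywhere.\<close>
lemma derived_numbers_nonincreasing:
  fixes h :: "real \<Rightarrow> real"
  assumes ab: "a \<le> b" and M: "M \<ge> 0" and lip: "\<And>x y. a \<le> x \<Longrightarrow> x \<le> y \<Longrightarrow> y \<le> b \<Longrightarrow> h y - h x \<le> M * (y - x)"
    and N: "countable N"
    and dn: "\<And>t \<delta>. \<lbrakk>t \<in> {a<..<b} - N; \<delta> > 0\<rbrakk> \<Longrightarrow>
      \<exists>s1 s2. a \<le> s1 \<and> s1 < s2 \<and> s2 \<le> b \<and> s1 \<le> t \<and> t \<le> s2 \<and> s2 - s1 < \<delta> \<and> h s2 \<le> h s1"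
  shows "h b \<le> h a"
proof -
  \<comment> \<open>The intervals over which \<open>h\<close> does not rise. By \<open>dn\<close>
    they form a Vitali cover of the open interval without \<open>N\<close>; as balls they have
    centre \<open>ce\<close> and radius \<open>ra\<close>.\<close>
  define K where "K = {i::real \<times> real. a \<le> fst i \<and> fst i < snd i \<and> snd i \<le> b \<and> h (snd i) \<le> h (fst i)}"
  define ce where "ce = (\<lambda>i::real \<times> real. (fst i + snd i) / 2)"
  define ra where "ra = (\<lambda>i::real \<times> real. (snd i - fst i) / 2)"
  have cb: "cball (ce i) (ra i) = {fst i..snd i}" for i
    unfolding cball_eq_atLeastAtMost ce_def ra_def by (simp add: field_simps)
  have ra: "0 < ra i" if "i \<in> K" for i using that by (auto simp: K_def ra_def)
  have cover: "\<exists>i. i \<in> K \<and> t \<in> cball (ce i) (ra i) \<and> ra i < \<delta>" if t: "t \<in> {a<..<b} - N" "\<delta> > 0" for t \<delta>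
  proof -
    obtain s1 s2 where "a \<le> s1" "s1 < s2" "s2 \<le> b" "s1 \<le> t" "t \<le> s2" "s2 - s1 < \<delta>" "h s2 \<le> h s1"
      using dn[OF t] by blast
    then show ?thesis unfolding cb by (intro exI[of _ "(s1, s2)"]) (auto simp: K_def ra_def)
  qed
  obtain C where C: "countable C" "C \<subseteq> K" "pairwise (\<lambda>i j. disjnt (cball (ce i) (ra i)) (cball (ce j) (ra j))) C"
    "negligible (({a<..<b} - N) - (\<Union>i\<in>C. cball (ce i) (ra i)))"
    by (rule Vitali_covering_theorem_cballs[of K ra "{a<..<b} - N" ce, OF ra cover])
  have pw: "pairwise (\<lambda>i j. disjnt {fst i..snd i} {fst j..snd j}) C" using C(3) unfolding cb .
  have "negligible (\<Union>((\<lambda>x. {x}) ` N))" using N by (intro negligible_countable_Union) auto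
  then have "negligible N" by simp
  then have "negligible ((({a<..<b} - N) - (\<Union>i\<in>C. {fst i..snd i})) \<union> (N \<union> {a, b}))"
    using C(4) unfolding cb by (intro negligible_Un) auto
  then have neg: "negligible ({a..b} - (\<Union>i\<in>C. {fst i..snd i}))"
    by (rule negligible_subset) auto
  have KC: "a \<le> fst i" "fst i < snd i" "snd i \<le> b" "h (snd i) \<le> h (fst i)" if "i \<in> C" for i
    using that C(2) by (auto simp: K_def)
  \<comment> \<open>The disjoint intervals in \<open>C\<close> fill [a, b] up to a null set, so
    finitely many of them leave less than \<open>e\<close> uncovered, over which \<open>h\<close>
    rises by at most M e.\<close>
  have main: "h b - h a \<le> M * e" if e: "e > 0" for e
  proof (cases "C = {}")
    \<comment> \<open>Separated because the enumeration below needs a nonempty \<open>C\<close>;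
      here [a, b] itself is null, so a = b.\<close>
    case True
    then have "negligible {a..b}" using neg by simp
    then have "measure lebesgue {a..b} = 0" by (rule negligible_imp_measure0)
    moreover have "measure lebesgue {a..b} = b - a" using ab by simp
    ultimately have "a = b" by linarith
    then have "h b - h a = 0" by (rule ssubst) (rule diff_self)
    moreover have "0 \<le> M * e" by (rule mult_nonneg_nonneg[OF M less_imp_le[OF e]])
    ultimately show ?thesis by linarith
  next
    case False
    define A where "A = (\<lambda>n. {fst (from_nat_into C n)..snd (from_nat_into C n)})"
    define S where "S = (\<Union>i\<in>C. {fst i..snd i})"
    have S_eq: "S = (\<Union>n. A n)"
      unfolding S_def A_def by (subst range_from_nat_into[OF False C(1), symmetric]) (simp only: image_image)
    have S_sub: "S \<subseteq> {a..b}" unfolding S_def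
    proof (rule UN_least)
      fix i assume "i \<in> C"
      then show "{fst i..snd i} \<subseteq> {a..b}" using KC(1,3)[of i] by auto
    qed
    have "measure lebesgue ({a..b} - S) = 0" using neg unfolding S_def by (simp add: negligible_imp_measure0)
    have Sm: "S \<in> sets lebesgue" unfolding S_def using C(1) by (intro sets.countable_UN') auto
    have Im: "{a..b} \<in> lmeasurable" using lmeasurable_cbox[of a b] by simp
    have "measure lebesgue ({a..b} - S) = measure lebesgue {a..b} - measure lebesgue S"
      by (rule measurable_measure_Diff[OF Im Sm S_sub])
    then have mS: "measure lebesgue S = b - a" using \<open>measure lebesgue ({a..b} - S) = 0\<close> ab by simp
    have "(\<lambda>n. measure lebesgue (\<Union>i\<le>n. A i)) \<longlonglongrightarrow> measure lebesgue (\<Union>n. \<Union>i\<le>n. A i)"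
    proof (rule Lim_measure_incseq)
      show "range (\<lambda>n. \<Union>i\<le>n. A i) \<subseteq> sets lebesgue" unfolding A_def by auto
      show "incseq (\<lambda>n. \<Union>i\<le>n. A i)" by (auto simp: incseq_def intro: order_trans)
      have "(\<Union>n. \<Union>i\<le>n. A i) = S" unfolding S_eq by auto
      moreover have "emeasure lebesgue S \<le> emeasure lebesgue {a..b}" using S_sub by (intro emeasure_mono) auto
      moreover have "emeasure lebesgue {a..b} \<noteq> \<infinity>" using fmeasurableD2[OF Im] by simp
      ultimately show "emeasure lebesgue (\<Union>n. \<Union>i\<le>n. A i) \<noteq> \<infinity>" by (auto simp: top_unique)
    qed
    moreover have "(\<Union>n. \<Union>i\<le>n. A i) = S" unfolding S_eq by auto
    ultimately have "(\<lambda>n. measure lebesgue (\<Union>i\<le>n. A i)) \<longlonglongrightarrow> b - a" using mS by simp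
    then have "\<forall>\<^sub>F n in sequentially. b - a - e < measure lebesgue (\<Union>i\<le>n. A i)"
      using e by (intro order_tendstoD(1)) auto
    then obtain n where n: "b - a - e < measure lebesgue (\<Union>i\<le>n. A i)"
      using eventually_happens trivial_limit_sequentially by blast
    define D where "D = from_nat_into C ` {..n}"
    have D: "finite D" "D \<subseteq> C" unfolding D_def using from_nat_into[OF False] by auto
    have "(\<Union>i\<le>n. A i) = (\<Union>i\<in>D. {fst i..snd i})" unfolding D_def A_def by auto
    also have "measure lebesgue \<dots> \<le> (\<Sum>i\<in>D. measure lebesgue {fst i..snd i})"
      by (rule measure_UNION_le[OF D(1)]) auto
    also have "\<dots> = (\<Sum>i\<in>D. snd i - fst i)"
      using KC D(2) by (intro sum.cong) (auto simp: less_imp_le)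
    finally have "b - a - e < (\<Sum>i\<in>D. snd i - fst i)" using n by linarith
    then have "M * ((b - a) - (\<Sum>i\<in>D. snd i - fst i)) \<le> M * e" using M by (intro mult_left_mono) auto
    moreover have "h b - h a \<le> M * ((b - a) - (\<Sum>i\<in>D. snd i - fst i))"
      by (rule sum_intervals_le[OF lip D(1) pairwise_subset[OF pw D(2)] _ ab]) (use KC D(2) in blast)+
    ultimately show ?thesis by linarith
  qed
  have "h b - h a \<le> 0"
  proof (rule field_le_epsilon)
    fix e :: real assume e: "e > 0"
    \<comment> \<open>The denominator is M + 1 because \<open>M\<close> may be 0.\<close>
    have "h b - h a \<le> M * (e / (M + 1))" by (rule main) (use e M in simp)
    also have "\<dots> \<le> 0 + e" using e M by (simp add: divide_simps)
    finally show "h b - h a \<le> 0 + e" .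
  qed
  then show ?thesis by simp
qed

text \<open>Meant for the set of times that a curve spends in one stratum: at all but countably many
  of them other such times accumulate, which yields secants within the stratum.\<close>

lemma countable_isolated_points:
  fixes E :: "real set"
  shows "countable {t\<in>E. \<not> t islimpt E}"
proof -
  let ?I = "{t\<in>E. \<not> t islimpt E}"
  obtain F where F: "countable F" "?I \<subseteq> \<Union>F" "\<And>N. N \<in> F \<Longrightarrow> countable (?I \<inter> N)"
  proof (rule countable_open_cover[of ?I "\<lambda>N. countable (?I \<inter> N)"])
    fix t assume "t \<in> ?I"
    then obtain N where N: "open N" "t \<in> N" "\<forall>y\<in>E. y \<in> N \<longrightarrow> y = t" unfolding islimpt_def by blast
    then have "?I \<inter> N \<subseteq> {t}" by blast
    then have "countable (?I \<inter> N)" by (rule countable_subset) simp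
    with N(1,2) show "\<exists>N. open N \<and> t \<in> N \<and> countable (?I \<inter> N)" by blast
  qed blast
  have "?I \<subseteq> (\<Union>N\<in>F. ?I \<inter> N)" using F(2) by blast
  moreover have "countable (\<Union>N\<in>F. ?I \<inter> N)" using F(1,3) by (intro countable_UN)
  ultimately show ?thesis by (rule countable_subset)
qed

section \<open>Limit curves of the subgradient method\<close>

lemma locally_lipschitz_lipschitz_on_cball:
  fixes f :: "'a::euclidean_space \<Rightarrow> real"
  assumes lip: "locally_lipschitz f"
  obtains M where "M > 0" "M-lipschitz_on (cball 0 R) f"
proof -
  \<comment> \<open>The time variable is a dummy with the single value 0.\<close>
  have ll: "local_lipschitz {0::real} (cball 0 R) (\<lambda>_. f)"
  proof (rule local_lipschitzI)
    fix t :: real and x :: 'a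
    obtain r L where r: "r > 0" "L-lipschitz_on (ball x r) f" using lip unfolding locally_lipschitz_def by blast
    have "cball x (r / 2) \<inter> cball 0 R \<subseteq> ball x r" using r(1) by auto
    then have "L-lipschitz_on (cball x (r / 2) \<inter> cball 0 R) f" by (rule lipschitz_on_subset[OF r(2)])
    then show "\<exists>u>0. \<exists>L. \<forall>t\<in>cball t u \<inter> {0}. L-lipschitz_on (cball x u \<inter> cball 0 R) f"
      using r(1) by (intro exI[of _ "r / 2"]) auto
  qed
  obtain L where "\<And>t. t \<in> {0::real} \<Longrightarrow> L-lipschitz_on (cball 0 R) f"
    by (rule local_lipschitz_compact_implies_lipschitz[OF ll]) auto
  then have "L-lipschitz_on (cball 0 R) f" by simp
  then have "(max L 1)-lipschitz_on (cball 0 R) f" by (rule lipschitz_on_le) simp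
  then show thesis by (intro that[of "max L 1"]) auto
qed

section \<open>The iterates interpolated in time\<close>

locale bounded_subgradient_dynamics =
  fixes f :: "'a::euclidean_space \<Rightarrow> real" and \<epsilon> :: "nat \<Rightarrow> real" and xs v :: "nat \<Rightarrow> 'a"
  assumes lip: "locally_lipschitz f" and steps: "step_sizes \<epsilon>"
    and subgradient: "subgradient_sequence f \<epsilon> xs v" and bounded_xs: "bounded (range xs)"
begin

lemma \<epsilon>_pos: "\<epsilon> i > 0" and \<epsilon>_lim: "\<epsilon> \<longlonglongrightarrow> 0" and \<epsilon>_le: "\<epsilon> i \<le> \<epsilon> 0"
  using steps unfolding step_sizes_def decseq_def by auto

lemma xs_Suc: "xs (Suc i) = xs i - \<epsilon> i *\<^sub>R v i" and v_clarke: "v i \<in> clarke_subdifferential f (xs i)"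
  using subgradient unfolding subgradient_sequence_def by auto

lemma v_bounded: obtains L where "L > 0" "\<And>i. norm (v i) \<le> L"
proof -
  obtain R where R: "\<And>i. norm (xs i) \<le> R" using bounded_xs unfolding bounded_iff by auto
  obtain L where L: "L > 0" "L-lipschitz_on (cball 0 (R + 1)) f"
    using locally_lipschitz_lipschitz_on_cball[OF lip] by blast
  have "norm (v i) \<le> L" for i
  proof (rule clarke_subdifferential_norm_le[OF _ zero_less_one v_clarke])
    have "ball (xs i) 1 \<subseteq> cball 0 (R + 1)"
    proof
      fix y assume "y \<in> ball (xs i) 1"
      then have "norm (y - xs i) < 1" by (simp add: dist_norm norm_minus_commute)
      moreover have "norm y \<le> norm (xs i) + norm (y - xs i)" by (rule norm_triangle_sub)
      ultimately show "y \<in> cball 0 (R + 1)" using R[of i] by simp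
    qed
    then show "L-lipschitz_on (ball (xs i) 1) f" by (rule lipschitz_on_subset[OF L(2)])
  qed
  then show thesis by (rule that[OF L(1)])
qed

definition \<tau> :: "nat \<Rightarrow> real" where "\<tau> m = (\<Sum>i<m. \<epsilon> i)"

definition elapsed :: "nat \<Rightarrow> real \<Rightarrow> real" where "elapsed i t = min (max (t - \<tau> i) 0) (\<epsilon> i)"

text \<open>The piecewise linear interpolation of the iterates with \<open>X (\<tau> m) = xs m\<close>; \<open>elapsed i t\<close> is the time spent on
  step \<open>i\<close> before time \<open>t\<close>.\<close>
definition X :: "real \<Rightarrow> 'a" where "X t = xs 0 - (\<Sum>i | \<tau> i < t. elapsed i t *\<^sub>R v i)"

lemma \<tau>_Suc: "\<tau> (Suc m) = \<tau> m + \<epsilon> m"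
  by (simp add: \<tau>_def)

lemma \<tau>_0 [simp]: "\<tau> 0 = 0"
  by (simp add: \<tau>_def)

lemma \<tau>_strict_mono: "strict_mono \<tau>"
  by (rule strict_monoI_Suc) (simp add: \<tau>_Suc \<epsilon>_pos)

lemma \<tau>_mono: "m \<le> n \<Longrightarrow> \<tau> m \<le> \<tau> n"
  using \<tau>_strict_mono by (simp add: strict_mono_less_eq)

lemma \<tau>_less_iff: "\<tau> m < \<tau> n \<longleftrightarrow> m < n"
  using \<tau>_strict_mono by (rule strict_mono_less)

lemma \<tau>_nonneg: "\<tau> m \<ge> 0"
  using \<tau>_mono[of 0 m] by simp

lemma \<tau>_at_top: "filterlim \<tau> at_top sequentially"
  using steps unfolding step_sizes_def \<tau>_def by simp

lemma \<tau>_unbounded: "\<exists>m. t \<le> \<tau> m"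
  using \<tau>_at_top[unfolded filterlim_at_top, rule_format, of t] eventually_happens trivial_limit_sequentially by blast

lemma elapsed_mono: "a \<le> b \<Longrightarrow> elapsed i a \<le> elapsed i b"
  unfolding elapsed_def by (intro min.mono max.mono) auto

lemma elapsed_pos_imp: "a \<le> b \<Longrightarrow> elapsed i a < elapsed i b \<Longrightarrow> \<tau> i < b \<and> a < \<tau> (Suc i)"
  unfolding elapsed_def \<tau>_Suc using \<epsilon>_pos[of i] by linarith

lemma elapsed_before: "t \<le> \<tau> i \<Longrightarrow> elapsed i t = 0"
  unfolding elapsed_def using \<epsilon>_pos[of i] by linarith

lemma elapsed_after: "\<tau> (Suc i) \<le> t \<Longrightarrow> elapsed i t = \<epsilon> i"
  unfolding elapsed_def \<tau>_Suc using \<epsilon>_pos[of i] by linarith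

lemma sum_elapsed: "0 \<le> t \<Longrightarrow> (\<Sum>i<N. elapsed i t) = min t (\<tau> N)"
proof (induction N)
  case (Suc N)
  then show ?case using \<epsilon>_pos[of N] by (simp add: elapsed_def \<tau>_Suc)
qed simp

lemma X_eq:
  assumes "t \<le> \<tau> N"
  shows "X t = xs 0 - (\<Sum>i<N. elapsed i t *\<^sub>R v i)"
proof -
  have "{i. \<tau> i < t} \<subseteq> {..<N}"
  proof
    fix i assume "i \<in> {i. \<tau> i < t}"
    then have "\<tau> i < \<tau> N" using assms by simp
    then show "i \<in> {..<N}" by (simp add: \<tau>_less_iff)
  qed
  then have "(\<Sum>i | \<tau> i < t. elapsed i t *\<^sub>R v i) = (\<Sum>i<N. elapsed i t *\<^sub>R v i)"
    by (rule sum.mono_neutral_left[OF finite_lessThan]) (simp add: elapsed_before)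
  then show ?thesis by (simp add: X_def)
qed

text \<open>The weights are nonnegative with sum b - a, so (X b - X a) / (b - a) is minus an average
  of subgradients. The half-space and Lipschitz estimates rest on this.\<close>

lemma X_diff:
  assumes "0 \<le> a" "a \<le> b"
  obtains N where "X b - X a = - (\<Sum>i<N. (elapsed i b - elapsed i a) *\<^sub>R v i)"
    "(\<Sum>i<N. elapsed i b - elapsed i a) = b - a"
proof -
  obtain N where N: "b \<le> \<tau> N" using \<tau>_unbounded by blast
  have "X b - X a = - (\<Sum>i<N. (elapsed i b - elapsed i a) *\<^sub>R v i)"
    using X_eq[OF N] X_eq[of a N] assms N by (simp add: scaleR_diff_left sum_subtractf)
  moreover have "(\<Sum>i<N. elapsed i b - elapsed i a) = b - a"
    using sum_elapsed[of b N] sum_elapsed[of a N] assms N by (simp add: sum_subtractf min_def)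
  ultimately show thesis by (rule that)
qed

text \<open>A linear bound on subgradients passes to their averages, and only steps overlapping the
  interval from \<open>a\<close> to \<open>b\<close> carry positive weight.\<close>

lemma X_halfspace:
  assumes ab: "0 \<le> a" "a \<le> b" and u: "\<And>i. \<tau> i < b \<Longrightarrow> a < \<tau> (Suc i) \<Longrightarrow> u \<bullet> v i \<le> c"
  shows "- (u \<bullet> (X b - X a)) \<le> c * (b - a)"
proof -
  obtain N where N: "X b - X a = - (\<Sum>i<N. (elapsed i b - elapsed i a) *\<^sub>R v i)"
    "(\<Sum>i<N. elapsed i b - elapsed i a) = b - a"
    by (rule X_diff[OF ab])
  have "- (u \<bullet> (X b - X a)) = (\<Sum>i<N. (elapsed i b - elapsed i a) * (u \<bullet> v i))"
    unfolding N(1) by (simp add: inner_sum_right)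
  also have "\<dots> \<le> (\<Sum>i<N. (elapsed i b - elapsed i a) * c)"
  proof (rule sum_mono)
    fix i
    show "(elapsed i b - elapsed i a) * (u \<bullet> v i) \<le> (elapsed i b - elapsed i a) * c"
    proof (cases "elapsed i a < elapsed i b")
      case True
      then show ?thesis using u elapsed_pos_imp[OF ab(2) True] by (intro mult_left_mono) auto
    next
      case False
      then have "elapsed i b - elapsed i a = 0" using elapsed_mono[OF ab(2), of i] by linarith
      then show ?thesis by simp
    qed
  qed
  also have "\<dots> = c * (b - a)" unfolding sum_distrib_right[symmetric] N(2) by (rule mult.commute)
  finally show ?thesis .
qed

lemma X_lipschitz:
  assumes L: "\<And>i. norm (v i) \<le> L" and ab: "0 \<le> a" "a \<le> b"
  shows "norm (X b - X a) \<le> L * (b - a)"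
proof -
  obtain N where N: "X b - X a = - (\<Sum>i<N. (elapsed i b - elapsed i a) *\<^sub>R v i)"
    "(\<Sum>i<N. elapsed i b - elapsed i a) = b - a"
    by (rule X_diff[OF ab])
  have "norm (X b - X a) \<le> (\<Sum>i<N. norm ((elapsed i b - elapsed i a) *\<^sub>R v i))"
    unfolding N(1) norm_minus_cancel by (rule norm_sum)
  also have "\<dots> \<le> (\<Sum>i<N. (elapsed i b - elapsed i a) * L)"
  proof (rule sum_mono)
    fix i
    show "norm ((elapsed i b - elapsed i a) *\<^sub>R v i) \<le> (elapsed i b - elapsed i a) * L"
      using elapsed_mono[OF ab(2), of i] mult_left_mono[OF L, of "elapsed i b - elapsed i a" i] by simp
  qed
  also have "\<dots> = L * (b - a)" unfolding sum_distrib_right[symmetric] N(2) by (rule mult.commute)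
  finally show ?thesis .
qed

lemma X_\<tau>: "X (\<tau> m) = xs m"
proof -
  have "X (\<tau> m) = xs 0 - (\<Sum>i<m. \<epsilon> i *\<^sub>R v i)"
    unfolding X_eq[OF order_refl] by (simp add: elapsed_after \<tau>_mono Suc_le_eq)
  also have "\<dots> = xs m" by (induction m) (simp_all add: xs_Suc algebra_simps)
  finally show ?thesis .
qed

lemma X_bounded: obtains R where "\<And>t. t \<ge> 0 \<Longrightarrow> norm (X t) \<le> R"
proof -
  obtain L where L: "L > 0" "\<And>i. norm (v i) \<le> L" by (rule v_bounded) blast
  obtain R where R: "\<And>i. norm (xs i) \<le> R" using bounded_xs unfolding bounded_iff by auto
  have "norm (X t) \<le> R + L * \<epsilon> 0" if t: "t \<ge> 0" for t
  proof -
    define m where "m = (LEAST m. t < \<tau> (Suc m))"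
    obtain n where "t + 1 \<le> \<tau> n" using \<tau>_unbounded by blast
    then have "t < \<tau> (Suc n)" using \<tau>_mono[of n "Suc n"] by simp
    then have m: "t < \<tau> (Suc m)" unfolding m_def by (rule LeastI)
    have "\<tau> m \<le> t"
    proof (cases m)
      case (Suc j)
      then have "\<not> t < \<tau> (Suc j)" using not_less_Least[of j "\<lambda>m. t < \<tau> (Suc m)"] by (simp add: m_def)
      then show ?thesis using Suc by simp
    qed (use t in simp)
    then have "norm (X t - X (\<tau> m)) \<le> L * (t - \<tau> m)" by (rule X_lipschitz[OF L(2) \<tau>_nonneg])
    also have "\<dots> \<le> L * \<epsilon> 0" using m \<epsilon>_le[of m] L(1) by (intro mult_left_mono) (auto simp: \<tau>_Suc)
    finally have "norm (X t - xs m) \<le> L * \<epsilon> 0" unfolding X_\<tau> .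
    moreover have "norm (X t) \<le> norm (xs m) + norm (X t - xs m)" by (rule norm_triangle_sub)
    ultimately show ?thesis using R[of m] by linarith
  qed
  then show thesis by (rule that)
qed

end
text \<open>Returns to a stratum may happen before or after \<open>t\<close>, while the slope
  estimate and the Vitali cover want ordered endpoints.\<close>

lemma difference_quotient_min_max:
  fixes g :: "real \<Rightarrow> 'b::real_vector"
  shows "(g r - g t) /\<^sub>R (r - t) = (g (max r t) - g (min r t)) /\<^sub>R (max r t - min r t)"
proof (cases "r \<le> t")
  case True
  have "(g r - g t) /\<^sub>R (r - t) = (- (g t - g r)) /\<^sub>R (- (t - r))" by simp
  also have "\<dots> = (g t - g r) /\<^sub>R (t - r)"
    by (simp only: inverse_minus_eq scaleR_minus_left scaleR_minus_right minus_minus)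
  finally show ?thesis using True by (simp add: min_def max_def)
qed (simp add: min_def max_def)

section \<open>Limits of time shifts\<close>

context bounded_subgradient_dynamics begin

text \<open>Pointwise convergence is enough, since the Lipschitz and half-space bounds involve two
  times only and pass to the limit.\<close>

definition limit_curve :: "(nat \<Rightarrow> real) \<Rightarrow> real \<Rightarrow> (real \<Rightarrow> 'a) \<Rightarrow> bool" where
  "limit_curve s T \<gamma> \<longleftrightarrow> (\<forall>t\<in>{0..T}. (\<lambda>k. X (s k + t)) \<longlonglongrightarrow> \<gamma> t)"

lemma limit_curve_exists:
  assumes s: "\<And>k. s k \<ge> 0"
  obtains q \<gamma> where "strict_mono (q :: nat \<Rightarrow> nat)" "limit_curve (s \<circ> q) T \<gamma>"
proof -
  obtain L where L: "L > 0" "\<And>i. norm (v i) \<le> L" by (rule v_bounded) blast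
  obtain R where R: "\<And>t. t \<ge> 0 \<Longrightarrow> norm (X t) \<le> R" by (rule X_bounded) blast
  have lipX: "norm (X a - X b) \<le> L * \<bar>a - b\<bar>" if "a \<ge> 0" "b \<ge> 0" for a b
    using X_lipschitz[OF L(2), of a b] X_lipschitz[OF L(2), of b a] that
    by (cases "a \<le> b") (auto simp: norm_minus_commute)
  have equi: "\<exists>d. 0 < d \<and> (\<forall>n y. y \<in> {0..T} \<and> norm (x - y) < d \<longrightarrow> norm (X (s n + x) - X (s n + y)) < e)"
    if "x \<in> {0..T}" "0 < e" for x e
  proof (intro exI[of _ "e / L"] conjI allI impI)
    show "0 < e / L" using L(1) that by simp
    fix n y assume y: "y \<in> {0..T} \<and> norm (x - y) < e / L"
    have "norm (X (s n + x) - X (s n + y)) \<le> L * \<bar>(s n + x) - (s n + y)\<bar>"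
      using s[of n] that(1) y by (intro lipX) auto
    also have "\<dots> < e" using y L(1) by (simp add: pos_less_divide_eq mult.commute)
    finally show "norm (X (s n + x) - X (s n + y)) < e" .
  qed
  have bd: "norm (X (s n + x)) \<le> R" if "x \<in> {0..T}" for n x using R s[of n] that by simp
  have "\<exists>\<gamma> q. strict_mono (q :: nat \<Rightarrow> nat) \<and>
    (\<forall>e>0. \<exists>N. \<forall>n x. n \<ge> N \<and> x \<in> {0..T} \<longrightarrow> norm (X (s (q n) + x) - \<gamma> x) < e)"
    by (rule Arzela_Ascoli[of "{0..T}" "\<lambda>n x. X (s n + x)" R, OF compact_Icc bd equi]) blast+
  then obtain \<gamma> q where q: "strict_mono (q :: nat \<Rightarrow> nat)"
    "\<forall>e>0. \<exists>N. \<forall>n x. n \<ge> N \<and> x \<in> {0..T} \<longrightarrow> norm (X (s (q n) + x) - \<gamma> x) < e"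
    by blast
  have "limit_curve (s \<circ> q) T \<gamma>"
    unfolding limit_curve_def
  proof (intro ballI LIMSEQ_I)
    fix t e :: real assume "t \<in> {0..T}" "0 < e"
    then show "\<exists>N. \<forall>n\<ge>N. norm (X ((s \<circ> q) n + t) - \<gamma> t) < e" using q(2)[rule_format, of e] by auto
  qed
  with q(1) show thesis by (rule that)
qed

lemma limit_curve_lipschitz:
  assumes s: "\<And>k. s k \<ge> 0" and \<gamma>: "limit_curve s T \<gamma>" and L: "\<And>i. norm (v i) \<le> L"
    and ab: "0 \<le> a" "a \<le> b" "b \<le> T"
  shows "norm (\<gamma> b - \<gamma> a) \<le> L * (b - a)"
proof (rule tendsto_upperbound[OF _ always_eventually trivial_limit_sequentially])
  show "(\<lambda>k. norm (X (s k + b) - X (s k + a))) \<longlonglongrightarrow> norm (\<gamma> b - \<gamma> a)"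
    using \<gamma> ab unfolding limit_curve_def by (intro tendsto_norm tendsto_diff) auto
  show "\<forall>k. norm (X (s k + b) - X (s k + a)) \<le> L * (b - a)"
  proof
    fix k
    have "norm (X (s k + b) - X (s k + a)) \<le> L * ((s k + b) - (s k + a))"
      by (rule X_lipschitz[OF L]) (use s[of k] ab in auto)
    then show "norm (X (s k + b) - X (s k + a)) \<le> L * (b - a)" by simp
  qed
qed

text \<open>The inclusion of -\<gamma>' in the Clarke subdifferential, integrated and tested against
  a single vector \<open>u\<close>, so that the curve need not be differentiated. For late times the
  iterates active during the interval lie in the ball where \<open>u\<close> bounds the
  subgradients.\<close>

lemma limit_curve_halfspace:
  assumes s: "\<And>k. s k \<ge> 0" "filterlim s at_top sequentially" and \<gamma>: "limit_curve s T \<gamma>"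
    and L: "L > 0" "\<And>i. norm (v i) \<le> L" and ab: "0 \<le> a" "a \<le> b" "b \<le> T"
    and \<rho>: "norm (\<gamma> a - p) + L * (b - a) < \<rho>"
    and u: "\<And>z w. z \<in> ball p \<rho> \<Longrightarrow> w \<in> clarke_subdifferential f z \<Longrightarrow> u \<bullet> w \<le> c"
  shows "- (u \<bullet> (\<gamma> b - \<gamma> a)) \<le> c * (b - a)"
proof -
  \<comment> \<open>Half of the slack in the assumption on \<open>\<rho>\<close>: one half pays for
    the distance from X (s k + a) to \<gamma> a, the other for a step that begins before s k +
    a.\<close>
  define \<eta> where "\<eta> = (\<rho> - norm (\<gamma> a - p) - L * (b - a)) / 2"
  have \<eta>: "\<eta> > 0" using \<rho> by (simp add: \<eta>_def)
  have limX: "(\<lambda>k. X (s k + t)) \<longlonglongrightarrow> \<gamma> t" if "0 \<le> t" "t \<le> T" for t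
    using \<gamma> that unfolding limit_curve_def by auto
  have "\<eta> / L > 0" using \<eta> L(1) by simp
  then obtain I where I: "\<And>i. i \<ge> I \<Longrightarrow> \<epsilon> i < \<eta> / L"
    using order_tendstoD(2)[OF \<epsilon>_lim] unfolding eventually_sequentially by blast
  have ev1: "\<forall>\<^sub>F k in sequentially. \<tau> I < s k"
    using s(2) unfolding filterlim_at_top_dense by blast
  have ev2: "\<forall>\<^sub>F k in sequentially. dist (X (s k + a)) (\<gamma> a) < \<eta>"
    using limX[of a] ab \<eta> by (intro tendstoD) auto
  have "\<forall>\<^sub>F k in sequentially. - (u \<bullet> (X (s k + b) - X (s k + a))) \<le> c * (b - a)"
    using ev1 ev2
  proof eventually_elim
    case (elim k)
    have "- (u \<bullet> (X (s k + b) - X (s k + a))) \<le> c * ((s k + b) - (s k + a))"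
    proof (rule X_halfspace)
      show "0 \<le> s k + a" "s k + a \<le> s k + b" using s(1)[of k] ab by auto
      fix i assume i: "\<tau> i < s k + b" "s k + a < \<tau> (Suc i)"
      have "\<tau> I < \<tau> (Suc i)" using elim(1) i(2) ab(1) by linarith
      then have "I \<le> i" by (simp add: \<tau>_less_iff)
      then have "\<epsilon> i < \<eta> / L" by (rule I)
      then have Le: "L * \<epsilon> i < \<eta>" using L(1) by (simp add: field_simps)
      \<comment> \<open>\<open>v i\<close> is a subgradient at the start \<tau> i of its step, which
        may precede s k + a, but by less than \<epsilon> i; here the vanishing of the step sizes
        enters.\<close>
      have "norm (X (\<tau> i) - X (s k + a)) \<le> L * (b - a) + L * \<epsilon> i"
      proof (cases "\<tau> i \<le> s k + a")
        case True
        have "norm (X (s k + a) - X (\<tau> i)) \<le> L * (s k + a - \<tau> i)"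
          by (rule X_lipschitz[OF L(2) \<tau>_nonneg True])
        also have "\<dots> \<le> L * \<epsilon> i" using i(2) L(1) by (intro mult_left_mono) (auto simp: \<tau>_Suc)
        also have "\<dots> \<le> L * (b - a) + L * \<epsilon> i" using ab L(1) by simp
        finally show ?thesis by (simp add: norm_minus_commute)
      next
        case False
        have "norm (X (\<tau> i) - X (s k + a)) \<le> L * (\<tau> i - (s k + a))"
          using False s(1)[of k] ab(1) by (intro X_lipschitz[OF L(2)]) auto
        also have "\<dots> \<le> L * (b - a)" using i(1) L(1) by (intro mult_left_mono) auto
        also have "\<dots> \<le> L * (b - a) + L * \<epsilon> i" using L(1) \<epsilon>_pos[of i] by simp
        finally show ?thesis .
      qed
      then have "dist (xs i) (X (s k + a)) \<le> L * (b - a) + L * \<epsilon> i" by (simp add: X_\<tau> dist_norm)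
      moreover have "dist (xs i) p \<le> dist (xs i) (X (s k + a)) + dist (X (s k + a)) (\<gamma> a) + dist (\<gamma> a) p"
        by (meson add_right_mono dist_triangle order_trans)
      moreover have "2 * \<eta> = \<rho> - dist (\<gamma> a) p - L * (b - a)" by (simp add: \<eta>_def dist_norm)
      ultimately have "dist (xs i) p < \<rho>" using elim(2) Le by linarith
      then have "xs i \<in> ball p \<rho>" by (simp add: dist_commute)
      then show "u \<bullet> v i \<le> c" using u v_clarke by blast
    qed
    then show ?case by simp
  qed
  moreover have "(\<lambda>k. - (u \<bullet> (X (s k + b) - X (s k + a)))) \<longlonglongrightarrow> - (u \<bullet> (\<gamma> b - \<gamma> a))"
    using limX ab by (intro tendsto_intros) auto
  ultimately show ?thesis by (intro tendsto_upperbound[OF _ _ trivial_limit_sequentially])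
qed

text \<open>The half-space bounds for \<open>u\<close> and for -u. The sign of u' is reversed
  because the curve moves against the subgradients.\<close>

lemma limit_curve_slope:
  assumes s: "\<And>k. s k \<ge> 0" "filterlim s at_top sequentially" and \<gamma>: "limit_curve s T \<gamma>"
    and L: "L > 0" "\<And>i. norm (v i) \<le> L" and ab: "0 \<le> a" "a < b" "b \<le> T"
    and \<rho>: "norm (\<gamma> a - p) + L * (b - a) < \<rho>"
    and u: "\<And>z w. z \<in> ball p \<rho> \<Longrightarrow> w \<in> clarke_subdifferential f z \<Longrightarrow> \<bar>u \<bullet> w - u'\<bar> \<le> e"
  shows "\<bar>u \<bullet> ((\<gamma> b - \<gamma> a) /\<^sub>R (b - a)) + u'\<bar> \<le> e"
proof -
  note half = limit_curve_halfspace[OF s \<gamma> L ab(1) less_imp_le[OF ab(2)] ab(3) \<rho>]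
  have 1: "- (u \<bullet> (\<gamma> b - \<gamma> a)) \<le> (u' + e) * (b - a)"
    by (rule half) (use u in \<open>fastforce simp: abs_le_iff\<close>)
  have 2: "- ((- u) \<bullet> (\<gamma> b - \<gamma> a)) \<le> (e - u') * (b - a)"
    by (rule half) (use u in \<open>fastforce simp: abs_le_iff\<close>)
  define d where "d = b - a"
  have d: "d > 0" using ab by (simp add: d_def)
  have "u \<bullet> ((\<gamma> b - \<gamma> a) /\<^sub>R (b - a)) = (u \<bullet> (\<gamma> b - \<gamma> a)) / d"
    by (simp add: d_def divide_inverse_commute)
  moreover have "(u \<bullet> (\<gamma> b - \<gamma> a)) / d \<le> e - u'" using 2 d unfolding d_def[symmetric] by (simp add: pos_divide_le_eq)
  moreover have "- (u' + e) \<le> (u \<bullet> (\<gamma> b - \<gamma> a)) / d"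
  proof -
    have "- ((u' + e) * d) \<le> u \<bullet> (\<gamma> b - \<gamma> a)" using 1 unfolding d_def[symmetric] by linarith
    then show ?thesis unfolding pos_le_divide_eq[OF d] by (simp only: mult_minus_left)
  qed
  ultimately show ?thesis by linarith
qed

text \<open>The limit curve stays inside the proof: it is chosen on [0, T] after \<open>T\<close>,
  whereas \<open>T0\<close> depends only on the ball around \<open>y\<close> in which noncriticality
  keeps the speed of every limit curve away from 0.\<close>

lemma limit_curve_descent:
  assumes ws: "whitney_stratification (Suc k) (graph_of f) \<X>"
    and s: "\<And>j. s j \<ge> 0" "filterlim s at_top sequentially" and y: "(\<lambda>j. X (s j)) \<longlonglongrightarrow> y"
    and B: "B \<in> \<X>" "(y, f y) \<in> B" and u: "(u, u') \<in> tangent_space B (y, f y)" "u' \<noteq> 0"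
  shows "\<exists>T0>0. \<forall>T. 0 < T \<longrightarrow> T < T0 \<longrightarrow>
    (\<exists>q l. strict_mono (q :: nat \<Rightarrow> nat) \<and> l < f y \<and> (\<lambda>j. f (X (s (q j) + T))) \<longlonglongrightarrow> l)"
proof -
  obtain L where L: "L > 0" "\<And>i. norm (v i) \<le> L" by (rule v_bounded) blast
  \<comment> \<open>An error of half of |u'| leaves |u . q| at least |u'| / 2 for the quotients q of
    the curve near \<open>y\<close>, hence |q| at least |u'| / (2 |u|), the lower bound
    \<open>\<eta>\<close> below.\<close>
  have "\<bar>u'\<bar> / 2 > 0" using u(2) by simp
  then obtain \<delta>0 where \<delta>0: "\<delta>0 > 0"
    "\<And>z w. z \<in> ball y \<delta>0 \<Longrightarrow> w \<in> clarke_subdifferential f z \<Longrightarrow> \<bar>u \<bullet> w - u'\<bar> \<le> \<bar>u'\<bar> / 2"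
    by (rule clarke_projection[OF lip ws B u(1)]) blast
  \<comment> \<open>Moving at speed at most \<open>L\<close>, the curve stays in the ball of radius
    \<open>\<delta>0\<close> before time \<delta>0 / L.\<close>
  have "\<exists>q l. strict_mono (q :: nat \<Rightarrow> nat) \<and> l < f y \<and> (\<lambda>j. f (X (s (q j) + T))) \<longlonglongrightarrow> l"
    if T: "0 < T" "T < \<delta>0 / L" for T
  proof -
    obtain q \<gamma> where q: "strict_mono (q :: nat \<Rightarrow> nat)" and \<gamma>: "limit_curve (s \<circ> q) T \<gamma>"
      by (rule limit_curve_exists[of s T, OF s(1)]) blast
    have sq: "\<And>j. (s \<circ> q) j \<ge> 0" "filterlim (s \<circ> q) at_top sequentially"
      using s(1) filterlim_compose[OF s(2) filterlim_subseq[OF q]] by (auto simp: o_def)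
    have limX: "(\<lambda>j. X (s (q j) + t)) \<longlonglongrightarrow> \<gamma> t" if "0 \<le> t" "t \<le> T" for t
      using \<gamma> that unfolding limit_curve_def by auto
    have "(\<lambda>j. X (s (q j))) \<longlonglongrightarrow> y" using LIMSEQ_subseq_LIMSEQ[OF y q] by (simp add: o_def)
    moreover have "(\<lambda>j. X (s (q j))) \<longlonglongrightarrow> \<gamma> 0" using limX[of 0] T(1) by simp
    ultimately have \<gamma>0: "\<gamma> 0 = y" by (rule LIMSEQ_unique[rotated])
    have lip\<gamma>: "norm (\<gamma> b - \<gamma> a) \<le> L * (b - a)" if "0 \<le> a" "a \<le> b" "b \<le> T" for a b
      by (rule limit_curve_lipschitz[OF sq(1) \<gamma> L(2) that])
    have LT: "L * T < \<delta>0" using T(2) L(1) by (simp add: pos_less_divide_eq mult.commute)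
    have slope_u: "\<bar>u \<bullet> ((\<gamma> b - \<gamma> a) /\<^sub>R (b - a)) + u'\<bar> \<le> \<bar>u'\<bar> / 2" if ab: "0 \<le> a" "a < b" "b \<le> T" for a b
    proof (rule limit_curve_slope[OF sq \<gamma> L ab _ \<delta>0(2)])
      have "norm (\<gamma> a - y) \<le> L * (a - 0)" using lip\<gamma>[of 0 a] ab unfolding \<gamma>0 by simp
      then have "norm (\<gamma> a - y) + L * (b - a) \<le> L * b" by (simp add: algebra_simps)
      also have "\<dots> \<le> L * T" using ab(3) L(1) by (intro mult_left_mono) auto
      finally show "norm (\<gamma> a - y) + L * (b - a) < \<delta>0" using LT by linarith
    qed
    have u0: "norm u > 0"
    proof (rule ccontr)
      assume "\<not> norm u > 0"
      then have "u = 0" by simp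
      then show False using slope_u[of 0 T] T(1) u(2) by simp
    qed
    define \<eta> where "\<eta> = \<bar>u'\<bar> / (2 * norm u)"
    have \<eta>: "\<eta> > 0" using u0 u(2) by (simp add: \<eta>_def)
    have slope_norm: "\<eta> \<le> norm ((\<gamma> b - \<gamma> a) /\<^sub>R (b - a))" if ab: "0 \<le> a" "a < b" "b \<le> T" for a b
    proof -
      have "\<bar>u'\<bar> / 2 \<le> \<bar>u \<bullet> ((\<gamma> b - \<gamma> a) /\<^sub>R (b - a))\<bar>" using slope_u[OF ab] by linarith
      also have "\<dots> \<le> norm u * norm ((\<gamma> b - \<gamma> a) /\<^sub>R (b - a))" by (rule Cauchy_Schwarz_ineq2)
      finally show ?thesis using u0 unfolding \<eta>_def by (simp only: divide_le_eq mult_pos_pos zero_less_numeral if_True) (simp add: mult.commute)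
    qed
    obtain M where M: "M > 0" "M-lipschitz_on (cball 0 (norm y + L * T)) f"
      by (rule locally_lipschitz_lipschitz_on_cball[OF lip]) blast
    have \<gamma>_in: "\<gamma> t \<in> cball 0 (norm y + L * T)" if "0 \<le> t" "t \<le> T" for t
    proof -
      have "norm (\<gamma> t) \<le> norm y + norm (\<gamma> t - y)" by (rule norm_triangle_sub)
      moreover have "norm (\<gamma> t - y) \<le> L * t" using lip\<gamma>[of 0 t] that unfolding \<gamma>0 by simp
      moreover have "L * t \<le> L * T" using that L(1) by (intro mult_left_mono) auto
      ultimately show ?thesis by simp
    qed
    define h where "h = (\<lambda>t. f (\<gamma> t))"
    have lip_h: "\<bar>h b - h a\<bar> \<le> (M * L) * (b - a)" if ab: "0 \<le> a" "a \<le> b" "b \<le> T" for a b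
    proof -
      have "\<bar>h b - h a\<bar> \<le> M * norm (\<gamma> b - \<gamma> a)"
        using lipschitz_onD[OF M(2) \<gamma>_in[of b] \<gamma>_in[of a]] ab by (simp add: h_def dist_norm)
      also have "\<dots> \<le> M * (L * (b - a))" using lip\<gamma>[OF ab] M(1) by (intro mult_left_mono) auto
      finally show ?thesis by simp
    qed
    \<comment> \<open>Half of \<eta>^2, so that the derived number, at most -\<eta>^2, is strictly
      below -c and quotients close to it are so too.\<close>
    define c where "c = \<eta>\<^sup>2 / 2"
    have c: "c > 0" using \<eta> by (simp add: c_def)
    define E where "E = (\<lambda>A. {t\<in>{0<..<T}. (\<gamma> t, h t) \<in> A})"
    \<comment> \<open>The exceptional times: those at which the curve does not return to its current
      stratum at arbitrarily near times.\<close>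
    define N where "N = (\<Union>A\<in>\<X>. {t\<in>E A. \<not> t islimpt E A})"
    have N: "countable N"
      unfolding N_def using whitney_stratification_countable[OF ws] countable_isolated_points by (intro countable_UN)
    have dn: "\<exists>a b. 0 \<le> a \<and> a < b \<and> b \<le> T \<and> a \<le> t \<and> t \<le> b \<and> b - a < \<delta> \<and> h b + c * b \<le> h a + c * a"
      if t: "t \<in> {0<..<T} - N" and \<delta>: "\<delta> > 0" for t \<delta>
    proof -
      have "(\<gamma> t, h t) \<in> graph_of f" by (simp add: graph_of_iff h_def)
      then obtain A where A: "A \<in> \<X>" "(\<gamma> t, h t) \<in> A" using whitney_stratificationD(2)[OF ws] by blast
      then have "t islimpt E A" using t unfolding N_def E_def by auto
      then obtain t0 where t0: "\<And>j. t0 j \<in> E A - {t}" "t0 \<longlonglongrightarrow> t" unfolding islimpt_sequential by blast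
      define lo hi where "lo = (\<lambda>r. min r t)" and "hi = (\<lambda>r. max r t)"
      have lohi: "0 \<le> lo r" "lo r < hi r" "hi r \<le> T" "lo r \<le> t" "t \<le> hi r" "hi r - lo r = \<bar>r - t\<bar>" if "r \<in> E A - {t}" for r
        using that t unfolding lo_def hi_def E_def by (auto simp: min_def max_def)
      have quot\<gamma>: "(\<gamma> r - \<gamma> t) /\<^sub>R (r - t) = (\<gamma> (hi r) - \<gamma> (lo r)) /\<^sub>R (hi r - lo r)"
        and quot_h: "(h r - h t) /\<^sub>R (r - t) = (h (hi r) - h (lo r)) /\<^sub>R (hi r - lo r)" for r
        unfolding lo_def hi_def by (rule difference_quotient_min_max)+
      have bQ: "norm ((\<gamma> r - \<gamma> t) /\<^sub>R (r - t)) \<le> L" if r: "r \<in> E A - {t}" for r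
      proof -
        have "norm (\<gamma> (hi r) - \<gamma> (lo r)) \<le> L * (hi r - lo r)" using lohi[OF r] by (intro lip\<gamma>) auto
        then show ?thesis unfolding quot\<gamma> using lohi(2)[OF r] by (simp add: divide_inverse_commute[symmetric] pos_divide_le_eq)
      qed
      have bH: "norm ((h r - h t) /\<^sub>R (r - t)) \<le> M * L" if r: "r \<in> E A - {t}" for r
      proof -
        have "\<bar>h (hi r) - h (lo r)\<bar> \<le> (M * L) * (hi r - lo r)" using lohi[OF r] by (intro lip_h) auto
        then show ?thesis unfolding quot_h using lohi(2)[OF r] by (simp add: abs_mult divide_inverse_commute[symmetric] pos_divide_le_eq)
      qed
      \<comment> \<open>The quotients of \<gamma> and of \<open>h\<close> must converge along the
        same subsequence for the limit pair to be a tangent vector of \<open>A\<close>.\<close>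
      have "norm ((\<gamma> (t0 j) - \<gamma> t) /\<^sub>R (t0 j - t), (h (t0 j) - h t) /\<^sub>R (t0 j - t)) \<le> L + M * L" for j
        by (rule order_trans[OF norm_Pair_le add_mono[OF bQ[OF t0(1)] bH[OF t0(1)]]])
      then obtain P \<sigma> where \<sigma>: "strict_mono (\<sigma> :: nat \<Rightarrow> nat)"
        "(\<lambda>j. ((\<gamma> (t0 (\<sigma> j)) - \<gamma> t) /\<^sub>R (t0 (\<sigma> j) - t), (h (t0 (\<sigma> j)) - h t) /\<^sub>R (t0 (\<sigma> j) - t))) \<longlonglongrightarrow> P"
        by (rule bounded_subsequence)
      define t1 where "t1 = t0 \<circ> \<sigma>"
      define p p' where "p = fst P" and "p' = snd P"
      have t1: "t1 j \<in> E A - {t}" for j using t0(1) by (simp add: t1_def)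
      have t1_lim: "t1 \<longlonglongrightarrow> t" unfolding t1_def by (rule LIMSEQ_subseq_LIMSEQ[OF t0(2) \<sigma>(1)])
      have lim_pair: "(\<lambda>j. ((\<gamma> (t1 j) - \<gamma> t) /\<^sub>R (t1 j - t), (h (t1 j) - h t) /\<^sub>R (t1 j - t))) \<longlonglongrightarrow> (p, p')"
        using \<sigma>(2) by (simp add: o_def t1_def p_def p'_def)
      have Q: "(\<lambda>j. (\<gamma> (t1 j) - \<gamma> t) /\<^sub>R (t1 j - t)) \<longlonglongrightarrow> p" using tendsto_fst[OF lim_pair] by simp
      have H: "(\<lambda>j. (h (t1 j) - h t) /\<^sub>R (t1 j - t)) \<longlonglongrightarrow> p'" using tendsto_snd[OF lim_pair] by simp
      have dist0: "(\<lambda>j. \<bar>t1 j - t\<bar>) \<longlonglongrightarrow> 0"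
        using tendsto_rabs[OF LIM_zero[OF t1_lim]] by simp
      have \<gamma>_close: "norm (\<gamma> (lo (t1 j)) - \<gamma> t) \<le> L * \<bar>t1 j - t\<bar>" for j
      proof -
        have "norm (\<gamma> t - \<gamma> (lo (t1 j))) \<le> L * (t - lo (t1 j))"
          using lohi[OF t1[of j]] t by (intro lip\<gamma>) auto
        also have "\<dots> \<le> L * \<bar>t1 j - t\<bar>" using lohi(5,6)[OF t1[of j]] L(1) by (intro mult_left_mono) auto
        finally show ?thesis by (simp add: norm_minus_commute)
      qed
      have \<gamma>t1: "(\<lambda>j. \<gamma> (t1 j)) \<longlonglongrightarrow> \<gamma> t" and ht1: "(\<lambda>j. h (t1 j)) \<longlonglongrightarrow> h t"
      proof -
        have "(\<lambda>j. (t1 j - t) *\<^sub>R ((\<gamma> (t1 j) - \<gamma> t) /\<^sub>R (t1 j - t))) \<longlonglongrightarrow> 0 *\<^sub>R p"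
          by (intro tendsto_scaleR Q LIM_zero t1_lim)
        moreover have "(t1 j - t) *\<^sub>R ((\<gamma> (t1 j) - \<gamma> t) /\<^sub>R (t1 j - t)) = \<gamma> (t1 j) - \<gamma> t" for j using t1[of j] by simp
        ultimately have "(\<lambda>j. \<gamma> (t1 j) - \<gamma> t) \<longlonglongrightarrow> 0" by simp
        then show 1: "(\<lambda>j. \<gamma> (t1 j)) \<longlonglongrightarrow> \<gamma> t" by (rule LIM_zero_cancel)
        show "(\<lambda>j. h (t1 j)) \<longlonglongrightarrow> h t"
          unfolding h_def by (rule isCont_tendsto_compose[OF locally_lipschitz_isCont[OF lip] 1])
      qed
      obtain d where d: "submanifold (Suc k) d A" using whitney_stratificationD(6)[OF ws A(1)] ..
      have tangent: "(p, p') \<in> tangent_space A (\<gamma> t, f (\<gamma> t))"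
      proof (rule secant_limit_tangent[OF d])
        show "(\<gamma> t, f (\<gamma> t)) \<in> A" using A(2) by (simp add: h_def)
        show "(\<gamma> (t1 j), h (t1 j)) \<in> A" for j using t1[of j] by (simp add: E_def)
        show "(\<lambda>j. (\<gamma> (t1 j), h (t1 j))) \<longlonglongrightarrow> (\<gamma> t, f (\<gamma> t))"
          using tendsto_Pair[OF \<gamma>t1 ht1] by (simp add: h_def)
        show "(\<lambda>j. ((\<gamma> (t1 j), h (t1 j)) - (\<gamma> t, f (\<gamma> t))) /\<^sub>R (t1 j - t)) \<longlonglongrightarrow> (p, p')"
          using lim_pair by (simp add: h_def)
      qed
      have p_norm: "\<eta> \<le> norm p"
      proof (rule tendsto_lowerbound[OF tendsto_norm[OF Q] always_eventually trivial_limit_sequentially])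
        show "\<forall>j. \<eta> \<le> norm ((\<gamma> (t1 j) - \<gamma> t) /\<^sub>R (t1 j - t))"
          unfolding quot\<gamma> using slope_norm lohi[OF t1] by blast
      qed
      \<comment> \<open>The projection formula at \<gamma> t is applied to the tangent vector (p,
        p') itself: p . q is close to -p' for late quotients q, and q tends to p.\<close>
      have "\<bar>p \<bullet> p + p'\<bar> \<le> 0 + e" if e: "e > 0" for e
      proof -
        obtain \<delta>' where \<delta>': "\<delta>' > 0"
          "\<And>z w. z \<in> ball (\<gamma> t) \<delta>' \<Longrightarrow> w \<in> clarke_subdifferential f z \<Longrightarrow> \<bar>p \<bullet> w - p'\<bar> \<le> e"
          by (rule clarke_projection[OF lip ws A(1) A(2)[unfolded h_def] tangent e]) blast
        \<comment> \<open>The factor 2 counts the distance from the left endpoint to \<gamma> t and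
          the length of the path over the interval.\<close>
        have "(\<lambda>j. 2 * L * \<bar>t1 j - t\<bar>) \<longlonglongrightarrow> 0" by (rule tendsto_mult_right_zero[OF dist0])
        then have "\<forall>\<^sub>F j in sequentially. 2 * L * \<bar>t1 j - t\<bar> < \<delta>'" using \<delta>'(1) by (rule order_tendstoD(2))
        then have ev: "\<forall>\<^sub>F j in sequentially. \<bar>p \<bullet> ((\<gamma> (t1 j) - \<gamma> t) /\<^sub>R (t1 j - t)) + p'\<bar> \<le> e"
        proof (rule eventually_mono)
          fix j assume j: "2 * L * \<bar>t1 j - t\<bar> < \<delta>'"
          note lh = lohi[OF t1[of j]]
          show "\<bar>p \<bullet> ((\<gamma> (t1 j) - \<gamma> t) /\<^sub>R (t1 j - t)) + p'\<bar> \<le> e"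
            unfolding quot\<gamma>
          proof (rule limit_curve_slope[OF sq \<gamma> L lh(1-3) _ \<delta>'(2)])
            show "norm (\<gamma> (lo (t1 j)) - \<gamma> t) + L * (hi (t1 j) - lo (t1 j)) < \<delta>'"
              using \<gamma>_close[of j] j unfolding lh(6) by linarith
          qed
        qed
        have "(\<lambda>j. \<bar>p \<bullet> ((\<gamma> (t1 j) - \<gamma> t) /\<^sub>R (t1 j - t)) + p'\<bar>) \<longlonglongrightarrow> \<bar>p \<bullet> p + p'\<bar>"
          by (intro tendsto_intros Q)
        from tendsto_upperbound[OF this ev trivial_limit_sequentially] show ?thesis by simp
      qed
      then have "\<bar>p \<bullet> p + p'\<bar> \<le> 0" by (rule field_le_epsilon)
      then have "p' = - (norm p)\<^sup>2" by (simp add: dot_square_norm)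
      also have "\<dots> \<le> - \<eta>\<^sup>2" using p_norm \<eta> by (simp add: power_mono)
      also have "\<dots> < - c" using \<eta> by (simp add: c_def)
      finally have "p' < - c" .
      from order_tendstoD(2)[OF H this] order_tendstoD(2)[OF dist0 \<delta>]
      have "\<forall>\<^sub>F j in sequentially. (h (t1 j) - h t) /\<^sub>R (t1 j - t) < - c \<and> \<bar>t1 j - t\<bar> < \<delta>"
        by (rule eventually_conj)
      then obtain j where j: "(h (t1 j) - h t) /\<^sub>R (t1 j - t) < - c" "\<bar>t1 j - t\<bar> < \<delta>"
        using eventually_happens trivial_limit_sequentially by blast
      note lh = lohi[OF t1[of j]]
      define a b where "a = lo (t1 j)" and "b = hi (t1 j)"
      have ba: "b - a > 0" using lh(2) by (simp add: a_def b_def)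
      have "(h b - h a) / (b - a) < - c"
        using j(1) unfolding quot_h a_def b_def by (simp add: divide_inverse_commute)
      then have "h b - h a < - c * (b - a)" using ba by (simp only: pos_divide_less_eq)
      then have "h b + c * b \<le> h a + c * a" by (simp add: algebra_simps)
      then show ?thesis using lh j(2) unfolding a_def b_def by (intro exI[of _ "lo (t1 j)"] exI[of _ "hi (t1 j)"]) simp
    qed
    \<comment> \<open>The criterion is applied to h t + c t, so that \<open>h\<close> itself drops
      by at least c T.\<close>
    have "h T + c * T \<le> h 0 + c * 0"
    proof (rule derived_numbers_nonincreasing[OF less_imp_le[OF T(1)] _ _ N dn])
      show "0 \<le> M * L + c" using M(1) L(1) c by simp
      show "(h y' + c * y') - (h x + c * x) \<le> (M * L + c) * (y' - x)" if "0 \<le> x" "x \<le> y'" "y' \<le> T" for x y'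
        using lip_h[OF that] by (simp add: algebra_simps)
    qed
    moreover have "c * T > 0" using c T(1) by simp
    ultimately have "h T < f y" by (simp add: h_def \<gamma>0)
    moreover have "(\<lambda>j. f (X (s (q j) + T))) \<longlonglongrightarrow> h T"
      unfolding h_def by (rule isCont_tendsto_compose[OF locally_lipschitz_isCont[OF lip] limX]) (use T in auto)
    ultimately show ?thesis using q by blast
  qed
  moreover have "\<delta>0 / L > 0" using \<delta>0(1) L(1) by simp
  ultimately show ?thesis by blast
qed

text \<open>Descent is used twice: from \<open>x\<close>, to make the values oscillate between f x
  and some l < f x; and from a limit \<open>y\<close> of upcrossing points of a regular level
  \<open>c\<close> in between, where it contradicts the time spent above \<open>c\<close>.\<close>

lemma accumulation_point_critical:
  assumes ws: "whitney_stratification DIM('a) (graph_of f) \<X>"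
    and r: "strict_mono r" "(\<lambda>j. xs (r j)) \<longlonglongrightarrow> x"
    and B: "B \<in> \<X>" "(x, f x) \<in> B" and u: "(u, u') \<in> tangent_space B (x, f x)"
  shows "u' = 0"
proof (rule ccontr)
  assume u': "u' \<noteq> 0"
  obtain k where k: "DIM('a) = Suc k" using whitney_stratificationD(1)[OF ws] gr0_conv_Suc by blast
  note ws' = ws[unfolded k]
  define F where "F = (\<lambda>t. f (X t))"
  obtain L where L: "L > 0" "\<And>i. norm (v i) \<le> L" by (rule v_bounded) blast
  obtain R where R: "\<And>t. t \<ge> 0 \<Longrightarrow> norm (X t) \<le> R" by (rule X_bounded) blast
  obtain M where M: "M > 0" "M-lipschitz_on (cball 0 R) f"
    by (rule locally_lipschitz_lipschitz_on_cball[OF lip]) blast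
  have lipF: "\<bar>F b - F a\<bar> \<le> (M * L) * (b - a)" if ab: "0 \<le> a" "a \<le> b" for a b
  proof -
    have "\<bar>F b - F a\<bar> \<le> M * norm (X b - X a)"
      using lipschitz_onD[OF M(2), of "X b" "X a"] R[of a] R[of b] ab by (simp add: F_def dist_norm)
    also have "\<dots> \<le> M * (L * (b - a))" using X_lipschitz[OF L(2) ab] M(1) by (intro mult_left_mono) auto
    finally show ?thesis by simp
  qed
  have contF: "continuous_on {0..} F"
  proof (rule lipschitz_on_continuous_on)
    show "(M * L)-lipschitz_on {0..} F"
    proof (rule lipschitz_onI)
      fix a b :: real assume "a \<in> {0..}" "b \<in> {0..}"
      then show "dist (F a) (F b) \<le> (M * L) * dist a b"
        using lipF[of a b] lipF[of b a] by (cases "a \<le> b") (auto simp: dist_real_def)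
    qed (use M(1) L(1) in simp)
  qed
  define s where "s = (\<lambda>j. \<tau> (r j))"
  have s: "\<And>j. s j \<ge> 0" "filterlim s at_top sequentially"
    unfolding s_def using \<tau>_nonneg filterlim_compose[OF \<tau>_at_top filterlim_subseq[OF r(1)]] by auto
  have Xs: "(\<lambda>j. X (s j)) \<longlonglongrightarrow> x" using r(2) by (simp add: s_def X_\<tau>)
  obtain T0 where T0: "T0 > 0" "\<And>T. 0 < T \<Longrightarrow> T < T0 \<Longrightarrow>
    \<exists>q l. strict_mono (q :: nat \<Rightarrow> nat) \<and> l < f x \<and> (\<lambda>j. f (X (s (q j) + T))) \<longlonglongrightarrow> l"
    using limit_curve_descent[OF ws' s Xs B u u'] by blast
  define T where "T = T0 / 2"
  have T: "0 < T" "T < T0" using T0(1) by (auto simp: T_def)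
  obtain q l where q: "strict_mono (q :: nat \<Rightarrow> nat)" "l < f x" "(\<lambda>j. F (s (q j) + T)) \<longlonglongrightarrow> l"
    using T0(2)[OF T] unfolding F_def by blast
  obtain c where c: "l < c" "c < f x"
    "\<And>A z. A \<in> \<X> \<Longrightarrow> (z, f z) \<in> A \<Longrightarrow> f z = c \<Longrightarrow> \<exists>u u'. (u, u') \<in> tangent_space A (z, f z) \<and> u' \<noteq> 0"
    by (rule regular_value_exists[OF lip ws q(2)]) blast
  \<comment> \<open>The second level keeps upcrossings from being too brief: climbing from
    \<open>c\<close> to \<open>c'\<close> at rate at most M L takes at least the time
    \<open>T1\<close>.\<close>
  define c' where "c' = (c + f x) / 2"
  have c': "c < c'" "c' < f x" using c(2) by (auto simp: c'_def)
  define T1 where "T1 = (c' - c) / (M * L)"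
  have T1: "T1 > 0" using c' M(1) L(1) by (simp add: T1_def)
  have "(\<lambda>j. X (s (q j))) \<longlonglongrightarrow> x" using LIMSEQ_subseq_LIMSEQ[OF Xs q(1)] by (simp add: o_def)
  then have Fs: "(\<lambda>j. F (s (q j))) \<longlonglongrightarrow> f x"
    unfolding F_def by (rule isCont_tendsto_compose[OF locally_lipschitz_isCont[OF lip]])
  have sq: "filterlim (\<lambda>j. s (q j)) at_top sequentially"
    by (rule filterlim_compose[OF s(2) filterlim_subseq[OF q(1)]])
  txt \<open>The values oscillate across \<open>c\<close>; after the last visit to level \<open>c\<close> before reaching \<open>c'\<close> they stay
    above \<open>c\<close> for a time at least \<open>T1\<close>.\<close>
  have upcrossing: "\<exists>t\<ge>real n. F t = c \<and> (\<forall>t'. t \<le> t' \<longrightarrow> t' \<le> t + T1 \<longrightarrow> c \<le> F t')" for n :: nat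
  proof -
    have "\<forall>\<^sub>F j in sequentially. real n < s (q j)" using sq unfolding filterlim_at_top_dense by blast
    then have "\<forall>\<^sub>F j in sequentially. real n < s (q j) \<and> F (s (q j) + T) < c"
      using order_tendstoD(2)[OF q(3) c(1)] by (rule eventually_conj)
    then obtain j where j: "real n < s (q j)" "F (s (q j) + T) < c"
      using eventually_happens trivial_limit_sequentially by blast
    define a where "a = s (q j) + T"
    have a: "real n \<le> a" "F a < c" using j T by (auto simp: a_def)
    have "\<forall>\<^sub>F j in sequentially. a < s (q j)" using sq unfolding filterlim_at_top_dense by blast
    then have "\<forall>\<^sub>F j in sequentially. a < s (q j) \<and> c' < F (s (q j))"
      using order_tendstoD(1)[OF Fs c'(2)] by (rule eventually_conj)
    then obtain i where i: "a < s (q i)" "c' < F (s (q i))"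
      using eventually_happens trivial_limit_sequentially by blast
    define b where "b = s (q i)"
    have b: "a < b" "c' < F b" using i by (auto simp: b_def)
    have a0: "a \<ge> 0" using a(1) by linarith
    have contab: "continuous_on {a..b} F" using contF by (rule continuous_on_subset) (use a0 in auto)
    define S where "S = {t\<in>{a..b}. F t \<le> c}"
    have "closed S" unfolding S_def by (rule continuous_on_closed_Collect_le[OF contab continuous_on_const closed_atLeastAtMost])
    moreover have "bounded S" by (rule bounded_subset[OF bounded_closed_interval[of a b]]) (auto simp: S_def)
    ultimately have "compact S" by (simp add: compact_eq_bounded_closed)
    have "a \<in> S" using a b by (auto simp: S_def)
    then have "S \<noteq> {}" by blast
    obtain t where t: "t \<in> S" "\<And>t'. t' \<in> S \<Longrightarrow> t' \<le> t"
      using compact_attains_sup[OF \<open>compact S\<close> \<open>S \<noteq> {}\<close>] by auto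
    have tab: "a \<le> t" "t \<le> b" "F t \<le> c" using t(1) by (auto simp: S_def)
    have "continuous_on {t..b} F" by (rule continuous_on_subset[OF contab]) (use tab in auto)
    moreover have "c \<le> F b" using b(2) c'(1) by linarith
    \<comment> \<open>If F t were below \<open>c\<close>, the value \<open>c\<close> would be taken
      later, at a point of \<open>S\<close> beyond its maximum.\<close>
    ultimately have "\<exists>t'\<ge>t. t' \<le> b \<and> F t' = c" using tab(2,3) IVT'[of F t c b] by blast
    then obtain t' where t': "t \<le> t'" "t' \<le> b" "F t' = c" by blast
    then have "t' \<in> S" using tab by (auto simp: S_def)
    then have Ft: "F t = c" using t(2)[of t'] t' by simp
    have "c' - c < F b - F t" using b(2) Ft by linarith
    also have "\<dots> \<le> (M * L) * (b - t)" using lipF[of t b] tab a0 by linarith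
    finally have "T1 < b - t" using M(1) L(1) by (simp add: T1_def pos_divide_less_eq mult.commute)
    moreover have "c \<le> F t''" if "t \<le> t''" "t'' \<le> b" for t''
    proof (rule ccontr)
      assume "\<not> c \<le> F t''"
      then have "t'' \<in> S" "F t'' \<noteq> c" using that tab by (auto simp: S_def)
      then show False using t(2)[of t''] that(1) Ft by simp
    qed
    ultimately show ?thesis using Ft tab(1) a(1) by (intro exI[of _ t]) auto
  qed
  then obtain \<theta> where \<theta>: "\<And>n::nat. real n \<le> \<theta> n" "\<And>n. F (\<theta> n) = c"
    "\<And>n t'. \<theta> n \<le> t' \<Longrightarrow> t' \<le> \<theta> n + T1 \<Longrightarrow> c \<le> F t'"
    by metis
  have \<theta>0: "\<theta> n \<ge> 0" for n using \<theta>(1)[of n] by linarith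
  have \<theta>_top: "filterlim \<theta> at_top sequentially"
    by (rule filterlim_at_top_mono[OF filterlim_real_sequentially]) (use \<theta>(1) in simp)
  have "norm (X (\<theta> n)) \<le> R" for n using R[OF \<theta>0] .
  then obtain y \<sigma> where \<sigma>: "strict_mono (\<sigma> :: nat \<Rightarrow> nat)" "(\<lambda>n. X (\<theta> (\<sigma> n))) \<longlonglongrightarrow> y"
    by (rule bounded_subsequence)
  define \<theta>' where "\<theta>' = (\<lambda>n. \<theta> (\<sigma> n))"
  have \<theta>': "\<And>n. \<theta>' n \<ge> 0" "filterlim \<theta>' at_top sequentially"
    unfolding \<theta>'_def using \<theta>0 filterlim_compose[OF \<theta>_top filterlim_subseq[OF \<sigma>(1)]] by auto
  have Xy: "(\<lambda>n. X (\<theta>' n)) \<longlonglongrightarrow> y" using \<sigma>(2) by (simp add: \<theta>'_def)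
  have "(\<lambda>n. F (\<theta>' n)) \<longlonglongrightarrow> f y"
    unfolding F_def by (rule isCont_tendsto_compose[OF locally_lipschitz_isCont[OF lip] Xy])
  then have fy: "f y = c" by (simp add: \<theta>'_def \<theta>(2) LIMSEQ_const_iff)
  obtain A where A: "A \<in> \<X>" "(y, f y) \<in> A"
    using whitney_stratificationD(2)[OF ws] graph_of_iff[of y "f y" f] by blast
  obtain w w' where w: "(w, w') \<in> tangent_space A (y, f y)" "w' \<noteq> 0" using c(3)[OF A fy] by blast
  obtain T2 where T2: "T2 > 0" "\<And>T. 0 < T \<Longrightarrow> T < T2 \<Longrightarrow>
    \<exists>q l. strict_mono (q :: nat \<Rightarrow> nat) \<and> l < f y \<and> (\<lambda>j. f (X (\<theta>' (q j) + T))) \<longlonglongrightarrow> l"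
    using limit_curve_descent[OF ws' \<theta>' Xy A w] by blast
  \<comment> \<open>Short enough both for descent from \<open>y\<close> and for the values to be
    still at least \<open>c\<close>.\<close>
  define T3 where "T3 = min T1 (T2 / 2)"
  have T3: "0 < T3" "T3 < T2" "T3 \<le> T1" using T1 T2(1) by (auto simp: T3_def)
  obtain q' l' where q': "l' < f y" "(\<lambda>j. F (\<theta>' (q' j) + T3)) \<longlonglongrightarrow> l'"
    using T2(2)[OF T3(1,2)] unfolding F_def by blast
  have "c \<le> F (\<theta>' (q' j) + T3)" for j
    unfolding \<theta>'_def by (rule \<theta>(3)[of "\<sigma> (q' j)"]) (use T3 in auto)
  then have "c \<le> l'"
    by (intro tendsto_lowerbound[OF q'(2) always_eventually trivial_limit_sequentially]) simp
  then show False using q'(1) fy by simp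
qed

end

section \<open>Passage to the strata of the domain\<close>

theorem corollary10:
  fixes f :: "real ^ 'n \<Rightarrow> real"
    and \<X> :: "((real ^ 'n) \<times> real) set set"
    and \<epsilon> :: "nat \<Rightarrow> real"
    and xs v :: "nat \<Rightarrow> real ^ 'n"
    and x :: "real ^ 'n"
    and r :: "nat \<Rightarrow> nat"
  assumes "locally_lipschitz f"
    and "whitney_stratifiable CARD('n) f"
    and "whitney_stratification CARD('n) (graph_of f) \<X>"
    and "step_sizes \<epsilon>"
    and "subgradient_sequence f \<epsilon> xs v"
    and "bounded (range xs)"
    and "x \<in> accumulation_set xs"
    and "strict_mono r"
    and "(\<lambda>j. xs (r j)) \<longlonglongrightarrow> x"
    and "limsup (\<lambda>j. ereal (norm (v (r j)))) > 0"
  shows "\<exists>S\<in>projected_strata \<X>. x \<in> S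
           \<and> (\<exists>d<CARD('n). submanifold CARD('n) d S)
           \<and> (\<forall>w\<in>tangent_space S x. (\<lambda>j. w \<bullet> v (r j)) \<longlonglongrightarrow> 0)"
proof -
  note lip = assms(1) and ws = assms(3)
  interpret bounded_subgradient_dynamics f \<epsilon> xs v
    by unfold_locales (rule assms)+
  obtain k where k: "CARD('n) = Suc k" using whitney_stratificationD(1)[OF ws] gr0_conv_Suc by blast
  note ws' = ws[unfolded k]
  have ws_dim: "whitney_stratification DIM(real ^ 'n) (graph_of f) \<X>" using ws by simp
  obtain A where A: "A \<in> \<X>" "(x, f x) \<in> A"
    using whitney_stratificationD(2)[OF ws] graph_of_iff[of x "f x" f] by blast
  have AG: "A \<subseteq> graph_of f" using A(1) whitney_stratificationD(2)[OF ws] by blast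
  obtain d where d: "submanifold (Suc k) d A" using whitney_stratificationD(6)[OF ws' A(1)] ..
  let ?T = "fst ` tangent_space A (x, f x)"
  \<comment> \<open>Criticality makes the slope w' zero, and the projection formula bounds w . v
    near \<open>x\<close> by any prescribed error around this slope.\<close>
  have orth: "(\<lambda>j. w \<bullet> v (r j)) \<longlonglongrightarrow> 0" if wT: "w \<in> ?T" for w
  proof -
    obtain w' where w: "(w, w') \<in> tangent_space A (x, f x)" using wT by auto
    have "w' = 0" by (rule accumulation_point_critical[OF ws_dim assms(8,9) A w])
    show ?thesis
    proof (rule LIMSEQ_I)
      fix e :: real assume "e > 0"
      then have "e / 2 > 0" by simp
      then obtain \<delta> where \<delta>: "\<delta> > 0"
        "\<And>z g. z \<in> ball x \<delta> \<Longrightarrow> g \<in> clarke_subdifferential f z \<Longrightarrow> \<bar>w \<bullet> g - w'\<bar> \<le> e / 2"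
        by (rule clarke_projection[OF lip ws' A w]) blast
      obtain N where N: "\<And>j. j \<ge> N \<Longrightarrow> norm (xs (r j) - x) < \<delta>" using LIMSEQ_D[OF assms(9) \<delta>(1)] by blast
      have "norm (w \<bullet> v (r j) - 0) < e" if "j \<ge> N" for j
      proof -
        have "xs (r j) \<in> ball x \<delta>" using N[OF that] by (simp add: dist_norm norm_minus_commute)
        from \<delta>(2)[OF this v_clarke] have "\<bar>w \<bullet> v (r j)\<bar> \<le> e / 2" using \<open>w' = 0\<close> by simp
        then show ?thesis using \<open>e > 0\<close> by simp
      qed
      then show "\<exists>N. \<forall>j\<ge>N. norm (w \<bullet> v (r j) - 0) < e" by blast
    qed
  qed
  have dimT: "dim ?T = d" "subspace ?T" using dim_fst_tangent_graph[OF lip AG d A(2)] by auto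
  \<comment> \<open>Otherwise every direction is the projection of a tangent vector, all coordinates
    of \<open>v (r j)\<close> tend to 0, and the limsup of the norms is 0.\<close>
  have "d < CARD('n)"
  proof (rule ccontr)
    assume "\<not> d < CARD('n)"
    then have "dim ?T = DIM(real ^ 'n)" using dimT(1) dim_subset_UNIV[of ?T] by simp
    then have "span ?T = UNIV" by (simp only: dim_eq_full)
    then have "?T = UNIV" using dimT(2) by (simp only: span_eq_iff[THEN iffD2])
    have "(\<lambda>j. \<Sum>b\<in>Basis. \<bar>v (r j) \<bullet> b\<bar>) \<longlonglongrightarrow> (\<Sum>b\<in>(Basis :: (real ^ 'n) set). 0)"
    proof (rule tendsto_sum)
      fix b :: "real ^ 'n"
      have "(\<lambda>j. b \<bullet> v (r j)) \<longlonglongrightarrow> 0" by (rule orth) (simp add: \<open>?T = UNIV\<close>)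
      then show "(\<lambda>j. \<bar>v (r j) \<bullet> b\<bar>) \<longlonglongrightarrow> 0" using tendsto_rabs by (fastforce simp: inner_commute)
    qed
    then have "(\<lambda>j. norm (v (r j))) \<longlonglongrightarrow> 0"
      by (intro Lim_null_comparison[OF always_eventually, of "\<lambda>j. norm (v (r j))"])
        (simp_all add: norm_le_l1)
    then have "(\<lambda>j. ereal (norm (v (r j)))) \<longlonglongrightarrow> 0" by (simp add: zero_ereal_def)
    then have "limsup (\<lambda>j. ereal (norm (v (r j)))) = 0" by (rule lim_imp_Limsup[OF trivial_limit_sequentially])
    then show False using assms(10) by simp
  qed
  moreover have "submanifold (Suc k) d (fst ` A)" by (rule projected_stratum_submanifold[OF lip AG d])
  \<comment> \<open>A tangent vector of the projected stratum has to be lifted: its secants are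
    completed by those of \<open>f\<close>, which are bounded by the Lipschitz condition, converge
    along a subsequence and yield a tangent vector of \<open>A\<close> above
    \<open>w\<close>.\<close>
  moreover have "w \<in> ?T" if w: "w \<in> tangent_space (fst ` A) x" for w
  proof -
    obtain y and t :: "nat \<Rightarrow> real" where y: "\<And>j. y j \<in> fst ` A" "y \<longlonglongrightarrow> x" "\<And>j. 0 < t j"
      "(\<lambda>j. (y j - x) /\<^sub>R t j) \<longlonglongrightarrow> w"
      by (rule tangent_secants[OF w]) blast
    have yA: "(y j, f (y j)) \<in> A" for j using y(1)[of j] AG by (auto simp: graph_of_def)
    have fy: "(\<lambda>j. f (y j)) \<longlonglongrightarrow> f x" by (rule isCont_tendsto_compose[OF locally_lipschitz_isCont[OF lip] y(2)])
    obtain \<rho> L where L: "\<rho> > 0" "L-lipschitz_on (ball x \<rho>) f" using lip unfolding locally_lipschitz_def by blast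
    obtain K where K: "K > 0" "\<And>j. norm ((y j - x) /\<^sub>R t j) \<le> K"
      using convergent_imp_Bseq[OF convergentI[OF y(4)]] unfolding Bseq_def by auto
    have L0: "L \<ge> 0" by (rule lipschitz_on_nonneg[OF L(2)])
    have "\<forall>\<^sub>F j in sequentially. y j \<in> ball x \<rho>" using y(2) L(1) by (intro topological_tendstoD) auto
    then obtain N where N: "\<And>j. j \<ge> N \<Longrightarrow> y j \<in> ball x \<rho>" unfolding eventually_sequentially by blast
    \<comment> \<open>Shifted by \<open>N\<close>, so that the Lipschitz estimate holds from the
      first index on.\<close>
    define h where "h = (\<lambda>j. (f (y (j + N)) - f x) /\<^sub>R t (j + N))"
    have "norm (h j) \<le> L * K" for j
    proof -
      have "\<bar>f (y (j + N)) - f x\<bar> \<le> L * norm (y (j + N) - x)"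
        using lipschitz_onD[OF L(2), of "y (j + N)" x] N[of "j + N"] L(1) by (simp add: dist_norm)
      then have "inverse (t (j + N)) * \<bar>f (y (j + N)) - f x\<bar> \<le> inverse (t (j + N)) * (L * norm (y (j + N) - x))"
        using y(3)[of "j + N"] by (intro mult_left_mono) auto
      also have "\<dots> = L * norm ((y (j + N) - x) /\<^sub>R t (j + N))" using y(3)[of "j + N"] by simp
      also have "\<dots> \<le> L * K" by (rule mult_left_mono[OF K(2) L0])
      finally show ?thesis using y(3)[of "j + N"] by (simp add: h_def abs_mult)
    qed
    then obtain w' \<sigma> where \<sigma>: "strict_mono (\<sigma> :: nat \<Rightarrow> nat)" "(\<lambda>j. h (\<sigma> j)) \<longlonglongrightarrow> w'"
      by (rule bounded_subsequence)
    define q where "q = (\<lambda>j. \<sigma> j + N)"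
    have q: "strict_mono q" using \<sigma>(1) by (simp add: q_def strict_mono_def)
    have "(w, w') \<in> tangent_space A (x, f x)"
    proof (rule secant_limit_tangent[OF d A(2)])
      show "(y (q j), f (y (q j))) \<in> A" for j by (rule yA)
      show "(\<lambda>j. (y (q j), f (y (q j)))) \<longlonglongrightarrow> (x, f x)"
        using LIMSEQ_subseq_LIMSEQ[OF tendsto_Pair[OF y(2) fy] q] by (simp add: o_def)
      have "(\<lambda>j. (y (q j) - x) /\<^sub>R t (q j)) \<longlonglongrightarrow> w" using LIMSEQ_subseq_LIMSEQ[OF y(4) q] by (simp add: o_def)
      moreover have "(\<lambda>j. (f (y (q j)) - f x) /\<^sub>R t (q j)) \<longlonglongrightarrow> w'" using \<sigma>(2) by (simp add: h_def q_def)
      ultimately show "(\<lambda>j. ((y (q j), f (y (q j))) - (x, f x)) /\<^sub>R t (q j)) \<longlonglongrightarrow> (w, w')"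
        using tendsto_Pair by fastforce
    qed
    then show ?thesis by force
  qed
  moreover have "fst ` A \<in> projected_strata \<X>" unfolding projected_strata_def using A(1) by blast
  moreover have "x \<in> fst ` A" using A(2) by force
  ultimately show ?thesis using orth k by (intro bexI[of _ "fst ` A"]) auto
qed
end
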